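(* Let $G_1,\dots,G_s\in L^2(\widehat H)$ and consider the associated $s\times r$ matrix $\mathbb{G}(\xi)=[G_j(\xi+\mu_k^\perp)]_{j=1,\dots,s;\ k=0,\dots,r-1}$, $\xi\in\Omega$. Then: (a) $\{\overline{G}_j\,\chi_m\}_{m\in M;\,j=1,\dots,s}$ is a complete system for $L^2(\widehat H)$ if and only if the rank of $\mathbb{G}(\xi)$ is $r$ for a.e. $\xi\in\Omega$. (b) $\{\overline{G}_j\,\chi_m\}_{m\in M;\,j=1,\dots,s}$ is a Bessel sequence for $L^2(\widehat H)$ if and only if $\beta_{\mathbb{G}}<\infty$. In this case, the optimal Bessel bound is $\beta_{\mathbb{G}}/r$. (c) $\{\overline{G}_j\,\chi_m\}_{m\in M;\,j=1,\dots,s}$ is a frame for $L^2(\widehat H)$ if and only if $0<\alpha_{\mathbb{G}}\le\beta_{\mathbb{G}}<\infty$. In this case, the optimal frame bounds are $\alpha_{\mathbb{G}}/r$ and $\beta_{\mathbb{G}}/r$. (d) $\{\overline{G}_j\,\chi_m\}_{m\in M;\,j=1,\dots,s}$ is a Riesz basis for $L^2(\widehat H)$ if and only if it is a frame for $L^2(\widehat H)$ and $s=r$.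
   Context: $G$ is a second countable locally compact abelian Hausdorff group, written additively. $M\subseteq H\subseteq G$ are countable (finite or countably infinite) uniform lattices in $G$, i.e. discrete subgroups with compact quotient in $G$; then $H/M$ is finite. $\widehat H$ is the (compact) dual group of $H$, with Haar measure $m_{\widehat H}$ normalized by $m_{\widehat H}(\widehat H)=1$; $(h,\gamma)\in\mathbb{T}$ denotes the value of $\gamma\in\widehat H$ at $h\in H$, and $\chi_h(\gamma)=(h,\gamma)$. $M^\perp=\{\gamma\in\widehat H:(m,\gamma)=1\ \forall m\in M\}=\{\mu_0^\perp=0,\mu_1^\perp,\dots,\mu_{r-1}^\perp\}$ is the (finite) annihilator of $M$ in $\widehat H$, of order $r$. $\Omega\subset\widehat H$ is a Borel section of $\widehat H/M^\perp$, i.e. $\widehat H$ is the disjoint union of $\mu_n^\perp+\Omega$, $n=0,\dots,r-1$. With $\mathbb{G}^*(\xi)$ the conjugate transpose of $\mathbb{G}(\xi)$ and $\lambda_{\min},\lambda_{\max}$ the smallest and largest eigenvalues, $\alpha_{\mathbb{G}}=\operatorname{ess\,inf}_{\xi\in\Omega}\lambda_{\min}[\mathbb{G}^*(\xi)\mathbb{G}(\xi)]$ and $\beta_{\mathbb{G}}=\operatorname{ess\,sup}_{\xi\in\Omega}\lambda_{\max}[\mathbb{G}^*(\xi)\mathbb{G}(\xi)]$, so $0\le\alpha_{\mathbb{G}}\le\beta_{\mathbb{G}}\le\infty$. *)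

theory Defs
  imports
    "HOL-Probability.Essential_Supremum"
    "Jordan_Normal_Form.Schur_Decomposition"
    "Jordan_Normal_Form.DL_Rank"
begin

definition additive_subgroup :: "'g::ab_group_add set \<Rightarrow> bool" where
  "additive_subgroup H \<longleftrightarrow> 0 \<in> H \<and> (\<forall>x\<in>H. \<forall>y\<in>H. x + y \<in> H) \<and> (\<forall>x\<in>H. - x \<in> H)"

definition coset :: "'g::ab_group_add set \<Rightarrow> 'g \<Rightarrow> 'g set" where
  "coset H x = (+) x ` H"

definition quotient_group_topology :: "'g::topological_ab_group_add set \<Rightarrow> 'g set topology" where
  "quotient_group_topology H = topology (\<lambda>W. W \<subseteq> range (coset H) \<and> open (coset H -` W))"

lemma openin_quotient_group_topology:
  "openin (quotient_group_topology H) W \<longleftrightarrow> W \<subseteq> range (coset H) \<and> open (coset H -` W)"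
proof -
  have "istopology (\<lambda>W. W \<subseteq> range (coset H) \<and> open (coset H -` W))"
    unfolding istopology_def by (auto simp: vimage_Union)
  then show ?thesis
    unfolding quotient_group_topology_def by (simp add: topology_inverse')
qed

definition uniform_lattice :: "'g::topological_ab_group_add set \<Rightarrow> bool" where
  "uniform_lattice H \<longleftrightarrow>
     additive_subgroup H \<and> discrete H \<and> compact_space (quotient_group_topology H)"

text \<open>A character of \<open>H\<close> is a function on the ambient group, made unique by being
  \<^const>\<open>undefined\<close> off \<open>H\<close>; the value \<open>(h, \<gamma>)\<close> is \<open>\<gamma> h\<close>. The dual group carries the
  compact-open topology. Its group operation, the pointwise product, is called addition.\<close>

definition dual :: "'g::topological_ab_group_add set \<Rightarrow> ('g \<Rightarrow> complex) set" where
  "dual H = {\<gamma> \<in> extensional H. continuous_on H \<gamma> \<and> (\<forall>x\<in>H. cmod (\<gamma> x) = 1) \<and>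
                (\<forall>x\<in>H. \<forall>y\<in>H. \<gamma> (x + y) = \<gamma> x * \<gamma> y)}"

definition dual_topology :: "'g::topological_ab_group_add set \<Rightarrow> ('g \<Rightarrow> complex) topology" where
  "dual_topology H =
     topology_generated_by {{\<gamma> \<in> dual H. \<gamma> ` K \<subseteq> U} | K U. K \<subseteq> H \<and> compact K \<and> open U}"

lemma topspace_dual_topology: "topspace (dual_topology H) = dual H"
  unfolding dual_topology_def topology_generated_by_topspace
  by (auto intro!: exI[of _ "{}"])

definition dual_zero :: "'g set \<Rightarrow> 'g \<Rightarrow> complex" where
  "dual_zero H = (\<lambda>h\<in>H. 1)"

definition dual_add :: "'g set \<Rightarrow> ('g \<Rightarrow> complex) \<Rightarrow> ('g \<Rightarrow> complex) \<Rightarrow> 'g \<Rightarrow> complex" where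
  "dual_add H \<gamma> \<delta> = (\<lambda>h\<in>H. \<gamma> h * \<delta> h)"

definition annihilator ::
    "'g::topological_ab_group_add set \<Rightarrow> 'g set \<Rightarrow> ('g \<Rightarrow> complex) set" where
  "annihilator H M = {\<gamma> \<in> dual H. \<forall>m\<in>M. \<gamma> m = 1}"

text \<open>Regularity of the measure need not be demanded: for a countable discrete \<open>H\<close> the dual is
  compact and metrizable, so that every finite Borel measure on it is regular.\<close>

definition normalized_haar_measure ::
    "'g::topological_ab_group_add set \<Rightarrow> ('g \<Rightarrow> complex) measure \<Rightarrow> bool" where
  "normalized_haar_measure H m \<longleftrightarrow>
     space m = dual H \<and>
     sets m = sigma_sets (dual H) {U. openin (dual_topology H) U} \<and>
     emeasure m (dual H) = 1 \<and>
     (\<forall>\<gamma>\<in>dual H. \<forall>A\<in>sets m. emeasure m (dual_add H \<gamma> ` A) = emeasure m A)"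

text \<open>Elements of \<open>L\<^sup>2\<close> are represented by square-integrable functions, and identities between
  them are identities almost everywhere. Families \<open>e\<close> are indexed by a set \<open>I\<close>.\<close>

definition L2 :: "'x measure \<Rightarrow> ('x \<Rightarrow> complex) set" where
  "L2 m = {f \<in> borel_measurable m. integrable m (\<lambda>x. (cmod (f x))\<^sup>2)}"

definition l2_inner :: "'x measure \<Rightarrow> ('x \<Rightarrow> complex) \<Rightarrow> ('x \<Rightarrow> complex) \<Rightarrow> complex" where
  "l2_inner m f g = (LINT x|m. f x * cnj (g x))"

definition l2_norm :: "'x measure \<Rightarrow> ('x \<Rightarrow> complex) \<Rightarrow> real" where
  "l2_norm m f = sqrt (LINT x|m. (cmod (f x))\<^sup>2)"

definition complete_system :: "'x measure \<Rightarrow> ('i \<Rightarrow> 'x \<Rightarrow> complex) \<Rightarrow> 'i set \<Rightarrow> bool" where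
  "complete_system m e I \<longleftrightarrow>
     (\<forall>f\<in>L2 m. \<forall>\<epsilon>>0. \<exists>F c. finite F \<and> F \<subseteq> I \<and> l2_norm m (\<lambda>x. f x - (\<Sum>i\<in>F. c i * e i x)) < \<epsilon>)"

definition bessel_bound ::
    "'x measure \<Rightarrow> ('i \<Rightarrow> 'x \<Rightarrow> complex) \<Rightarrow> 'i set \<Rightarrow> real \<Rightarrow> bool" where
  "bessel_bound m e I B \<longleftrightarrow> 0 < B \<and>
     (\<forall>f\<in>L2 m. (\<Sum>\<^sub>\<infinity>i\<in>I. ennreal ((cmod (l2_inner m f (e i)))\<^sup>2)) \<le> ennreal (B * (l2_norm m f)\<^sup>2))"

definition lower_frame_bound ::
    "'x measure \<Rightarrow> ('i \<Rightarrow> 'x \<Rightarrow> complex) \<Rightarrow> 'i set \<Rightarrow> real \<Rightarrow> bool" where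
  "lower_frame_bound m e I A \<longleftrightarrow> 0 < A \<and>
     (\<forall>f\<in>L2 m. ennreal (A * (l2_norm m f)\<^sup>2) \<le> (\<Sum>\<^sub>\<infinity>i\<in>I. ennreal ((cmod (l2_inner m f (e i)))\<^sup>2)))"

definition bessel_sequence :: "'x measure \<Rightarrow> ('i \<Rightarrow> 'x \<Rightarrow> complex) \<Rightarrow> 'i set \<Rightarrow> bool" where
  "bessel_sequence m e I \<longleftrightarrow> (\<exists>B. bessel_bound m e I B)"

definition frame :: "'x measure \<Rightarrow> ('i \<Rightarrow> 'x \<Rightarrow> complex) \<Rightarrow> 'i set \<Rightarrow> bool" where
  "frame m e I \<longleftrightarrow> (\<exists>A B. lower_frame_bound m e I A \<and> bessel_bound m e I B)"

text \<open>Meaningful for Bessel sequences and for frames, respectively.\<close>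

definition optimal_upper_bound :: "'x measure \<Rightarrow> ('i \<Rightarrow> 'x \<Rightarrow> complex) \<Rightarrow> 'i set \<Rightarrow> real" where
  "optimal_upper_bound m e I = Inf {B. bessel_bound m e I B}"

definition optimal_lower_bound :: "'x measure \<Rightarrow> ('i \<Rightarrow> 'x \<Rightarrow> complex) \<Rightarrow> 'i set \<Rightarrow> real" where
  "optimal_lower_bound m e I = Sup {A. lower_frame_bound m e I A}"

definition orthonormal_basis :: "'x measure \<Rightarrow> ('i \<Rightarrow> 'x \<Rightarrow> complex) \<Rightarrow> 'i set \<Rightarrow> bool" where
  "orthonormal_basis m b I \<longleftrightarrow>
     (\<forall>i\<in>I. b i \<in> L2 m) \<and>
     (\<forall>i\<in>I. \<forall>j\<in>I. l2_inner m (b i) (b j) = (if i = j then 1 else 0)) \<and>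
     complete_system m b I"

text \<open>Linearity and boundedness together make such a map respect equality almost everywhere.\<close>

definition l2_bounded_operator ::
    "'x measure \<Rightarrow> (('x \<Rightarrow> complex) \<Rightarrow> 'x \<Rightarrow> complex) \<Rightarrow> bool" where
  "l2_bounded_operator m U \<longleftrightarrow>
     (\<forall>f\<in>L2 m. U f \<in> L2 m) \<and>
     (\<forall>f\<in>L2 m. \<forall>g\<in>L2 m. \<forall>c d. AE x in m. U (\<lambda>y. c * f y + d * g y) x = c * U f x + d * U g x) \<and>
     (\<exists>C. \<forall>f\<in>L2 m. l2_norm m (U f) \<le> C * l2_norm m f)"

definition riesz_basis :: "'x measure \<Rightarrow> ('i \<Rightarrow> 'x \<Rightarrow> complex) \<Rightarrow> 'i set \<Rightarrow> bool" where
  "riesz_basis m e I \<longleftrightarrow>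
     (\<exists>b U V. orthonormal_basis m b I \<and> l2_bounded_operator m U \<and> l2_bounded_operator m V \<and>
        (\<forall>f\<in>L2 m. (AE x in m. V (U f) x = f x) \<and> (AE x in m. U (V f) x = f x)) \<and>
        (\<forall>i\<in>I. AE x in m. U (b i) x = e i x))"

definition modulated_system ::
    "(nat \<Rightarrow> ('g \<Rightarrow> complex) \<Rightarrow> complex) \<Rightarrow> 'g \<times> nat \<Rightarrow> ('g \<Rightarrow> complex) \<Rightarrow> complex" where
  "modulated_system G = (\<lambda>(h, j) \<gamma>. cnj (G j \<gamma>) * \<gamma> h)"

text \<open>Matrix indices start at \<open>0\<close>, whereas the functions are \<open>G 1, \<dots>, G s\<close>.\<close>

definition fiber_matrix ::
    "'g set \<Rightarrow> (nat \<Rightarrow> 'g \<Rightarrow> complex) \<Rightarrow> nat \<Rightarrow> nat \<Rightarrow> (nat \<Rightarrow> ('g \<Rightarrow> complex) \<Rightarrow> complex)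
      \<Rightarrow> ('g \<Rightarrow> complex) \<Rightarrow> complex mat" where
  "fiber_matrix H \<mu> s r G \<xi> = mat s r (\<lambda>(j, k). G (Suc j) (dual_add H \<xi> (\<mu> k)))"

abbreviation matrix_rank :: "complex mat \<Rightarrow> nat" where
  "matrix_rank A \<equiv> vec_space.rank (dim_row A) A"

text \<open>For Hermitian matrices, all of whose eigenvalues are real.\<close>

definition lambda_min :: "complex mat \<Rightarrow> real" where
  "lambda_min A = Min {x. eigenvalue A (complex_of_real x)}"

definition lambda_max :: "complex mat \<Rightarrow> real" where
  "lambda_max A = Max {x. eigenvalue A (complex_of_real x)}"

definition essinf :: "'x measure \<Rightarrow> ('x \<Rightarrow> ereal) \<Rightarrow> ereal" where
  "essinf m f = - esssup m (\<lambda>x. - f x)"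

definition alpha_const :: "'x measure \<Rightarrow> 'x set \<Rightarrow> ('x \<Rightarrow> complex mat) \<Rightarrow> ereal" where
  "alpha_const m \<Omega> A =
     essinf (restrict_space m \<Omega>) (\<lambda>\<xi>. ereal (lambda_min (mat_adjoint (A \<xi>) * A \<xi>)))"

definition beta_const :: "'x measure \<Rightarrow> 'x set \<Rightarrow> ('x \<Rightarrow> complex mat) \<Rightarrow> ereal" where
  "beta_const m \<Omega> A =
     esssup (restrict_space m \<Omega>) (\<lambda>\<xi>. ereal (lambda_max (mat_adjoint (A \<xi>) * A \<xi>)))"

end

theory Submission
  imports Defs "HOL-Probability.Probability_Measure"
begin

text \<open>
  Everything is decided on the fibers of the quotient of the dual group by the annihilator of \<open>M\<close>.
  The translates of \<open>\<Omega>\<close> by the elements \<open>\<mu> k\<close> tile the dual group, so a function \<open>f\<close> is the same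
  thing as the field of vectors \<open>f (\<xi> + \<mu> k)\<close>, \<open>k < r\<close>, over the points \<open>\<xi>\<close> of \<open>\<Omega>\<close>, and its
  squared norm is the integral over \<open>\<Omega>\<close> of the squared lengths of these vectors (\<open>l2_norm_fiber\<close>).
  Write \<open>a\<close> for the matrix attached to \<open>\<xi>\<close>. A character \<open>\<chi>\<close> coming from \<open>M\<close> is invariant under
  translation by \<open>\<mu> k\<close>; hence the inner product of \<open>f\<close> with the conjugate of \<open>G j\<close> times \<open>\<chi>\<close> is,
  up to the factor \<open>1 / r\<close>, the Fourier coefficient at \<open>\<chi>\<close> of the periodization of \<open>f * G j\<close>, and
  the value of that periodization at \<open>\<xi>\<close> is a coordinate of \<open>a\<close> applied to the fiber of \<open>f\<close>. As
  the characters of \<open>M\<close> are an orthonormal basis of the periodic functions, Parseval's identity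
  gives \<open>frame_sum\<close>: the sum of the squared moduli of the inner products is \<open>1 / r\<close> times the
  integral over \<open>\<Omega>\<close> of the squared length of \<open>a\<close> applied to the fiber of \<open>f\<close>.

  The bounds follow from this identity. A Bessel or lower frame bound means an inequality between
  the integrals of two quadratic forms in the fibers. Tested on functions whose fiber is a
  constant vector over a subset of \<open>\<Omega>\<close>, it becomes an inequality at almost every point, for a
  countable dense set of vectors and hence for all (\<open>bessel_bound_iff\<close>, \<open>lower_frame_bound_iff\<close>).
  Rayleigh quotients translate it into a bound on the extremal eigenvalues of \<open>a\<^sup>* a\<close>
  (\<open>lambda_max_le_iff\<close>, \<open>le_lambda_min_iff\<close>).

  For completeness, note that the fibers of linear combinations of the system are \<open>a\<^sup>* p\<close> with
  vectors \<open>p\<close> of trigonometric polynomials over \<open>M\<close>. If these combinations are dense, then the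
  range of \<open>a\<^sup>*\<close> contains all vectors for almost every \<open>\<xi>\<close>, so \<open>a\<close> has no kernel
  (\<open>complete_imp_injective\<close>). If \<open>a\<close> has no kernel, then \<open>p = a (a\<^sup>* a)\<inverse> F\<close> solves \<open>a\<^sup>* p = F\<close> for
  the fiber \<open>F\<close> of a given function; Cramer's rule makes \<open>p\<close> measurable, and after truncation it
  can be approximated by trigonometric polynomials (\<open>injective_imp_complete\<close>).

  A Riesz basis is a frame, and it is stable: the coefficients of a combination are bounded by its
  norm. On the fibers, stability says that \<open>a\<^sup>*\<close> is bounded below (\<open>stable_imp_s_le_r\<close>). So
  neither \<open>a\<close> nor \<open>a\<^sup>*\<close> has a kernel, and \<open>a\<close> is square. Conversely, for a frame with \<open>s = r\<close> the
  fiberwise action of \<open>a\<^sup>*\<close>, divided by the square root of \<open>r\<close>, is a bounded operator with bounded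
  inverse that maps an orthonormal basis to the system (\<open>frame_imp_riesz\<close>).

  Two facts about the dual group are used. The characters of \<open>H\<close> separate points from subgroups
  (\<open>separating_character\<close>); together with the invariance of the measure this gives orthogonality.
  And the trigonometric polynomials over \<open>M\<close> are dense among the bounded periodic functions, in
  the space of square-integrable functions for every integrable weight (\<open>periodic_density\<close>); this
  is a monotone class argument, as the characters generate the Borel sets when \<open>H\<close> is countable
  and discrete.
\<close>

section \<open>Matrices as quadratic forms\<close>

text \<open>Matrices and vectors are functions of natural numbers, of which only the arguments below the
  dimension matter. A field of matrices is then a family of scalar functions, to which
  measurability and integrals apply entry by entry.\<close>

definition mat_app :: "nat \<Rightarrow> (nat \<Rightarrow> nat \<Rightarrow> complex) \<Rightarrow> (nat \<Rightarrow> complex) \<Rightarrow> nat \<Rightarrow> complex" where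
  "mat_app n a v j = (\<Sum>k<n. a j k * v k)"

definition norm_sq :: "nat \<Rightarrow> (nat \<Rightarrow> complex) \<Rightarrow> real" where
  "norm_sq n v = (\<Sum>k<n. (cmod (v k))\<^sup>2)"

definition injective :: "nat \<Rightarrow> nat \<Rightarrow> (nat \<Rightarrow> nat \<Rightarrow> complex) \<Rightarrow> bool" where
  "injective s r a \<longleftrightarrow> (\<forall>v. (\<forall>j<s. mat_app r a v j = 0) \<longrightarrow> (\<forall>k<r. v k = 0))"

definition gram :: "nat \<Rightarrow> (nat \<Rightarrow> nat \<Rightarrow> complex) \<Rightarrow> nat \<Rightarrow> nat \<Rightarrow> complex" where
  "gram s a k l = (\<Sum>j<s. cnj (a j k) * a j l)"

lemma norm_sq_nonneg: "0 \<le> norm_sq n v"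
  by (simp add: norm_sq_def sum_nonneg)

lemma norm_sq_eq_0_iff: "norm_sq n v = 0 \<longleftrightarrow> (\<forall>k<n. v k = 0)"
  by (auto simp: norm_sq_def sum_nonneg_eq_0_iff)

lemma of_real_norm_sq: "complex_of_real (norm_sq n v) = (\<Sum>k<n. cnj (v k) * v k)"
  unfolding norm_sq_def of_real_sum
  by (intro sum.cong refl) (simp only: complex_norm_square mult.commute)

lemma norm_sq_scale: "norm_sq n (\<lambda>k. c * v k) = (cmod c)\<^sup>2 * norm_sq n v"
  by (simp add: norm_sq_def norm_mult power_mult_distrib sum_distrib_left)

lemma mat_app_scale: "mat_app n a (\<lambda>k. c * v k) = (\<lambda>j. c * mat_app n a v j)"
  by (simp add: fun_eq_iff mat_app_def sum_distrib_left algebra_simps)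

lemma mat_app_diff: "mat_app n a (\<lambda>k. u k - v k) = (\<lambda>j. mat_app n a u j - mat_app n a v j)"
  by (simp add: fun_eq_iff mat_app_def algebra_simps sum_subtractf)

lemma cmod_sum_sq_le: "(cmod (\<Sum>k\<in>I. a k * v k))\<^sup>2 \<le> (\<Sum>k\<in>I. (cmod (a k))\<^sup>2) * (\<Sum>k\<in>I. (cmod (v k))\<^sup>2)"
proof -
  have "(cmod (\<Sum>k\<in>I. a k * v k))\<^sup>2 \<le> (\<Sum>k\<in>I. cmod (a k) * cmod (v k))\<^sup>2"
    by (intro power_mono) (auto simp: norm_mult intro!: sum_norm_le)
  also have "\<dots> \<le> (\<Sum>k\<in>I. (cmod (a k))\<^sup>2) * (\<Sum>k\<in>I. (cmod (v k))\<^sup>2)"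
    by (rule Cauchy_Schwarz_ineq_sum)
  finally show ?thesis .
qed

lemma norm_sq_mat_app_le:
  "norm_sq s (mat_app r a v) \<le> (\<Sum>j<s. \<Sum>k<r. (cmod (a j k))\<^sup>2) * norm_sq r v"
  unfolding norm_sq_def mat_app_def sum_distrib_right[of _ "{..<s}"]
  by (intro sum_mono cmod_sum_sq_le)

lemma mult_mat_vec_eq_mat_app:
  "mat s r (\<lambda>(j, k). a j k) *\<^sub>v vec r v = vec s (mat_app r a v)"
  by (intro eq_vecI) (auto simp: scalar_prod_def mat_app_def lessThan_atLeast0)

lemma injective_iff_mat:
  "injective s r a \<longleftrightarrow>
     (\<forall>v\<in>carrier_vec r. mat s r (\<lambda>(j, k). a j k) *\<^sub>v v = 0\<^sub>v s \<longrightarrow> v = 0\<^sub>v r)"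
proof -
  have *: "(vec n f = 0\<^sub>v n) \<longleftrightarrow> (\<forall>k<n. f k = 0)" for n and f :: "nat \<Rightarrow> complex"
    by (auto simp: vec_eq_iff)
  have "v = vec r (\<lambda>k. v $ k)" if "v \<in> carrier_vec r" for v :: "complex vec"
    using that by auto
  then have **: "(\<forall>v\<in>carrier_vec r. P v) \<longleftrightarrow> (\<forall>f. P (vec r f))" for P :: "complex vec \<Rightarrow> bool"
    by (metis vec_carrier)
  show ?thesis
    unfolding injective_def ** mult_mat_vec_eq_mat_app * ..
qed

text \<open>Full column rank is linear independence of the columns. The rank is computed from the set of
  columns, in which a repeated column leaves no trace; but two equal columns \<open>i\<close> and \<open>j\<close> give the
  kernel vector \<open>unit_vec r i - unit_vec r j\<close> and leave fewer than \<open>r\<close> columns.\<close>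

lemma matrix_rank_eq_iff_injective:
  "matrix_rank (mat s r (\<lambda>(j, k). a j k)) = r \<longleftrightarrow> injective s r a"
proof -
  define A where "A = mat s r (\<lambda>(j, k). a j k)"
  have A: "A \<in> carrier_mat s r" by (simp add: A_def)
  interpret vec_space "TYPE(complex)" s .
  have "rank A = r \<longleftrightarrow> (\<forall>v\<in>carrier_vec r. A *\<^sub>v v = 0\<^sub>v s \<longrightarrow> v = 0\<^sub>v r)"
  proof (cases "distinct (cols A)")
    case True
    then show ?thesis
      using lin_indpt_full_rank[OF A True] full_rank_lin_indpt[OF A _ True] lin_depI[OF A _ _ _ True]
        lin_depE[OF A _ True] by metis
  next
    case False
    have "\<exists>S. maximal S (\<lambda>T. T \<subseteq> set (cols A) \<and> lin_indpt T)"
      using maximal_exists[of "(\<lambda>T. T \<subseteq> set (cols A) \<and> lin_indpt T)" "card (set (cols A))" "{}"]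
      by (meson List.finite_set card_mono empty_iff empty_subsetI finite_lin_indpt2 rev_finite_subset)
    then obtain S where S: "maximal S (\<lambda>T. T \<subseteq> set (cols A) \<and> lin_indpt T)" by blast
    then have "card S \<le> card (set (cols A))" by (simp add: card_mono maximal_def)
    also have "\<dots> < r"
      using False A by (metis card_distinct card_length carrier_matD(2) cols_length nat_less_le)
    finally have 1: "rank A \<noteq> r"
      using rank_card_indpt[OF A S] by simp
    obtain i j where ij: "i \<noteq> j" "i < r" "j < r" "col A i = col A j"
      using False A unfolding distinct_conv_nth by auto
    define v :: "complex vec" where "v = unit_vec r i - unit_vec r j"
    have v: "v \<in> carrier_vec r" by (simp add: v_def)
    have "v $ i = 1" using ij by (simp add: v_def)
    then have "v \<noteq> 0\<^sub>v r" using ij by auto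
    have col: "A *\<^sub>v unit_vec r i = col A i" if "i < r" for i
      using A that by (intro eq_vecI) (auto simp: scalar_prod_right_unit)
    have "A *\<^sub>v v = 0\<^sub>v s"
      unfolding v_def using A ij
      by (subst mult_minus_distrib_mat_vec[of _ s r]) (auto simp: col)
    with \<open>v \<noteq> 0\<^sub>v r\<close> show ?thesis using 1 v by blast
  qed
  moreover have "dim_row A = s" using A by simp
  ultimately show ?thesis unfolding injective_iff_mat A_def by simp
qed

text \<open>With fewer rows than columns, rows of zeros make the matrix square without changing its
  kernel, and a zero row makes the determinant vanish.\<close>

lemma injective_imp_le:
  assumes "injective s r a"
  shows "r \<le> s"
proof (rule ccontr)
  assume "\<not> r \<le> s"
  define b where "b = (\<lambda>j k. if j < s then a j k else 0)"
  define B where "B = mat r r (\<lambda>(j, k). b j k)"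
  have B: "B \<in> carrier_mat r r" by (simp add: B_def)
  have "row B s = 0\<^sub>v r"
    using \<open>\<not> r \<le> s\<close> by (intro eq_vecI) (auto simp: B_def b_def)
  then have "B = mat\<^sub>r r r (\<lambda>i. if i = s then 0\<^sub>v r else row B i)"
    using B by (intro eq_rowI) auto
  moreover have "det (mat\<^sub>r r r (\<lambda>i. if i = s then 0\<^sub>v r else row B i)) = 0"
    using \<open>\<not> r \<le> s\<close> B by (intro det_row_0) auto
  ultimately have "det B = 0" by simp
  then have "\<not> injective r r b"
    unfolding injective_iff_mat using det_0_iff_vec_prod_zero_field[OF B] by (auto simp: B_def)
  then obtain v k where v: "\<And>j. j < r \<Longrightarrow> mat_app r b v j = 0" and k: "k < r" "v k \<noteq> 0"
    unfolding injective_def by blast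
  have "mat_app r a v j = 0" if "j < s" for j
    using v[of j] that \<open>\<not> r \<le> s\<close> by (simp add: mat_app_def b_def)
  then have "\<not> injective s r a"
    unfolding injective_def using k by blast
  with assms show False by simp
qed

text \<open>Cramer's rule, so that the entries of the inverse are seen to depend measurably on those of
  \<open>c\<close>.\<close>

definition inverse_entries :: "nat \<Rightarrow> (nat \<Rightarrow> nat \<Rightarrow> complex) \<Rightarrow> nat \<Rightarrow> nat \<Rightarrow> complex" where
  "inverse_entries n c k l =
     adj_mat (mat n n (\<lambda>(k, l). c k l)) $$ (k, l) / det (mat n n (\<lambda>(k, l). c k l))"

lemma inverse_entries:
  assumes "injective n n c" and "k < n"
  shows "mat_app n (inverse_entries n c) (mat_app n c v) k = v k"
    and "mat_app n c (mat_app n (inverse_entries n c) v) k = v k"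
proof -
  define A where "A = mat n n (\<lambda>(k, l). c k l)"
  define D where "D = mat n n (\<lambda>(k, l). inverse_entries n c k l)"
  have A: "A \<in> carrier_mat n n" and D: "D \<in> carrier_mat n n" by (simp_all add: A_def D_def)
  have "det A \<noteq> 0"
    using assms(1) unfolding injective_iff_mat det_0_iff_vec_prod_zero_field[OF A] by (auto simp: A_def)
  have D': "D = (1 / det A) \<cdot>\<^sub>m adj_mat A"
    using adj_mat(1)[OF A] by (intro eq_matI) (auto simp: D_def inverse_entries_def A_def)
  have "D * A = 1\<^sub>m n"
    unfolding D' using adj_mat[OF A] A \<open>det A \<noteq> 0\<close>
    by (subst mult_smult_assoc_mat[of _ n n _ n]) (auto intro!: eq_matI)
  moreover have "A * D = 1\<^sub>m n"
    unfolding D' using adj_mat[OF A] A \<open>det A \<noteq> 0\<close>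
    by (subst mult_smult_distrib[of _ n n _ n]) (auto intro!: eq_matI)
  ultimately have "D *\<^sub>v (A *\<^sub>v vec n v) = vec n v" "A *\<^sub>v (D *\<^sub>v vec n v) = vec n v"
    using A D by (metis assoc_mult_mat_vec one_mult_mat_vec vec_carrier)+
  then have "vec n (mat_app n (inverse_entries n c) (mat_app n c v)) = vec n v"
    "vec n (mat_app n c (mat_app n (inverse_entries n c) v)) = vec n v"
    by (simp_all only: A_def D_def mult_mat_vec_eq_mat_app)
  then show "mat_app n (inverse_entries n c) (mat_app n c v) k = v k"
    "mat_app n c (mat_app n (inverse_entries n c) v) k = v k"
    using assms(2) by (metis index_vec)+
qed

text \<open>The gap is computed without any spectral theory. Let \<open>Q\<close> be the form of \<open>c\<close> and \<open>w = c v\<close>.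
  If \<open>K\<close> bounds \<open>Q\<close> on unit vectors, then positivity of \<open>Q\<close> at the vector \<open>v - w / K\<close> gives
  \<open>norm_sq n w \<le> K * Q v v\<close>; and \<open>v\<close> is controlled by \<open>w\<close> through the inverse of \<open>c\<close>.\<close>

lemma definite_imp_uniformly_definite:
  assumes inj: "injective n n c"
    and herm: "\<And>k l. k < n \<Longrightarrow> l < n \<Longrightarrow> c l k = cnj (c k l)"
    and psd: "\<And>v. 0 \<le> Re (\<Sum>k<n. cnj (v k) * mat_app n c v k)"
  obtains \<delta> where "\<delta> > 0" "\<And>v. \<delta> * norm_sq n v \<le> Re (\<Sum>k<n. cnj (v k) * mat_app n c v k)"
proof -
  define Q where "Q u v = (\<Sum>k<n. cnj (u k) * mat_app n c v k)" for u v
  define K where "K = 1 + (\<Sum>j<n. \<Sum>k<n. (cmod (c j k))\<^sup>2)"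
  define K' where "K' = 1 + (\<Sum>j<n. \<Sum>k<n. (cmod (inverse_entries n c j k))\<^sup>2)"
  have K: "K \<ge> 1" "K' \<ge> 1" unfolding K_def K'_def by (simp_all add: sum_nonneg)
  have herm': "Q u v = cnj (Q v u)" for u v
  proof -
    have "Q u v = (\<Sum>k<n. \<Sum>l<n. cnj (u k) * c k l * v l)"
      by (simp add: Q_def mat_app_def sum_distrib_left mult.assoc)
    also have "\<dots> = (\<Sum>l<n. \<Sum>k<n. cnj (u k) * c k l * v l)" by (rule sum.swap)
    also have "\<dots> = (\<Sum>l<n. \<Sum>k<n. cnj (cnj (v l) * c l k * u k))"
    proof (intro sum.cong refl)
      fix k l assume "k \<in> {..<n}" "l \<in> {..<n}"
      then have "c k l = cnj (c l k)" using herm[of l k] by simp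
      then show "cnj (u k) * c k l * v l = cnj (cnj (v l) * c l k * u k)" by simp
    qed
    also have "\<dots> = cnj (Q v u)"
      by (simp add: Q_def mat_app_def sum_distrib_left mult.assoc)
    finally show ?thesis .
  qed
  have "norm_sq n v \<le> K * K' * K' * Re (Q v v)" for v
  proof -
    define w where "w = mat_app n c v"
    have "norm_sq n v = norm_sq n (mat_app n (inverse_entries n c) w)"
      unfolding norm_sq_def w_def by (intro sum.cong) (auto simp: inverse_entries(1)[OF inj])
    also have "\<dots> \<le> (K' - 1) * norm_sq n w"
      using norm_sq_mat_app_le by (simp add: K'_def)
    also have "\<dots> \<le> K' * norm_sq n w"
      by (simp add: norm_sq_nonneg mult_right_mono)
    finally have 1: "norm_sq n v \<le> K' * norm_sq n w" .
    have Qw: "Re (Q w w) \<le> K * norm_sq n w"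
    proof -
      have "norm_sq n (mat_app n c w) \<le> (K - 1) * norm_sq n w"
        using norm_sq_mat_app_le by (simp add: K_def)
      also have "\<dots> \<le> (K * K) * norm_sq n w"
        using K by (intro mult_right_mono norm_sq_nonneg) (smt (verit) mult_le_cancel_left1)
      finally have *: "norm_sq n (mat_app n c w) \<le> K\<^sup>2 * norm_sq n w" by (simp add: power2_eq_square)
      have "(Re (Q w w))\<^sup>2 \<le> (cmod (Q w w))\<^sup>2"
        by (simp add: cmod_power2)
      also have "\<dots> \<le> (\<Sum>k<n. (cmod (cnj (w k)))\<^sup>2) * norm_sq n (mat_app n c w)"
        unfolding Q_def norm_sq_def by (rule cmod_sum_sq_le)
      also have "\<dots> = norm_sq n w * norm_sq n (mat_app n c w)" by (simp add: norm_sq_def)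
      also have "\<dots> \<le> norm_sq n w * (K\<^sup>2 * norm_sq n w)"
        using * by (intro mult_left_mono norm_sq_nonneg)
      finally have "(Re (Q w w))\<^sup>2 \<le> (K * norm_sq n w)\<^sup>2" by (simp add: power2_eq_square algebra_simps)
      then show ?thesis using K norm_sq_nonneg[of n w] by (meson dual_order.trans mult_nonneg_nonneg power2_le_imp_le zero_le_one)
    qed
    have Qvw: "Q w v = norm_sq n w"
      by (simp add: Q_def w_def[symmetric] of_real_norm_sq)
    have expand: "Q (\<lambda>k. v k - t * w k) (\<lambda>k. v k - t * w k) =
        Q v v - t * Q v w - cnj t * Q w v + cnj t * t * Q w w" for t
      by (simp add: Q_def mat_app_diff mat_app_scale algebra_simps sum.distrib sum_subtractf sum_distrib_left)
    \<comment> \<open>This \<open>t\<close> minimizes the bound \<open>K * t\<^sup>2 - 2 * t\<close> for the terms that depend on \<open>t\<close>, in units of \<open>norm_sq n w\<close>.\<close>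
    define t where "t = complex_of_real (1 / K)"
    have "0 \<le> Re (Q (\<lambda>k. v k - t * w k) (\<lambda>k. v k - t * w k))"
      using psd unfolding Q_def .
    also have "\<dots> = Re (Q v v) - 2 / K * norm_sq n w + 1 / K\<^sup>2 * Re (Q w w)"
      unfolding expand using Qvw herm'[of v w] by (simp add: t_def power2_eq_square)
    also have "\<dots> \<le> Re (Q v v) - 2 / K * norm_sq n w + 1 / K\<^sup>2 * (K * norm_sq n w)"
      using Qw by (intro add_left_mono mult_left_mono) auto
    also have "\<dots> = Re (Q v v) - norm_sq n w / K"
      using K by (simp add: power2_eq_square field_simps)
    finally have 2: "norm_sq n w \<le> K * Re (Q v v)" using K by (simp add: field_simps)
    have "norm_sq n v \<le> K' * (K * Re (Q v v))"
      using 1 2 K by (meson dual_order.trans mult_left_mono zero_le_one)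
    also have "\<dots> \<le> K' * (K' * (K * Re (Q v v)))"
      using K mult_right_mono[of 1 K' "K * Re (Q v v)"] psd[of v]
      by (intro mult_left_mono) (auto simp: Q_def[symmetric])
    finally show ?thesis by (simp add: algebra_simps)
  qed
  then have "1 / (K * K' * K') * norm_sq n v \<le> Re (Q v v)" for v
    using K by (simp add: field_simps)
  then show thesis
    using K by (intro that[of "1 / (K * K' * K')"]) (auto simp: Q_def)
qed

lemma gram_form:
  "(\<Sum>k<r. cnj (u k) * mat_app r (gram s a) v k) = (\<Sum>j<s. cnj (mat_app r a u j) * mat_app r a v j)"
proof -
  have "cnj (u k) * mat_app r (gram s a) v k = (\<Sum>j<s. \<Sum>l<r. cnj (u k) * cnj (a j k) * a j l * v l)"
    for k
  proof -
    have "cnj (u k) * mat_app r (gram s a) v k = (\<Sum>l<r. \<Sum>j<s. cnj (u k) * cnj (a j k) * a j l * v l)"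
      by (simp add: mat_app_def gram_def sum_distrib_left sum_distrib_right mult.assoc)
    then show ?thesis by (subst sum.swap)
  qed
  then have "(\<Sum>k<r. cnj (u k) * mat_app r (gram s a) v k) =
      (\<Sum>k<r. \<Sum>j<s. \<Sum>l<r. cnj (u k) * cnj (a j k) * a j l * v l)"
    by simp
  also have "\<dots> = (\<Sum>j<s. \<Sum>k<r. \<Sum>l<r. cnj (u k) * cnj (a j k) * a j l * v l)"
    by (rule sum.swap)
  also have "\<dots> = (\<Sum>j<s. cnj (mat_app r a u j) * mat_app r a v j)"
    by (simp add: mat_app_def sum_product mult.assoc mult.left_commute)
  finally show ?thesis .
qed

lemma mat_adjoint_mult_eq_gram:
  "mat_adjoint (mat s r (\<lambda>(j, k). a j k)) * mat s r (\<lambda>(j, k). a j k) = mat r r (\<lambda>(k, l). gram s a k l)"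
  by (intro eq_matI)
    (auto simp: mat_adjoint_def gram_def scalar_prod_def mat_of_rows_def lessThan_atLeast0)

lemma eigenvalue_mat_iff:
  "eigenvalue (mat n n (\<lambda>(k, l). c k l)) x \<longleftrightarrow>
     (\<exists>v. (\<exists>k<n. v k \<noteq> 0) \<and> (\<forall>k<n. mat_app n c v k = x * v k))"
proof -
  have v: "v = vec n (\<lambda>k. v $ k)" if "v \<in> carrier_vec n" for v :: "complex vec"
    using that by auto
  have "eigenvalue (mat n n (\<lambda>(k, l). c k l)) x \<longleftrightarrow>
      (\<exists>v\<in>carrier_vec n. v \<noteq> 0\<^sub>v n \<and> mat n n (\<lambda>(k, l). c k l) *\<^sub>v v = x \<cdot>\<^sub>v v)"
    by (auto simp: eigenvalue_def eigenvector_def)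
  also have "\<dots> \<longleftrightarrow> (\<exists>f. vec n f \<noteq> 0\<^sub>v n \<and> mat n n (\<lambda>(k, l). c k l) *\<^sub>v vec n f = x \<cdot>\<^sub>v vec n f)"
    (is "(\<exists>v\<in>_. ?P v) \<longleftrightarrow> _")
  proof
    assume "\<exists>v\<in>carrier_vec n. ?P v"
    then obtain w where w: "w \<in> carrier_vec n" "?P w" by (elim bexE)
    show "\<exists>f. ?P (vec n f)"
      by (rule exI[of _ "\<lambda>k. w $ k"]) (simp add: v[OF w(1), symmetric] w(2))
  next
    assume "\<exists>f. ?P (vec n f)"
    then obtain f where "?P (vec n f)" by (elim exE)
    then show "\<exists>v\<in>carrier_vec n. ?P v" by (intro bexI[of _ "vec n f"] vec_carrier)
  qed
  also have "\<dots> \<longleftrightarrow> (\<exists>f. (\<exists>k<n. f k \<noteq> 0) \<and> (\<forall>k<n. mat_app n c f k = x * f k))"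
    unfolding mult_mat_vec_eq_mat_app by (auto simp: vec_eq_iff)
  finally show ?thesis .
qed

text \<open>The semidefinite form \<open>\<sigma> * (x * norm_sq r v - norm_sq s (mat_app r a v))\<close> comes arbitrarily
  close to zero on unit vectors. By \<open>definite_imp_uniformly_definite\<close> its matrix has a kernel, and
  a kernel vector is an eigenvector of the Gram matrix. The sign \<open>\<sigma>\<close> covers the supremum and the
  infimum of the Rayleigh quotients at once.\<close>

lemma extremal_value_is_eigenvalue:
  assumes \<sigma>: "\<bar>\<sigma>\<bar> = 1"
    and psd: "\<And>v. 0 \<le> \<sigma> * (x * norm_sq r v - norm_sq s (mat_app r a v))"
    and sharp: "\<And>\<delta>. \<delta> > 0 \<Longrightarrow> \<exists>v. \<sigma> * (x * norm_sq r v - norm_sq s (mat_app r a v)) < \<delta> * norm_sq r v"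
  shows "eigenvalue (mat r r (\<lambda>(k, l). gram s a k l)) (complex_of_real x)"
proof -
  define c where "c k l = complex_of_real \<sigma> * ((if k = l then complex_of_real x else 0) - gram s a k l)" for k l
  have app: "mat_app r c v k = \<sigma> * (x * v k - mat_app r (gram s a) v k)" if "k < r" for v :: "nat \<Rightarrow> complex" and k
  proof -
    have "mat_app r c v k = (\<Sum>l<r. \<sigma> * ((if k = l then complex_of_real x * v l else 0) - gram s a k l * v l))"
      unfolding mat_app_def c_def by (intro sum.cong refl) (simp add: ring_distribs mult.assoc)
    also have "\<dots> = \<sigma> * (x * v k - mat_app r (gram s a) v k)"
      using that unfolding sum_distrib_left[symmetric] sum_subtractf mat_app_def by simp
    finally show ?thesis .
  qed
  have form: "(\<Sum>k<r. cnj (v k) * mat_app r c v k) =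
      complex_of_real (\<sigma> * (x * norm_sq r v - norm_sq s (mat_app r a v)))" for v
  proof -
    have "(\<Sum>k<r. cnj (v k) * mat_app r c v k) =
        complex_of_real \<sigma> * (complex_of_real x * (\<Sum>k<r. cnj (v k) * v k) - (\<Sum>k<r. cnj (v k) * mat_app r (gram s a) v k))"
      unfolding sum_subtractf[symmetric] sum_distrib_left
    proof (intro sum.cong refl)
      fix k assume "k \<in> {..<r}"
      then show "cnj (v k) * mat_app r c v k =
          complex_of_real \<sigma> * (complex_of_real x * (cnj (v k) * v k) - cnj (v k) * mat_app r (gram s a) v k)"
        by (simp add: app[of k v] right_diff_distrib mult.left_commute)
    qed
    also have "\<dots> = complex_of_real (\<sigma> * (x * norm_sq r v - norm_sq s (mat_app r a v)))"
      unfolding gram_form by (simp add: of_real_norm_sq)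
    finally show ?thesis .
  qed
  have "\<not> injective r r c"
  proof
    assume inj: "injective r r c"
    have "c l k = cnj (c k l)" for k l
      by (auto simp: c_def gram_def mult.commute)
    moreover have "0 \<le> Re (\<Sum>k<r. cnj (v k) * mat_app r c v k)" for v
      unfolding form using psd by simp
    ultimately obtain \<delta> where "\<delta> > 0"
      "\<And>v. \<delta> * norm_sq r v \<le> Re (\<Sum>k<r. cnj (v k) * mat_app r c v k)"
      using definite_imp_uniformly_definite[OF inj] by metis
    moreover obtain v where "\<sigma> * (x * norm_sq r v - norm_sq s (mat_app r a v)) < \<delta> * norm_sq r v"
      using sharp[OF \<open>\<delta> > 0\<close>] by blast
    ultimately show False
      unfolding form by (metis Re_complex_of_real not_less)
  qed
  then obtain v k where v: "\<And>k. k < r \<Longrightarrow> mat_app r c v k = 0" and k: "k < r" "v k \<noteq> 0"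
    unfolding injective_def by blast
  have "mat_app r (gram s a) v k = x * v k" if "k < r" for k
    using v[OF that] \<sigma> by (auto simp: app[OF that])
  then show ?thesis
    unfolding eigenvalue_mat_iff using k by (intro exI[of _ v]) auto
qed

lemma eigenvalue_gram_imp:
  assumes "eigenvalue (mat r r (\<lambda>(k, l). gram s a k l)) (complex_of_real x)"
  obtains v where "0 < norm_sq r v" "norm_sq s (mat_app r a v) = x * norm_sq r v"
proof -
  from assms[unfolded eigenvalue_mat_iff] obtain v where
    "(\<exists>k<r. v k \<noteq> 0) \<and> (\<forall>k<r. mat_app r (gram s a) v k = complex_of_real x * v k)"
    by (rule exE)
  then have nonzero: "\<exists>k<r. v k \<noteq> 0"
    and eig: "\<forall>k<r. mat_app r (gram s a) v k = complex_of_real x * v k" by simp_all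
  have "complex_of_real (norm_sq s (mat_app r a v)) = (\<Sum>k<r. cnj (v k) * mat_app r (gram s a) v k)"
    unfolding gram_form by (simp add: of_real_norm_sq)
  also have "\<dots> = complex_of_real (x * norm_sq r v)"
    unfolding of_real_mult of_real_norm_sq sum_distrib_left
    using eig by (intro sum.cong) auto
  finally have "norm_sq s (mat_app r a v) = x * norm_sq r v" by (simp only: of_real_eq_iff)
  moreover have "0 < norm_sq r v"
    using nonzero norm_sq_nonneg[of r v] norm_sq_eq_0_iff[of r v] by (metis order_le_less)
  ultimately show thesis using that by blast
qed

lemma finite_real_eigenvalues:
  "finite {x. eigenvalue (mat n n (\<lambda>(k, l). c k l)) (complex_of_real x)}"
proof -
  define A where "A = mat n n (\<lambda>(k, l). c k l)"
  have A: "A \<in> carrier_mat n n" by (simp add: A_def)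
  have "char_poly A \<noteq> 0" using degree_monic_char_poly[OF A] by (metis coeff_0 zero_neq_one)
  then have "finite {z. poly (char_poly A) z = 0}" by (rule poly_roots_finite)
  then have "finite (complex_of_real -` {z. poly (char_poly A) z = 0})"
    by (rule finite_vimageI) (simp add: inj_on_def)
  then show ?thesis
    unfolding A_def[symmetric] eigenvalue_root_char_poly[OF A] vimage_def by simp
qed

definition rayleigh_quotients :: "nat \<Rightarrow> nat \<Rightarrow> (nat \<Rightarrow> nat \<Rightarrow> complex) \<Rightarrow> real set" where
  "rayleigh_quotients s r a = {norm_sq s (mat_app r a v) / norm_sq r v | v. 0 < norm_sq r v}"

lemma rayleigh_quotients:
  assumes "0 < r"
  shows "rayleigh_quotients s r a \<noteq> {}" "bdd_above (rayleigh_quotients s r a)" "bdd_below (rayleigh_quotients s r a)"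
proof -
  have "norm_sq r (\<lambda>_. 1) = r" by (simp add: norm_sq_def)
  then show "rayleigh_quotients s r a \<noteq> {}" using assms by (auto simp: rayleigh_quotients_def intro!: exI[of _ "\<lambda>_. 1"])
  show "bdd_above (rayleigh_quotients s r a)"
    by (rule bdd_aboveI[of _ "\<Sum>j<s. \<Sum>k<r. (cmod (a j k))\<^sup>2"])
      (auto simp: rayleigh_quotients_def divide_le_eq norm_sq_mat_app_le)
  show "bdd_below (rayleigh_quotients s r a)"
    by (rule bdd_belowI[of _ 0]) (auto simp: rayleigh_quotients_def norm_sq_nonneg)
qed

lemma le_quotients_iff:
  "(\<forall>q\<in>rayleigh_quotients s r a. x \<le> q) \<longleftrightarrow> (\<forall>v. x * norm_sq r v \<le> norm_sq s (mat_app r a v))"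
  and quotients_le_iff:
  "(\<forall>q\<in>rayleigh_quotients s r a. q \<le> x) \<longleftrightarrow> (\<forall>v. norm_sq s (mat_app r a v) \<le> x * norm_sq r v)"
proof -
  have 0: "norm_sq r v > 0 \<or> (norm_sq r v = 0 \<and> norm_sq s (mat_app r a v) = 0)" for v
    using norm_sq_mat_app_le[of s r a v] norm_sq_nonneg[of r v] norm_sq_nonneg[of s "mat_app r a v"]
    by (metis antisym_conv1 mult_zero_right order.antisym)
  have *: "(\<forall>q\<in>rayleigh_quotients s r a. P q) \<longleftrightarrow> (\<forall>v. 0 < norm_sq r v \<longrightarrow> P (norm_sq s (mat_app r a v) / norm_sq r v))"
    for P by (auto simp: rayleigh_quotients_def)
  show "(\<forall>q\<in>rayleigh_quotients s r a. x \<le> q) \<longleftrightarrow> (\<forall>v. x * norm_sq r v \<le> norm_sq s (mat_app r a v))"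
    unfolding *
  proof (intro iff_allI)
    show "(0 < norm_sq r v \<longrightarrow> x \<le> norm_sq s (mat_app r a v) / norm_sq r v) \<longleftrightarrow>
        x * norm_sq r v \<le> norm_sq s (mat_app r a v)" for v
      using 0[of v] by (auto simp: le_divide_eq)
  qed
  show "(\<forall>q\<in>rayleigh_quotients s r a. q \<le> x) \<longleftrightarrow> (\<forall>v. norm_sq s (mat_app r a v) \<le> x * norm_sq r v)"
    unfolding *
  proof (intro iff_allI)
    show "(0 < norm_sq r v \<longrightarrow> norm_sq s (mat_app r a v) / norm_sq r v \<le> x) \<longleftrightarrow>
        norm_sq s (mat_app r a v) \<le> x * norm_sq r v" for v
      using 0[of v] by (auto simp: divide_le_eq)
  qed
qed

text \<open>Eigenvalues are Rayleigh quotients of their eigenvectors, and the extremal quotients are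
  eigenvalues. In this form the eigenvalues become bounds on \<open>norm_sq s (mat_app r a v)\<close>, which
  can be integrated over \<open>\<Omega>\<close>.\<close>

lemma
  fixes a :: "nat \<Rightarrow> nat \<Rightarrow> complex" and s r :: nat
  assumes r: "0 < r"
  defines "C \<equiv> mat_adjoint (mat s r (\<lambda>(j, k). a j k)) * mat s r (\<lambda>(j, k). a j k)"
  shows lambda_max_eq: "lambda_max C = Sup (rayleigh_quotients s r a)"
    and lambda_min_eq: "lambda_min C = Inf (rayleigh_quotients s r a)"
proof -
  note Q = rayleigh_quotients[OF r, of s a]
  define E where "E = {x. eigenvalue C (complex_of_real x)}"
  have C: "C = mat r r (\<lambda>(k, l). gram s a k l)" by (simp add: C_def mat_adjoint_mult_eq_gram)
  have fin: "finite E" unfolding E_def C by (rule finite_real_eigenvalues)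
  have sub: "E \<subseteq> rayleigh_quotients s r a"
  proof
    fix x assume "x \<in> E"
    then have "eigenvalue (mat r r (\<lambda>(k, l). gram s a k l)) (complex_of_real x)"
      by (simp add: E_def C)
    then obtain v where "0 < norm_sq r v" "norm_sq s (mat_app r a v) = x * norm_sq r v"
      by (rule eigenvalue_gram_imp)
    then show "x \<in> rayleigh_quotients s r a" unfolding rayleigh_quotients_def by (intro CollectI exI[of _ v]) simp
  qed
  have sup: "Sup (rayleigh_quotients s r a) \<in> E" unfolding E_def C mem_Collect_eq
  proof (rule extremal_value_is_eigenvalue[where \<sigma> = 1])
    show "0 \<le> 1 * (Sup (rayleigh_quotients s r a) * norm_sq r v - norm_sq s (mat_app r a v))" for v
    proof -
      have "\<forall>q\<in>rayleigh_quotients s r a. q \<le> Sup (rayleigh_quotients s r a)" using cSup_upper[OF _ Q(2)] by blast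
      then show ?thesis unfolding quotients_le_iff by simp
    qed
    fix \<delta> :: real assume "\<delta> > 0"
    then obtain q where "q \<in> rayleigh_quotients s r a" "Sup (rayleigh_quotients s r a) - \<delta> < q"
      using less_cSup_iff[OF Q(1,2), of "Sup (rayleigh_quotients s r a) - \<delta>"] by auto
    then obtain v where "0 < norm_sq r v"
      "Sup (rayleigh_quotients s r a) - \<delta> < norm_sq s (mat_app r a v) / norm_sq r v"
      unfolding rayleigh_quotients_def by blast
    then show "\<exists>v. 1 * (Sup (rayleigh_quotients s r a) * norm_sq r v - norm_sq s (mat_app r a v)) < \<delta> * norm_sq r v"
      by (intro exI[of _ v]) (simp add: less_divide_eq algebra_simps)
  qed simp
  have inf: "Inf (rayleigh_quotients s r a) \<in> E" unfolding E_def C mem_Collect_eq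
  proof (rule extremal_value_is_eigenvalue[where \<sigma> = "-1"])
    show "0 \<le> -1 * (Inf (rayleigh_quotients s r a) * norm_sq r v - norm_sq s (mat_app r a v))" for v
    proof -
      have "\<forall>q\<in>rayleigh_quotients s r a. Inf (rayleigh_quotients s r a) \<le> q" using cInf_lower[OF _ Q(3)] by blast
      then show ?thesis unfolding le_quotients_iff by simp
    qed
    fix \<delta> :: real assume "\<delta> > 0"
    then obtain q where "q \<in> rayleigh_quotients s r a" "q < Inf (rayleigh_quotients s r a) + \<delta>"
      using cInf_less_iff[OF Q(1,3), of "Inf (rayleigh_quotients s r a) + \<delta>"] by auto
    then obtain v where "0 < norm_sq r v"
      "norm_sq s (mat_app r a v) / norm_sq r v < Inf (rayleigh_quotients s r a) + \<delta>"
      unfolding rayleigh_quotients_def by blast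
    then show "\<exists>v. -1 * (Inf (rayleigh_quotients s r a) * norm_sq r v - norm_sq s (mat_app r a v)) < \<delta> * norm_sq r v"
      by (intro exI[of _ v]) (simp add: divide_less_eq algebra_simps)
  qed simp
  show "lambda_max C = Sup (rayleigh_quotients s r a)"
    unfolding lambda_max_def E_def[symmetric]
    by (rule Max_eqI[OF fin _ sup]) (rule cSup_upper[OF subsetD[OF sub] Q(2)])
  show "lambda_min C = Inf (rayleigh_quotients s r a)"
    unfolding lambda_min_def E_def[symmetric]
    by (rule Min_eqI[OF fin _ inf]) (rule cInf_lower[OF subsetD[OF sub] Q(3)])
qed

lemma lambda_max_le_iff:
  assumes "0 < r"
  shows "lambda_max (mat_adjoint (mat s r (\<lambda>(j, k). a j k)) * mat s r (\<lambda>(j, k). a j k)) \<le> x \<longleftrightarrow>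
    (\<forall>v. norm_sq s (mat_app r a v) \<le> x * norm_sq r v)"
  by (simp only: lambda_max_eq[OF assms] cSup_le_iff[OF rayleigh_quotients(1,2)[OF assms]] quotients_le_iff)

lemma le_lambda_min_iff:
  assumes "0 < r"
  shows "x \<le> lambda_min (mat_adjoint (mat s r (\<lambda>(j, k). a j k)) * mat s r (\<lambda>(j, k). a j k)) \<longleftrightarrow>
    (\<forall>v. x * norm_sq r v \<le> norm_sq s (mat_app r a v))"
  by (simp only: lambda_min_eq[OF assms] le_cInf_iff[OF rayleigh_quotients(1,3)[OF assms]] le_quotients_iff)

lemma cnj_measurable [measurable]: "cnj \<in> borel \<rightarrow>\<^sub>M borel"
  by (intro borel_measurable_continuous_onI continuous_intros)

definition conj_transpose :: "(nat \<Rightarrow> nat \<Rightarrow> complex) \<Rightarrow> nat \<Rightarrow> nat \<Rightarrow> complex" where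
  "conj_transpose a k j = cnj (a j k)"

text \<open>For injective \<open>a\<close> this is \<open>a (a\<^sup>* a)\<inverse> F\<close>, the pseudoinverse solution \<open>p\<close> of \<open>a\<^sup>* p = F\<close>. Its
  size is governed by the lower bound of \<open>a\<close>, and it depends measurably on \<open>a\<close> and \<open>F\<close>.\<close>

definition solve :: "nat \<Rightarrow> nat \<Rightarrow> (nat \<Rightarrow> nat \<Rightarrow> complex) \<Rightarrow> (nat \<Rightarrow> complex) \<Rightarrow> nat \<Rightarrow> complex" where
  "solve s r a F = mat_app r a (mat_app r (inverse_entries r (gram s a)) F)"

lemma mat_app_cong: "(\<And>k. k < n \<Longrightarrow> u k = v k) \<Longrightarrow> mat_app n a u = mat_app n a v"
  by (auto simp: fun_eq_iff mat_app_def intro!: sum.cong)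

lemma norm_sq_cong: "(\<And>k. k < n \<Longrightarrow> u k = v k) \<Longrightarrow> norm_sq n u = norm_sq n v"
  by (auto simp: norm_sq_def)

lemma mat_app_add: "mat_app n a (\<lambda>k. u k + v k) = (\<lambda>j. mat_app n a u j + mat_app n a v j)"
  by (simp add: fun_eq_iff mat_app_def algebra_simps sum.distrib)

lemma gram_app: "mat_app r (gram s a) v k = mat_app s (conj_transpose a) (mat_app r a v) k"
proof -
  have "mat_app r (gram s a) v k = (\<Sum>l<r. \<Sum>j<s. cnj (a j k) * a j l * v l)"
    by (simp add: mat_app_def gram_def sum_distrib_right)
  also have "\<dots> = (\<Sum>j<s. \<Sum>l<r. cnj (a j k) * a j l * v l)" by (rule sum.swap)
  also have "\<dots> = mat_app s (conj_transpose a) (mat_app r a v) k"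
    by (simp add: mat_app_def conj_transpose_def sum_distrib_left mult.assoc)
  finally show ?thesis .
qed

lemma injective_gram:
  assumes "injective s r a"
  shows "injective r r (gram s a)"
  unfolding injective_def
proof (intro allI impI)
  fix v k assume *: "\<forall>j<r. mat_app r (gram s a) v j = 0" and k: "k < r"
  have "complex_of_real (norm_sq s (mat_app r a v)) = (\<Sum>k<r. cnj (v k) * mat_app r (gram s a) v k)"
    unfolding gram_form of_real_norm_sq ..
  also have "\<dots> = 0" using * by simp
  finally have "\<forall>j<s. mat_app r a v j = 0" by (simp add: norm_sq_eq_0_iff)
  then show "v k = 0" using assms k by (simp add: injective_def)
qed

lemma solve_eq:
  assumes "injective s r a" "k < r"
  shows "mat_app s (conj_transpose a) (solve s r a F) k = F k"
  unfolding solve_def gram_app[symmetric] by (rule inverse_entries(2)[OF injective_gram[OF assms(1)] assms(2)])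

lemma solve_cong: "(\<And>k. k < r \<Longrightarrow> F k = F' k) \<Longrightarrow> solve s r a F = solve s r a F'"
  unfolding solve_def using mat_app_cong[of r F F'] by simp

lemma solve_linear:
  "solve s r a (\<lambda>k. c * F k + d * F' k) j = c * solve s r a F j + d * solve s r a F' j"
  by (simp add: solve_def mat_app_add mat_app_scale)

lemma lower_bound_imp_injective:
  assumes "0 < c" "\<And>v. c * norm_sq r v \<le> norm_sq s (mat_app r a v)"
  shows "injective s r a"
  unfolding injective_def
proof (intro allI impI)
  fix v k assume "\<forall>j<s. mat_app r a v j = 0" "k < r"
  then have "c * norm_sq r v \<le> 0" using assms(2)[of v] norm_sq_eq_0_iff[of s "mat_app r a v"] by simp
  then have "norm_sq r v = 0" using assms(1) norm_sq_nonneg[of r v] by (simp add: mult_le_0_iff)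
  then show "v k = 0" using \<open>k < r\<close> by (simp add: norm_sq_eq_0_iff)
qed

text \<open>The solution is \<open>p = a w\<close> with \<open>a\<^sup>* p = F\<close>, so that its squared norm is the inner product of
  \<open>w\<close> and \<open>F\<close>, while the lower bound controls \<open>w\<close> by \<open>a w = p\<close>.\<close>

lemma norm_sq_solve_le:
  assumes c: "0 < c" "\<And>v. c * norm_sq r v \<le> norm_sq s (mat_app r a v)"
  shows "norm_sq s (solve s r a F) \<le> norm_sq r F / c"
proof -
  note inj = lower_bound_imp_injective[OF c]
  define w where "w = mat_app r (inverse_entries r (gram s a)) F"
  define p where "p = solve s r a F"
  have p: "p = mat_app r a w" by (simp add: p_def solve_def w_def)
  have gw: "mat_app r (gram s a) w k = F k" if "k < r" for k
    unfolding w_def by (rule inverse_entries(2)[OF injective_gram[OF inj] that])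
  have "complex_of_real (norm_sq s p) = (\<Sum>k<r. cnj (w k) * F k)"
    unfolding of_real_norm_sq p gram_form[symmetric] by (simp add: gw)
  then have "norm_sq s p = cmod (\<Sum>k<r. cnj (w k) * F k)"
    by (metis norm_of_real norm_sq_nonneg abs_of_nonneg)
  then have "(norm_sq s p)\<^sup>2 \<le> norm_sq r w * norm_sq r F"
    using cmod_sum_sq_le[of "\<lambda>k. cnj (w k)" F "{..<r}"] by (simp add: norm_sq_def)
  also have "\<dots> \<le> (norm_sq s p / c) * norm_sq r F"
    using c(2)[of w] c(1) by (intro mult_right_mono norm_sq_nonneg) (simp add: p field_simps)
  finally have *: "norm_sq s p * norm_sq s p \<le> norm_sq s p * (norm_sq r F / c)"
    by (simp add: power2_eq_square)
  show ?thesis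
  proof (cases "norm_sq s p = 0")
    case True
    then show ?thesis using c(1) norm_sq_nonneg[of r F] by (simp add: p_def)
  next
    case False
    then have "0 < norm_sq s p" using norm_sq_nonneg[of s p] by simp
    with * have "norm_sq s p \<le> norm_sq r F / c" by (rule mult_left_le_imp_le)
    then show ?thesis by (simp add: p_def)
  qed
qed

text \<open>A square injective matrix is onto, so a kernel vector of \<open>a\<^sup>*\<close> has the form \<open>p = a u\<close>, and
  its squared norm is the inner product of \<open>u\<close> with \<open>a\<^sup>* p = 0\<close>.\<close>

lemma injective_conj_transpose:
  assumes "injective r r a"
  shows "injective r r (conj_transpose a)"
  unfolding injective_def
proof (intro allI impI)
  fix p k assume *: "\<forall>k<r. mat_app r (conj_transpose a) p k = 0" and k: "k < r"
  define u where "u = mat_app r (inverse_entries r a) p"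
  have p: "p j = mat_app r a u j" if "j < r" for j
    unfolding u_def by (rule inverse_entries(2)[OF assms that, symmetric])
  have "complex_of_real (norm_sq r p) = complex_of_real (norm_sq r (mat_app r a u))"
    by (subst norm_sq_cong[OF p]) auto
  also have "\<dots> = (\<Sum>k<r. cnj (u k) * mat_app r (conj_transpose a) (mat_app r a u) k)"
    unfolding of_real_norm_sq gram_form[symmetric] gram_app ..
  also have "\<dots> = (\<Sum>k<r. cnj (u k) * mat_app r (conj_transpose a) p k)"
    by (subst mat_app_cong[OF p]) auto
  also have "\<dots> = 0" using * by simp
  finally show "p k = 0" using k by (simp add: norm_sq_eq_0_iff)
qed

lemma solve_conj_transpose:
  assumes "injective r r a" "j < r"
  shows "solve r r a (mat_app r (conj_transpose a) v) j = v j"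
proof -
  define d where "d j = solve r r a (mat_app r (conj_transpose a) v) j - v j" for j
  have "mat_app r (conj_transpose a) d k = 0" if "k < r" for k
    unfolding d_def using solve_eq[OF assms(1) that] by (simp add: mat_app_diff)
  then have "d j = 0" using injective_conj_transpose[OF assms(1)] assms(2) unfolding injective_def by blast
  then show ?thesis by (simp add: d_def)
qed

lemma measurable_det:
  assumes "\<And>i j. i < n \<Longrightarrow> j < n \<Longrightarrow> (\<lambda>x. f x i j) \<in> borel_measurable m"
  shows "(\<lambda>x. det (mat n n (\<lambda>(i, j). f x i j :: complex))) \<in> borel_measurable m"
proof -
  have "det (mat n n (\<lambda>(i, j). f x i j)) =
      (\<Sum>p\<in>{p. p permutes {0..<n}}. signof p * (\<Prod>i = 0..<n. f x i (p i)))" for x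
    by (subst det_def'[of _ n]) (auto intro!: sum.cong prod.cong dest: permutes_in_image)
  moreover have "(\<lambda>x. \<Prod>i = 0..<n. f x i (p i)) \<in> borel_measurable m" if "p permutes {0..<n}" for p
    using permutes_in_image[OF that] assms by (intro borel_measurable_prod) auto
  ultimately show ?thesis
    by (simp only:) (intro borel_measurable_sum borel_measurable_times borel_measurable_const; simp)
qed

lemma measurable_inverse_entries:
  assumes c: "\<And>k l. k < n \<Longrightarrow> l < n \<Longrightarrow> (\<lambda>x. c x k l) \<in> borel_measurable m" and kl: "k < n" "l < n"
  shows "(\<lambda>x. inverse_entries n (c x) k l) \<in> borel_measurable m"
proof -
  have "adj_mat (mat n n (\<lambda>(k, l). c x k l)) $$ (k, l) =
      (-1) ^ (l + k) * det (mat (n - 1) (n - 1) (\<lambda>(i, j). c x (if i < l then i else Suc i) (if j < k then j else Suc j)))" for x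
  proof -
    have "mat_delete (mat n n (\<lambda>(k, l). c x k l)) l k =
        mat (n - 1) (n - 1) (\<lambda>(i, j). c x (if i < l then i else Suc i) (if j < k then j else Suc j))"
      by (intro eq_matI) (auto simp: mat_delete_def)
    then show ?thesis using kl by (simp add: adj_mat_def cofactor_def)
  qed
  then have "(\<lambda>x. adj_mat (mat n n (\<lambda>(k, l). c x k l)) $$ (k, l)) \<in> borel_measurable m"
    using c by (simp only:) (intro borel_measurable_times borel_measurable_const measurable_det; auto)
  then show ?thesis
    unfolding inverse_entries_def by (intro borel_measurable_divide measurable_det c)
qed

lemma measurable_solve:
  assumes a: "\<And>j k. j < s \<Longrightarrow> k < r \<Longrightarrow> (\<lambda>x. a x j k) \<in> borel_measurable m"
    and F: "\<And>k. k < r \<Longrightarrow> (\<lambda>x. F x k) \<in> borel_measurable m" and j: "j < s"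
  shows "(\<lambda>x. solve s r (a x) (F x) j) \<in> borel_measurable m"
proof -
  have "(\<lambda>x. gram s (a x) k l) \<in> borel_measurable m" if "k < r" "l < r" for k l
    unfolding gram_def using a that measurable_compose[OF _ cnj_measurable]
    by (intro borel_measurable_sum borel_measurable_times) auto
  then have "(\<lambda>x. inverse_entries r (gram s (a x)) k l) \<in> borel_measurable m" if "k < r" "l < r" for k l
    using that by (intro measurable_inverse_entries) auto
  then show ?thesis
    unfolding solve_def mat_app_def using a F j
    by (intro borel_measurable_sum borel_measurable_times) auto
qed

lemma tendsto_norm_sq:
  assumes "\<And>k. k < n \<Longrightarrow> (\<lambda>i. u i k) \<longlonglongrightarrow> v k"
  shows "(\<lambda>i. norm_sq n (u i)) \<longlonglongrightarrow> norm_sq n v"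
  unfolding norm_sq_def using assms by (intro tendsto_intros) auto

lemma tendsto_mat_app:
  assumes "\<And>k. k < n \<Longrightarrow> (\<lambda>i. u i k) \<longlonglongrightarrow> v k"
  shows "(\<lambda>i. mat_app n a (u i) j) \<longlonglongrightarrow> mat_app n a v j"
  unfolding mat_app_def using assms by (intro tendsto_intros) auto

lemma countable_dense_vectors:
  obtains D :: "(nat \<Rightarrow> complex) set" where "countable D"
    "\<And>v. \<exists>u. (\<forall>i. u i \<in> D) \<and> (\<forall>k<n. (\<lambda>i. u i k) \<longlonglongrightarrow> v k)"
proof -
  obtain D0 :: "complex set" where D0: "countable D0" "\<And>X. open X \<Longrightarrow> X \<noteq> {} \<Longrightarrow> \<exists>d\<in>D0. d \<in> X"
    by (rule countable_dense_setE) blast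
  have "\<exists>u. (\<forall>i. u i \<in> PiE {..<n} (\<lambda>_. D0)) \<and> (\<forall>k<n. (\<lambda>i. u i k) \<longlonglongrightarrow> v k)" for v
  proof -
    have "\<forall>p. \<exists>d. d \<in> D0 \<and> d \<in> ball (v (snd p)) (inverse (real (Suc (fst p))))"
      using D0(2)[OF open_ball] by (auto simp: Bex_def)
    from choice[OF this] obtain d' where
      "\<forall>p. d' p \<in> D0 \<and> d' p \<in> ball (v (snd p)) (inverse (real (Suc (fst p))))" ..
    then have d: "\<And>i k. d' (i, k) \<in> D0" "\<And>i k. dist (v k) (d' (i, k)) < inverse (real (Suc i))"
      by auto
    define d where "d i k = d' (i, k)" for i k
    note d = d[folded d_def]
    have "(\<lambda>i. restrict (d i) {..<n} k) \<longlonglongrightarrow> v k" if "k < n" for k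
    proof -
      have "(\<lambda>i. dist (d i k) (v k)) \<longlonglongrightarrow> 0"
      proof (rule real_tendsto_sandwich[OF _ _ tendsto_const LIMSEQ_inverse_real_of_nat])
        show "\<forall>\<^sub>F i in sequentially. dist (d i k) (v k) \<le> inverse (real (Suc i))"
          using d(2)[of k] by (intro always_eventually allI less_imp_le) (simp add: dist_commute)
      qed simp
      then have "(\<lambda>i. d i k) \<longlonglongrightarrow> v k" by (rule tendsto_dist_iff[THEN iffD2])
      then show ?thesis using that by simp
    qed
    then show ?thesis
      using d(1) by (intro exI[of _ "\<lambda>i. restrict (d i) {..<n}"]) auto
  qed
  then show thesis using D0(1) by (intro that[of "PiE {..<n} (\<lambda>_. D0)"]) (auto intro: countable_PiE)
qed

text \<open>Both inequalities are continuous in the vector. An inequality that holds almost everywhere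
  for each single vector thus holds almost everywhere for all vectors at once.\<close>

lemma countable_dense_test_vectors:
  obtains D :: "(nat \<Rightarrow> complex) set" where "countable D"
    "\<And>s a x w. \<forall>v\<in>D. norm_sq s (mat_app n a v) \<le> x * norm_sq n v \<Longrightarrow>
       norm_sq s (mat_app n a w) \<le> x * norm_sq n w"
    "\<And>s a x w. \<forall>v\<in>D. x * norm_sq n v \<le> norm_sq s (mat_app n a v) \<Longrightarrow>
       x * norm_sq n w \<le> norm_sq s (mat_app n a w)"
proof -
  obtain D :: "(nat \<Rightarrow> complex) set" where D: "countable D"
    "\<And>v. \<exists>u. (\<forall>i. u i \<in> D) \<and> (\<forall>k<n. (\<lambda>i. u i k) \<longlonglongrightarrow> v k)"
    by (rule countable_dense_vectors[where n = n]) blast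
  have lims: "(\<lambda>i. norm_sq s (mat_app n a (u i))) \<longlonglongrightarrow> norm_sq s (mat_app n a w)"
    "(\<lambda>i. x * norm_sq n (u i)) \<longlonglongrightarrow> x * norm_sq n w"
    if "\<forall>k<n. (\<lambda>i. u i k) \<longlonglongrightarrow> w k" for u w s a x
    using that by (intro tendsto_intros tendsto_norm_sq tendsto_mat_app; simp)+
  show thesis
  proof (rule that[OF D(1)])
    fix s a x w
    obtain u where u: "\<forall>i. u i \<in> D" "\<forall>k<n. (\<lambda>i. u i k) \<longlonglongrightarrow> w k" using D(2)[of w] by blast
    show "norm_sq s (mat_app n a w) \<le> x * norm_sq n w"
      if "\<forall>v\<in>D. norm_sq s (mat_app n a v) \<le> x * norm_sq n v"
      using u(1) that by (intro LIMSEQ_le[OF lims(1)[OF u(2)] lims(2)[OF u(2)]]) auto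
    show "x * norm_sq n w \<le> norm_sq s (mat_app n a w)"
      if "\<forall>v\<in>D. x * norm_sq n v \<le> norm_sq s (mat_app n a v)"
      using u(1) that by (intro LIMSEQ_le[OF lims(2)[OF u(2)] lims(1)[OF u(2)]]) auto
  qed
qed

section \<open>Square-integrable functions and orthonormal expansions\<close>

lemma L2_measurable [measurable_dest]: "f \<in> L2 m \<Longrightarrow> f \<in> borel_measurable m"
  and L2_integrable: "f \<in> L2 m \<Longrightarrow> integrable m (\<lambda>x. (cmod (f x))\<^sup>2)"
  by (auto simp: L2_def)

lemma L2_zero [simp]: "(\<lambda>_. 0) \<in> L2 m"
  by (simp add: L2_def)

lemma L2_mult_integrable:
  assumes "f \<in> L2 m" "g \<in> L2 m"
  shows "integrable m (\<lambda>x. f x * g x)"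
proof (rule Bochner_Integration.integrable_bound)
  show "integrable m (\<lambda>x. (cmod (f x))\<^sup>2 + (cmod (g x))\<^sup>2)"
    using assms by (intro Bochner_Integration.integrable_add L2_integrable)
  show "AE x in m. norm (f x * g x) \<le> norm ((cmod (f x))\<^sup>2 + (cmod (g x))\<^sup>2)"
  proof (intro AE_I2)
    fix x
    have "2 * (cmod (f x) * cmod (g x)) \<le> (cmod (f x))\<^sup>2 + (cmod (g x))\<^sup>2"
      using sum_squares_bound[of "cmod (f x)" "cmod (g x)"] by simp
    moreover have "0 \<le> cmod (f x) * cmod (g x)" by simp
    ultimately have "cmod (f x) * cmod (g x) \<le> (cmod (f x))\<^sup>2 + (cmod (g x))\<^sup>2" by linarith
    then show "norm (f x * g x) \<le> norm ((cmod (f x))\<^sup>2 + (cmod (g x))\<^sup>2)"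
      by (simp add: norm_mult)
  qed
qed (use assms in measurable)

lemma L2_cnj: "f \<in> L2 m \<Longrightarrow> (\<lambda>x. cnj (f x)) \<in> L2 m"
  using measurable_compose[OF L2_measurable cnj_measurable, of f m] by (simp add: L2_def)

lemma L2_inner_integrable:
  "f \<in> L2 m \<Longrightarrow> g \<in> L2 m \<Longrightarrow> integrable m (\<lambda>x. f x * cnj (g x))"
  by (intro L2_mult_integrable L2_cnj)

lemma L2_add:
  assumes "f \<in> L2 m" "g \<in> L2 m"
  shows "(\<lambda>x. f x + g x) \<in> L2 m"
proof -
  have "integrable m (\<lambda>x. (cmod (f x + g x))\<^sup>2)"
  proof (rule Bochner_Integration.integrable_bound)
    show "integrable m (\<lambda>x. 2 * (cmod (f x))\<^sup>2 + 2 * (cmod (g x))\<^sup>2)"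
      using assms by (intro Bochner_Integration.integrable_add integrable_mult_right L2_integrable)
    show "AE x in m. norm ((cmod (f x + g x))\<^sup>2) \<le> norm (2 * (cmod (f x))\<^sup>2 + 2 * (cmod (g x))\<^sup>2)"
    proof (intro AE_I2)
      fix x
      have "(cmod (f x + g x))\<^sup>2 \<le> (cmod (f x) + cmod (g x))\<^sup>2"
        by (intro power_mono norm_triangle_ineq) auto
      also have "\<dots> \<le> 2 * (cmod (f x))\<^sup>2 + 2 * (cmod (g x))\<^sup>2"
        using sum_squares_bound[of "cmod (f x)" "cmod (g x)"] by (simp add: power2_sum)
      finally show "norm ((cmod (f x + g x))\<^sup>2) \<le> norm (2 * (cmod (f x))\<^sup>2 + 2 * (cmod (g x))\<^sup>2)"
        by simp
    qed
  qed (use assms in measurable)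
  then show ?thesis using assms by (auto simp: L2_def)
qed

lemma L2_cmult: "f \<in> L2 m \<Longrightarrow> (\<lambda>x. c * f x) \<in> L2 m"
  by (auto simp: L2_def norm_mult power_mult_distrib)

lemma L2_diff: "f \<in> L2 m \<Longrightarrow> g \<in> L2 m \<Longrightarrow> (\<lambda>x. f x - g x) \<in> L2 m"
  using L2_add[of f m "\<lambda>x. (-1) * g x"] L2_cmult[of g m "-1"] by simp

lemma L2_sum: "(\<And>i. i \<in> F \<Longrightarrow> f i \<in> L2 m) \<Longrightarrow> (\<lambda>x. \<Sum>i\<in>F. f i x) \<in> L2 m"
  by (induction F rule: infinite_finite_induct) (auto intro!: L2_add)

lemma L2_lincomb: "(\<And>i. i \<in> F \<Longrightarrow> f i \<in> L2 m) \<Longrightarrow> (\<lambda>x. \<Sum>i\<in>F. c i * f i x) \<in> L2 m"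
  by (intro L2_sum L2_cmult)

lemma L2_dominated:
  assumes "g \<in> L2 m" "f \<in> borel_measurable m" "AE x in m. cmod (f x) \<le> C * cmod (g x)"
  shows "f \<in> L2 m"
proof -
  have "integrable m (\<lambda>x. (cmod (f x))\<^sup>2)"
  proof (rule Bochner_Integration.integrable_bound)
    show "integrable m (\<lambda>x. C\<^sup>2 * (cmod (g x))\<^sup>2)"
      using assms(1) by (intro integrable_mult_right L2_integrable)
    show "AE x in m. norm ((cmod (f x))\<^sup>2) \<le> norm (C\<^sup>2 * (cmod (g x))\<^sup>2)"
      using assms(3)
    proof eventually_elim
      case (elim x)
      then have "(cmod (f x))\<^sup>2 \<le> (C * cmod (g x))\<^sup>2" by (intro power_mono) auto
      then show ?case by (simp add: power_mult_distrib)
    qed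
  qed (use assms in measurable)
  then show ?thesis using assms(2) by (simp add: L2_def)
qed

lemma l2_norm_nonneg [simp]: "0 \<le> l2_norm m f"
  by (simp add: l2_norm_def)

lemma l2_norm_sq: "(l2_norm m f)\<^sup>2 = (LINT x|m. (cmod (f x))\<^sup>2)"
  by (simp add: l2_norm_def)

lemma l2_inner_self: "l2_inner m f f = complex_of_real ((l2_norm m f)\<^sup>2)"
  unfolding l2_inner_def l2_norm_sq complex_norm_square[symmetric] by (rule integral_complex_of_real)

lemma l2_inner_commute: "l2_inner m g f = cnj (l2_inner m f g)"
  unfolding l2_inner_def using Bochner_Integration.integral_cnj[of m "\<lambda>x. f x * cnj (g x)"]
  by (simp add: mult.commute)

lemma l2_inner_diff_left:
  "f \<in> L2 m \<Longrightarrow> g \<in> L2 m \<Longrightarrow> h \<in> L2 m \<Longrightarrow>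
    l2_inner m (\<lambda>x. f x - g x) h = l2_inner m f h - l2_inner m g h"
  by (simp add: l2_inner_def ring_distribs Bochner_Integration.integral_diff L2_inner_integrable)

lemma l2_inner_diff_right:
  "f \<in> L2 m \<Longrightarrow> g \<in> L2 m \<Longrightarrow> h \<in> L2 m \<Longrightarrow>
    l2_inner m h (\<lambda>x. f x - g x) = l2_inner m h f - l2_inner m h g"
  by (simp add: l2_inner_def ring_distribs Bochner_Integration.integral_diff L2_inner_integrable)

lemma l2_inner_lincomb_right:
  assumes "\<And>i. i \<in> F \<Longrightarrow> e i \<in> L2 m" "f \<in> L2 m"
  shows "l2_inner m f (\<lambda>x. \<Sum>i\<in>F. c i * e i x) = (\<Sum>i\<in>F. cnj (c i) * l2_inner m f (e i))"
proof -
  have "l2_inner m f (\<lambda>x. \<Sum>i\<in>F. c i * e i x) = (LINT x|m. (\<Sum>i\<in>F. cnj (c i) * (f x * cnj (e i x))))"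
    by (simp add: l2_inner_def sum_distrib_left mult.left_commute)
  also have "\<dots> = (\<Sum>i\<in>F. LINT x|m. cnj (c i) * (f x * cnj (e i x)))"
    using assms by (intro Bochner_Integration.integral_sum integrable_mult_right L2_inner_integrable)
  also have "\<dots> = (\<Sum>i\<in>F. cnj (c i) * l2_inner m f (e i))"
    by (simp add: l2_inner_def)
  finally show ?thesis .
qed

lemma l2_norm_diff_sq:
  assumes "f \<in> L2 m" "g \<in> L2 m"
  shows "(l2_norm m (\<lambda>x. f x - g x))\<^sup>2 = (l2_norm m f)\<^sup>2 - 2 * Re (l2_inner m f g) + (l2_norm m g)\<^sup>2"
proof -
  have "complex_of_real ((l2_norm m (\<lambda>x. f x - g x))\<^sup>2) =
      complex_of_real ((l2_norm m f)\<^sup>2) - (l2_inner m f g + cnj (l2_inner m f g)) + complex_of_real ((l2_norm m g)\<^sup>2)"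
    unfolding l2_inner_self[symmetric]
    using assms l2_inner_commute[of m g f] by (simp add: l2_inner_diff_left l2_inner_diff_right L2_diff)
  also have "\<dots> = complex_of_real ((l2_norm m f)\<^sup>2 - 2 * Re (l2_inner m f g) + (l2_norm m g)\<^sup>2)"
    by (simp add: complex_add_cnj)
  finally show ?thesis by (simp only: of_real_eq_iff)
qed

lemma l2_Cauchy_Schwarz:
  assumes "f \<in> L2 m" "g \<in> L2 m"
  shows "cmod (l2_inner m f g) \<le> l2_norm m f * l2_norm m g"
proof -
  note [measurable] = L2_measurable[OF assms(1)] L2_measurable[OF assms(2)]
  have int: "integrable m (\<lambda>x. cmod (f x) * cmod (g x))"
    using integrable_norm[OF L2_inner_integrable[OF assms]] by (simp add: norm_mult)
  have sq: "(\<integral>\<^sup>+x. (ennreal (cmod (h x)))\<^sup>2 \<partial>m) = ennreal ((l2_norm m h)\<^sup>2)" if "h \<in> L2 m" for h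
    unfolding l2_norm_sq using nn_integral_eq_integral[OF L2_integrable[OF that]]
    by (simp add: ennreal_power)
  have "ennreal (LINT x|m. cmod (f x) * cmod (g x)) = (\<integral>\<^sup>+x. ennreal (cmod (f x)) * ennreal (cmod (g x)) \<partial>m)"
    by (subst nn_integral_eq_integral[OF int, symmetric]) (simp_all add: ennreal_mult')
  then have "ennreal ((LINT x|m. cmod (f x) * cmod (g x))\<^sup>2) =
      (\<integral>\<^sup>+x. ennreal (cmod (f x)) * ennreal (cmod (g x)) \<partial>m)\<^sup>2"
    by (simp flip: ennreal_power add: integral_nonneg_AE)
  also have "\<dots> \<le> (\<integral>\<^sup>+x. (ennreal (cmod (f x)))\<^sup>2 \<partial>m) * (\<integral>\<^sup>+x. (ennreal (cmod (g x)))\<^sup>2 \<partial>m)"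
    by (rule Cauchy_Schwarz_nn_integral) measurable
  also have "\<dots> = ennreal ((l2_norm m f * l2_norm m g)\<^sup>2)"
    unfolding sq[OF assms(1)] sq[OF assms(2)] by (simp add: ennreal_mult'[symmetric] power_mult_distrib)
  finally have "(LINT x|m. cmod (f x) * cmod (g x))\<^sup>2 \<le> (l2_norm m f * l2_norm m g)\<^sup>2"
    by simp
  then have "(LINT x|m. cmod (f x) * cmod (g x)) \<le> l2_norm m f * l2_norm m g"
    by (rule power2_le_imp_le) simp
  moreover have "cmod (l2_inner m f g) \<le> (LINT x|m. cmod (f x) * cmod (g x))"
    unfolding l2_inner_def using integral_norm_bound[of m "\<lambda>x. f x * cnj (g x)"] by (simp add: norm_mult)
  ultimately show ?thesis by simp
qed

lemma l2_norm_diff_le: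
  assumes "f \<in> L2 m" "g \<in> L2 m"
  shows "l2_norm m (\<lambda>x. f x - g x) \<le> l2_norm m f + l2_norm m g"
proof (rule power2_le_imp_le)
  have "- Re (l2_inner m f g) \<le> l2_norm m f * l2_norm m g"
    using l2_Cauchy_Schwarz[OF assms] abs_Re_le_cmod[of "l2_inner m f g"] by linarith
  then show "(l2_norm m (\<lambda>x. f x - g x))\<^sup>2 \<le> (l2_norm m f + l2_norm m g)\<^sup>2"
    unfolding l2_norm_diff_sq[OF assms] by (simp add: power2_sum)
qed simp

lemma l2_norm_cmult: "l2_norm m (\<lambda>x. c * f x) = cmod c * l2_norm m f"
  by (simp add: l2_norm_def norm_mult power_mult_distrib real_sqrt_mult)

lemma l2_norm_add_le:
  assumes "f \<in> L2 m" "g \<in> L2 m"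
  shows "l2_norm m (\<lambda>x. f x + g x) \<le> l2_norm m f + l2_norm m g"
  using l2_norm_diff_le[OF assms(1) L2_cmult[OF assms(2), of "-1"]] l2_norm_cmult[of m "-1" g] by simp

lemma l2_norm_AE_cong:
  assumes "f \<in> borel_measurable m" "g \<in> borel_measurable m" "AE x in m. f x = g x"
  shows "l2_norm m f = l2_norm m g"
proof -
  have "(LINT x|m. (cmod (f x))\<^sup>2) = (LINT x|m. (cmod (g x))\<^sup>2)"
    using assms by (intro integral_cong_AE) auto
  then show ?thesis by (simp add: l2_norm_def)
qed

lemma l2_inner_AE_cong:
  assumes [measurable]: "f \<in> borel_measurable m" "g \<in> borel_measurable m" "h \<in> borel_measurable m"
    and "AE x in m. f x = g x"
  shows "l2_inner m h f = l2_inner m h g"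
  unfolding l2_inner_def
proof (rule integral_cong_AE)
  show "AE x in m. h x * cnj (f x) = h x * cnj (g x)" using assms(4) by eventually_elim simp
qed measurable

definition closed_span :: "'x measure \<Rightarrow> ('i \<Rightarrow> 'x \<Rightarrow> complex) \<Rightarrow> 'i set \<Rightarrow> ('x \<Rightarrow> complex) set" where
  "closed_span m e I = {f \<in> L2 m. \<forall>\<epsilon>>0. \<exists>F c. finite F \<and> F \<subseteq> I \<and>
     l2_norm m (\<lambda>x. f x - (\<Sum>i\<in>F. c i * e i x)) < \<epsilon>}"

lemma complete_system_iff: "complete_system m e I \<longleftrightarrow> L2 m \<subseteq> closed_span m e I"
  by (auto simp: complete_system_def closed_span_def)

lemma closed_spanI: "f \<in> L2 m \<Longrightarrow> (\<And>\<epsilon>. \<epsilon> > 0 \<Longrightarrow> \<exists>F c. finite F \<and> F \<subseteq> I \<and>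
     l2_norm m (\<lambda>x. f x - (\<Sum>i\<in>F. c i * e i x)) < \<epsilon>) \<Longrightarrow> f \<in> closed_span m e I"
  by (simp add: closed_span_def)

lemma closed_span_L2: "f \<in> closed_span m e I \<Longrightarrow> f \<in> L2 m"
  by (simp add: closed_span_def)

lemma closed_span_add:
  assumes e: "\<And>i. i \<in> I \<Longrightarrow> e i \<in> L2 m" and f: "f \<in> closed_span m e I" and g: "g \<in> closed_span m e I"
  shows "(\<lambda>x. f x + g x) \<in> closed_span m e I"
proof (rule closed_spanI)
  show "(\<lambda>x. f x + g x) \<in> L2 m" using f g by (intro L2_add closed_span_L2)
  fix \<epsilon> :: real assume "\<epsilon> > 0"
  then obtain F c F' c' where F: "finite F" "F \<subseteq> I" "l2_norm m (\<lambda>x. f x - (\<Sum>i\<in>F. c i * e i x)) < \<epsilon> / 2"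
    and F': "finite F'" "F' \<subseteq> I" "l2_norm m (\<lambda>x. g x - (\<Sum>i\<in>F'. c' i * e i x)) < \<epsilon> / 2"
    using f g unfolding closed_span_def mem_Collect_eq by (meson half_gt_zero)
  define d where "d i = (if i \<in> F then c i else 0) + (if i \<in> F' then c' i else 0)" for i
  have d: "(\<Sum>i\<in>F \<union> F'. d i * e i x) = (\<Sum>i\<in>F. c i * e i x) + (\<Sum>i\<in>F'. c' i * e i x)" for x
  proof -
    have "(\<Sum>i\<in>F \<union> F'. d i * e i x) =
        (\<Sum>i\<in>F \<union> F'. if i \<in> F then c i * e i x else 0) + (\<Sum>i\<in>F \<union> F'. if i \<in> F' then c' i * e i x else 0)"
      unfolding sum.distrib[symmetric] by (intro sum.cong) (auto simp: d_def ring_distribs)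
    also have "\<dots> = (\<Sum>i\<in>F. c i * e i x) + (\<Sum>i\<in>F'. c' i * e i x)"
      using F(1) F'(1) by (simp add: sum.inter_restrict[symmetric] Int_absorb1)
    finally show ?thesis .
  qed
  have "l2_norm m (\<lambda>x. (f x + g x) - (\<Sum>i\<in>F \<union> F'. d i * e i x)) =
      l2_norm m (\<lambda>x. (f x - (\<Sum>i\<in>F. c i * e i x)) + (g x - (\<Sum>i\<in>F'. c' i * e i x)))"
    by (simp add: d algebra_simps)
  also have "\<dots> \<le> l2_norm m (\<lambda>x. f x - (\<Sum>i\<in>F. c i * e i x)) + l2_norm m (\<lambda>x. g x - (\<Sum>i\<in>F'. c' i * e i x))"
    using F(2) F'(2) e f g by (intro l2_norm_add_le L2_diff L2_lincomb) (auto dest: closed_span_L2)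
  also have "\<dots> < \<epsilon>" using F(3) F'(3) by simp
  finally show "\<exists>F c. finite F \<and> F \<subseteq> I \<and> l2_norm m (\<lambda>x. (f x + g x) - (\<Sum>i\<in>F. c i * e i x)) < \<epsilon>"
    using F(1,2) F'(1,2) by (intro exI[of _ "F \<union> F'"] exI[of _ d]) auto
qed

lemma closed_span_scale:
  assumes "f \<in> closed_span m e I"
  shows "(\<lambda>x. c * f x) \<in> closed_span m e I"
proof (rule closed_spanI)
  show "(\<lambda>x. c * f x) \<in> L2 m" using assms by (intro L2_cmult closed_span_L2)
  fix \<epsilon> :: real assume "\<epsilon> > 0"
  define \<delta> where "\<delta> = \<epsilon> / (cmod c + 1)"
  have pos: "0 < cmod c + 1" by (simp add: add_nonneg_pos)
  then have "\<delta> > 0" using \<open>\<epsilon> > 0\<close> by (simp add: \<delta>_def)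
  then obtain F d where F: "finite F" "F \<subseteq> I" "l2_norm m (\<lambda>x. f x - (\<Sum>i\<in>F. d i * e i x)) < \<delta>"
    using assms unfolding closed_span_def by blast
  have "l2_norm m (\<lambda>x. c * f x - (\<Sum>i\<in>F. (c * d i) * e i x)) =
      cmod c * l2_norm m (\<lambda>x. f x - (\<Sum>i\<in>F. d i * e i x))"
    unfolding l2_norm_cmult[symmetric] by (simp add: sum_distrib_left right_diff_distrib mult.assoc)
  also have "\<dots> \<le> cmod c * \<delta>" using F(3) by (intro mult_left_mono) auto
  also have "\<dots> < (cmod c + 1) * \<delta>" using \<open>\<delta> > 0\<close> by (simp add: ring_distribs)
  also have "\<dots> = \<epsilon>" using pos by (simp add: \<delta>_def)
  finally show "\<exists>F d. finite F \<and> F \<subseteq> I \<and> l2_norm m (\<lambda>x. c * f x - (\<Sum>i\<in>F. d i * e i x)) < \<epsilon>"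
    using F(1,2) by (intro exI[of _ F] exI[of _ "\<lambda>i. c * d i"]) auto
qed

lemma closed_span_sum:
  assumes "\<And>i. i \<in> I \<Longrightarrow> e i \<in> L2 m" "finite J" "\<And>j. j \<in> J \<Longrightarrow> f j \<in> closed_span m e I"
  shows "(\<lambda>x. \<Sum>j\<in>J. f j x) \<in> closed_span m e I"
  using assms(2,3)
proof (induction J)
  case empty
  show ?case
    by (rule closed_spanI) (auto intro!: exI[of _ "{}"] simp: l2_norm_def)
next
  case (insert j J)
  then show ?case by (simp add: closed_span_add[OF assms(1)])
qed

lemma closed_span_closed:
  assumes e: "\<And>i. i \<in> I \<Longrightarrow> e i \<in> L2 m" and f: "f \<in> L2 m"
    and g: "\<And>\<epsilon>. \<epsilon> > 0 \<Longrightarrow> \<exists>g\<in>closed_span m e I. l2_norm m (\<lambda>x. f x - g x) < \<epsilon>"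
  shows "f \<in> closed_span m e I"
proof (rule closed_spanI[OF f])
  fix \<epsilon> :: real assume "\<epsilon> > 0"
  then obtain g where g: "g \<in> closed_span m e I" "l2_norm m (\<lambda>x. f x - g x) < \<epsilon> / 2"
    using g[of "\<epsilon> / 2"] by auto
  then obtain F c where F: "finite F" "F \<subseteq> I" "l2_norm m (\<lambda>x. g x - (\<Sum>i\<in>F. c i * e i x)) < \<epsilon> / 2"
    using \<open>\<epsilon> > 0\<close> unfolding closed_span_def mem_Collect_eq by (meson half_gt_zero)
  have "l2_norm m (\<lambda>x. f x - (\<Sum>i\<in>F. c i * e i x)) =
      l2_norm m (\<lambda>x. (f x - g x) + (g x - (\<Sum>i\<in>F. c i * e i x)))" by simp
  also have "\<dots> \<le> l2_norm m (\<lambda>x. f x - g x) + l2_norm m (\<lambda>x. g x - (\<Sum>i\<in>F. c i * e i x))"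
    using F(2) e f g(1) by (intro l2_norm_add_le L2_diff L2_lincomb) (auto dest: closed_span_L2)
  also have "\<dots> < \<epsilon>" using F(3) g(2) by simp
  finally show "\<exists>F c. finite F \<and> F \<subseteq> I \<and> l2_norm m (\<lambda>x. f x - (\<Sum>i\<in>F. c i * e i x)) < \<epsilon>"
    using F(1,2) by blast
qed

definition orthonormal :: "'x measure \<Rightarrow> ('i \<Rightarrow> 'x \<Rightarrow> complex) \<Rightarrow> 'i set \<Rightarrow> bool" where
  "orthonormal m e I \<longleftrightarrow> (\<forall>i\<in>I. e i \<in> L2 m) \<and>
     (\<forall>i\<in>I. \<forall>j\<in>I. l2_inner m (e i) (e j) = (if i = j then 1 else 0))"

lemma orthonormal_norm_lincomb:
  assumes e: "orthonormal m e I" and F: "finite F" "F \<subseteq> I"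
  shows "(l2_norm m (\<lambda>x. \<Sum>i\<in>F. c i * e i x))\<^sup>2 = (\<Sum>i\<in>F. (cmod (c i))\<^sup>2)"
proof -
  have L: "e i \<in> L2 m" if "i \<in> F" for i using e F that by (auto simp: orthonormal_def)
  have "l2_inner m (\<lambda>x. \<Sum>i\<in>F. c i * e i x) (e j) = c j" if "j \<in> F" for j
  proof -
    have "l2_inner m (\<lambda>x. \<Sum>i\<in>F. c i * e i x) (e j) = cnj (\<Sum>i\<in>F. cnj (c i) * l2_inner m (e j) (e i))"
      using L that by (subst l2_inner_commute) (simp only: l2_inner_lincomb_right)
    also have "(\<Sum>i\<in>F. cnj (c i) * l2_inner m (e j) (e i)) = (\<Sum>i\<in>F. if i = j then cnj (c i) else 0)"
      using e F that by (intro sum.cong) (auto simp: orthonormal_def subset_eq)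
    finally show ?thesis using that F by simp
  qed
  then have "complex_of_real ((l2_norm m (\<lambda>x. \<Sum>i\<in>F. c i * e i x))\<^sup>2) = (\<Sum>i\<in>F. cnj (c i) * c i)"
    unfolding l2_inner_self[symmetric]
    by (subst l2_inner_lincomb_right) (auto intro!: L L2_lincomb sum.cong)
  also have "\<dots> = complex_of_real (\<Sum>i\<in>F. (cmod (c i))\<^sup>2)"
    unfolding of_real_sum complex_norm_square by (simp add: mult.commute)
  finally show ?thesis by (simp only: of_real_eq_iff)
qed

text \<open>Completing the square: the Fourier coefficients are the best choice of \<open>c\<close>, from which
  Bessel's inequality and Parseval's identity are read off.\<close>

lemma orthonormal_norm_diff:
  assumes e: "orthonormal m e I" and F: "finite F" "F \<subseteq> I" and f: "f \<in> L2 m"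
  shows "(l2_norm m (\<lambda>x. f x - (\<Sum>i\<in>F. c i * e i x)))\<^sup>2 =
    (l2_norm m f)\<^sup>2 - (\<Sum>i\<in>F. (cmod (l2_inner m f (e i)))\<^sup>2) + (\<Sum>i\<in>F. (cmod (l2_inner m f (e i) - c i))\<^sup>2)"
proof -
  have L: "e i \<in> L2 m" if "i \<in> F" for i using e F that by (auto simp: orthonormal_def)
  have "(cmod (a - b))\<^sup>2 = (cmod a)\<^sup>2 - 2 * Re (cnj b * a) + (cmod b)\<^sup>2" for a b :: complex
    unfolding cmod_power2 by (simp add: power2_eq_square algebra_simps)
  then have "(\<Sum>i\<in>F. (cmod (l2_inner m f (e i) - c i))\<^sup>2) = (\<Sum>i\<in>F. (cmod (l2_inner m f (e i)))\<^sup>2)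
      - 2 * (\<Sum>i\<in>F. Re (cnj (c i) * l2_inner m f (e i))) + (\<Sum>i\<in>F. (cmod (c i))\<^sup>2)"
    by (simp only: sum.distrib sum_subtractf sum_distrib_left)
  moreover have "Re (l2_inner m f (\<lambda>x. \<Sum>i\<in>F. c i * e i x)) = (\<Sum>i\<in>F. Re (cnj (c i) * l2_inner m f (e i)))"
    using L f by (subst l2_inner_lincomb_right) auto
  ultimately show ?thesis
    using L by (subst l2_norm_diff_sq[OF f L2_lincomb]) (auto simp: orthonormal_norm_lincomb[OF e F])
qed

lemma Bessel_inequality:
  assumes "orthonormal m e I" "finite F" "F \<subseteq> I" "f \<in> L2 m"
  shows "(\<Sum>i\<in>F. (cmod (l2_inner m f (e i)))\<^sup>2) \<le> (l2_norm m f)\<^sup>2"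
  using orthonormal_norm_diff[OF assms, of "\<lambda>i. l2_inner m f (e i)"]
    zero_le_power2[of "l2_norm m (\<lambda>x. f x - (\<Sum>i\<in>F. l2_inner m f (e i) * e i x))"]
  by simp

lemma orthonormal_expansion:
  assumes e: "orthonormal m e I" and f: "f \<in> closed_span m e I" and "\<epsilon> > 0"
  obtains F where "finite F" "F \<subseteq> I" "l2_norm m (\<lambda>x. f x - (\<Sum>i\<in>F. l2_inner m f (e i) * e i x)) < \<epsilon>"
proof -
  obtain F c where F: "finite F" "F \<subseteq> I" "l2_norm m (\<lambda>x. f x - (\<Sum>i\<in>F. c i * e i x)) < \<epsilon>"
    using f \<open>\<epsilon> > 0\<close> unfolding closed_span_def by blast
  note d = orthonormal_norm_diff[OF e F(1,2) closed_span_L2[OF f]]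
  have "(l2_norm m (\<lambda>x. f x - (\<Sum>i\<in>F. l2_inner m f (e i) * e i x)))\<^sup>2 \<le>
      (l2_norm m (\<lambda>x. f x - (\<Sum>i\<in>F. c i * e i x)))\<^sup>2"
    unfolding d by (simp add: sum_nonneg)
  then have "l2_norm m (\<lambda>x. f x - (\<Sum>i\<in>F. l2_inner m f (e i) * e i x)) \<le>
      l2_norm m (\<lambda>x. f x - (\<Sum>i\<in>F. c i * e i x))"
    by (rule power2_le_imp_le) simp
  with F show thesis by (intro that[of F]) auto
qed

lemma has_sum_nonnegI:
  fixes f :: "'i \<Rightarrow> real"
  assumes nonneg: "\<And>i. i \<in> I \<Longrightarrow> 0 \<le> f i"
    and upper: "\<And>F. finite F \<Longrightarrow> F \<subseteq> I \<Longrightarrow> sum f F \<le> S"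
    and sup: "\<And>\<epsilon>. \<epsilon> > 0 \<Longrightarrow> \<exists>F. finite F \<and> F \<subseteq> I \<and> S - \<epsilon> < sum f F"
  shows "(f has_sum S) I"
  unfolding has_sum_def
proof (rule tendstoI)
  fix \<epsilon> :: real assume "\<epsilon> > 0"
  then obtain F where F: "finite F" "F \<subseteq> I" "S - \<epsilon> < sum f F" using sup by blast
  have "dist (sum f F') S < \<epsilon>" if "finite F'" "F' \<subseteq> I" "F \<subseteq> F'" for F'
    using upper[OF that(1,2)] sum_mono2[OF that(1,3), of f] nonneg that(2) F(3)
    by (force simp: dist_real_def)
  then show "\<forall>\<^sub>F F in finite_subsets_at_top I. dist (sum f F) S < \<epsilon>"
    unfolding eventually_finite_subsets_at_top using F by blast
qed

lemma Parseval:
  assumes e: "orthonormal m e I" and f: "f \<in> closed_span m e I"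
  shows "((\<lambda>i. (cmod (l2_inner m f (e i)))\<^sup>2) has_sum (l2_norm m f)\<^sup>2) I"
proof (rule has_sum_nonnegI)
  note fL = closed_span_L2[OF f]
  show "(\<Sum>i\<in>F. (cmod (l2_inner m f (e i)))\<^sup>2) \<le> (l2_norm m f)\<^sup>2" if "finite F" "F \<subseteq> I" for F
    using Bessel_inequality[OF e that fL] .
  fix \<epsilon> :: real assume "\<epsilon> > 0"
  then obtain F where F: "finite F" "F \<subseteq> I"
    "l2_norm m (\<lambda>x. f x - (\<Sum>i\<in>F. l2_inner m f (e i) * e i x)) < sqrt \<epsilon>"
    using orthonormal_expansion[OF e f, of "sqrt \<epsilon>"] by auto
  then have "(l2_norm m (\<lambda>x. f x - (\<Sum>i\<in>F. l2_inner m f (e i) * e i x)))\<^sup>2 < \<epsilon>"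
    using \<open>\<epsilon> > 0\<close> by (metis l2_norm_nonneg real_less_rsqrt real_sqrt_less_iff real_sqrt_unique)
  then show "\<exists>F. finite F \<and> F \<subseteq> I \<and> (l2_norm m f)\<^sup>2 - \<epsilon> < (\<Sum>i\<in>F. (cmod (l2_inner m f (e i)))\<^sup>2)"
    unfolding orthonormal_norm_diff[OF e F(1,2) fL] using F(1,2) by (intro exI[of _ F]) simp
qed simp

lemma infsum_ennreal_eq:
  fixes f :: "'i \<Rightarrow> real"
  assumes "(f has_sum S) I" "\<And>i. i \<in> I \<Longrightarrow> 0 \<le> f i"
  shows "(\<Sum>\<^sub>\<infinity>i\<in>I. ennreal (f i)) = ennreal S"
proof -
  have "ennreal S = ennreal (infsum f I)" using assms(1) by (simp add: infsumI)
  also have "\<dots> = (SUP F\<in>{F. finite F \<and> F \<subseteq> I}. ennreal (sum f F))"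
    using assms by (intro infsum_nonneg_is_SUPREMUM_ennreal has_sum_imp_summable) auto
  also have "\<dots> = (SUP F\<in>{F. finite F \<and> F \<subseteq> I}. (\<Sum>i\<in>F. ennreal (f i)))"
    using assms(2) by (intro SUP_cong refl sum_ennreal[symmetric]) auto
  also have "\<dots> = (\<Sum>\<^sub>\<infinity>i\<in>I. ennreal (f i))"
    by (rule nonneg_infsum_complete[symmetric]) simp
  finally show ?thesis ..
qed

lemma infsum_ennreal_le_iff:
  fixes f :: "'i \<Rightarrow> real"
  assumes "\<And>i. i \<in> I \<Longrightarrow> 0 \<le> f i" "0 \<le> c"
  shows "(\<Sum>\<^sub>\<infinity>i\<in>I. ennreal (f i)) \<le> ennreal c \<longleftrightarrow> (\<forall>F. finite F \<longrightarrow> F \<subseteq> I \<longrightarrow> sum f F \<le> c)"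
proof -
  have "(\<Sum>\<^sub>\<infinity>i\<in>I. ennreal (f i)) = (SUP F\<in>{F. finite F \<and> F \<subseteq> I}. ennreal (sum f F))"
    using assms(1) by (subst nonneg_infsum_complete) (auto intro!: SUP_cong sum_ennreal)
  then show ?thesis using assms(2) by (auto simp: SUP_le_iff)
qed

lemma has_sum_product_finite:
  fixes f :: "'a \<Rightarrow> 'b \<Rightarrow> real"
  assumes "finite J" "\<And>j. j \<in> J \<Longrightarrow> ((\<lambda>i. f i j) has_sum S j) I"
  shows "((\<lambda>(i, j). f i j) has_sum sum S J) (I \<times> J)"
  using assms
proof (induction J)
  case (insert j J)
  have "((\<lambda>(i, j). f i j) has_sum S j) ((\<lambda>i. (i, j)) ` I)"
    using insert.prems[of j] by (subst has_sum_reindex) (auto simp: inj_on_def o_def)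
  moreover have "((\<lambda>(i, j). f i j) has_sum sum S J) (I \<times> J)"
    using insert by auto
  ultimately have "((\<lambda>(i, j). f i j) has_sum (S j + sum S J)) ((\<lambda>i. (i, j)) ` I \<union> I \<times> J)"
    using insert.hyps by (intro has_sum_Un_disjoint) auto
  moreover have "(\<lambda>i. (i, j)) ` I \<union> I \<times> J = I \<times> insert j J" by auto
  ultimately show ?case using insert.hyps by simp
qed simp

section \<open>Riesz bases are stable frames\<close>

lemma l2_bounded_operator_linear:
  "l2_bounded_operator m U \<Longrightarrow> f \<in> L2 m \<Longrightarrow> g \<in> L2 m \<Longrightarrow>
    AE x in m. U (\<lambda>y. c * f y + d * g y) x = c * U f x + d * U g x"
  by (simp add: l2_bounded_operator_def)

lemma l2_bounded_operator_lincomb: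
  assumes U: "l2_bounded_operator m U" and F: "finite F" "\<And>i. i \<in> F \<Longrightarrow> f i \<in> L2 m"
  shows "AE x in m. U (\<lambda>y. \<Sum>i\<in>F. c i * f i y) x = (\<Sum>i\<in>F. c i * U (f i) x)"
  using F
proof (induction F)
  case empty
  have "AE x in m. U (\<lambda>y. 0 * 0 + 0 * 0) x = 0 * U (\<lambda>_. 0) x + 0 * U (\<lambda>_. 0) x"
    by (rule l2_bounded_operator_linear[OF U L2_zero L2_zero])
  then show ?case by simp
next
  case (insert j F)
  have "AE x in m. U (\<lambda>y. c j * f j y + 1 * (\<Sum>i\<in>F. c i * f i y)) x =
      c j * U (f j) x + 1 * U (\<lambda>y. \<Sum>i\<in>F. c i * f i y) x"
    using insert.prems by (intro l2_bounded_operator_linear[OF U] L2_lincomb) auto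
  moreover have "AE x in m. U (\<lambda>y. \<Sum>i\<in>F. c i * f i y) x = (\<Sum>i\<in>F. c i * U (f i) x)"
    using insert by blast
  ultimately show ?case
    by eventually_elim (use insert.hyps in simp)
qed

lemma l2_bounded_operator_bound:
  assumes "l2_bounded_operator m U"
  obtains C where "C > 0" "\<And>f. f \<in> L2 m \<Longrightarrow> l2_norm m (U f) \<le> C * l2_norm m f"
proof -
  obtain C where C: "\<And>f. f \<in> L2 m \<Longrightarrow> l2_norm m (U f) \<le> C * l2_norm m f"
    using assms unfolding l2_bounded_operator_def by blast
  have "l2_norm m (U f) \<le> (\<bar>C\<bar> + 1) * l2_norm m f" if "f \<in> L2 m" for f
    using C[OF that] mult_right_mono[of C "\<bar>C\<bar> + 1" "l2_norm m f"] l2_norm_nonneg[of m f] by linarith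
  then show thesis by (intro that[of "\<bar>C\<bar> + 1"]) auto
qed

text \<open>The bounded inverse \<open>V\<close> recovers the combination of the orthonormal basis with the same
  coefficients.\<close>

lemma riesz_basis_stable:
  assumes R: "riesz_basis m e I" and e: "\<And>i. i \<in> I \<Longrightarrow> e i \<in> L2 m"
  obtains C where "C > 0" "\<And>F c. finite F \<Longrightarrow> F \<subseteq> I \<Longrightarrow>
    (\<Sum>i\<in>F. (cmod (c i))\<^sup>2) \<le> C * (l2_norm m (\<lambda>x. \<Sum>i\<in>F. c i * e i x))\<^sup>2"
proof -
  obtain b U V where b: "orthonormal_basis m b I" and U: "l2_bounded_operator m U"
    and V: "l2_bounded_operator m V"
    and VU: "\<And>f. f \<in> L2 m \<Longrightarrow> AE x in m. V (U f) x = f x"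
    and Ub: "\<And>i. i \<in> I \<Longrightarrow> AE x in m. U (b i) x = e i x"
    using R unfolding riesz_basis_def by blast
  have on: "orthonormal m b I" using b by (simp add: orthonormal_basis_def orthonormal_def)
  obtain C where C: "C > 0" "\<And>f. f \<in> L2 m \<Longrightarrow> l2_norm m (V f) \<le> C * l2_norm m f"
    using l2_bounded_operator_bound[OF V] by blast
  have "(\<Sum>i\<in>F. (cmod (c i))\<^sup>2) \<le> C\<^sup>2 * (l2_norm m (\<lambda>x. \<Sum>i\<in>F. c i * e i x))\<^sup>2"
    if F: "finite F" "F \<subseteq> I" for F c
  proof -
    define g where "g x = (\<Sum>i\<in>F. c i * b i x)" for x
    have bL: "b i \<in> L2 m" if "i \<in> F" for i using F that on by (auto simp: orthonormal_def)
    have g: "g \<in> L2 m" unfolding g_def by (intro L2_lincomb bL)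
    then have Ug: "U g \<in> L2 m" and VUg: "V (U g) \<in> L2 m"
      using U V by (auto simp: l2_bounded_operator_def)
    have "AE x in m. \<forall>i\<in>F. U (b i) x = e i x"
      using F Ub by (intro AE_finite_allI) auto
    moreover have "AE x in m. U g x = (\<Sum>i\<in>F. c i * U (b i) x)"
      unfolding g_def by (rule l2_bounded_operator_lincomb[OF U F(1) bL])
    ultimately have "AE x in m. U g x = (\<Sum>i\<in>F. c i * e i x)"
      by eventually_elim simp
    then have 1: "l2_norm m (U g) = l2_norm m (\<lambda>x. \<Sum>i\<in>F. c i * e i x)"
      using Ug L2_lincomb[of F e m c] e F(2) by (intro l2_norm_AE_cong) (auto dest: L2_measurable)
    have "(\<Sum>i\<in>F. (cmod (c i))\<^sup>2) = (l2_norm m g)\<^sup>2"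
      unfolding g_def by (rule orthonormal_norm_lincomb[OF on F, symmetric])
    also have "l2_norm m g = l2_norm m (V (U g))"
      using VU[OF g] g VUg by (intro l2_norm_AE_cong) (auto dest: L2_measurable)
    also have "(l2_norm m (V (U g)))\<^sup>2 \<le> (C * l2_norm m (U g))\<^sup>2"
      by (intro power_mono C(2) Ug) simp
    finally show ?thesis by (simp add: 1 power_mult_distrib)
  qed
  then show thesis using C(1) by (intro that[of "C\<^sup>2"]) auto
qed

text \<open>The textbook argument applies Parseval's identity to \<open>U\<^sup>* f\<close>. Here finite sums take the
  place of the adjoint. For the upper bound, the sum of the squared coefficients is the inner
  product of \<open>f\<close> with \<open>U g\<close>, where \<open>g\<close> is the combination of basis vectors with these
  coefficients. For the lower bound, \<open>V f\<close> is expanded in the basis and mapped back by \<open>U\<close>, which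
  approximates \<open>f\<close> by combinations of the \<open>e i\<close> whose coefficients are bounded by the norm of \<open>f\<close>.\<close>

lemma riesz_basis_imp_frame:
  assumes R: "riesz_basis m e I" and e: "\<And>i. i \<in> I \<Longrightarrow> e i \<in> L2 m"
  shows "frame m e I"
proof -
  obtain b U V where b: "orthonormal_basis m b I" and U: "l2_bounded_operator m U"
    and V: "l2_bounded_operator m V"
    and UV: "\<And>f. f \<in> L2 m \<Longrightarrow> AE x in m. U (V f) x = f x"
    and Ub: "\<And>i. i \<in> I \<Longrightarrow> AE x in m. U (b i) x = e i x"
    using R unfolding riesz_basis_def by blast
  have on: "orthonormal m b I" using b by (simp add: orthonormal_basis_def orthonormal_def)
  have complete: "f \<in> closed_span m b I" if "f \<in> L2 m" for f
    using b that by (auto simp: orthonormal_basis_def complete_system_iff)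
  obtain C where C: "C > 0" "\<And>f. f \<in> L2 m \<Longrightarrow> l2_norm m (U f) \<le> C * l2_norm m f"
    using l2_bounded_operator_bound[OF U] by blast
  obtain D where D: "D > 0" "\<And>f. f \<in> L2 m \<Longrightarrow> l2_norm m (V f) \<le> D * l2_norm m f"
    using l2_bounded_operator_bound[OF V] by blast
  have lin: "AE x in m. U (\<lambda>x. \<Sum>i\<in>F. c i * b i x) x = (\<Sum>i\<in>F. c i * e i x)"
    if F: "finite F" "F \<subseteq> I" for F c
  proof -
    have "AE x in m. \<forall>i\<in>F. U (b i) x = e i x"
      using F Ub by (intro AE_finite_allI) auto
    moreover have "AE x in m. U (\<lambda>x. \<Sum>i\<in>F. c i * b i x) x = (\<Sum>i\<in>F. c i * U (b i) x)"
      using F on by (intro l2_bounded_operator_lincomb[OF U]) (auto simp: orthonormal_def)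
    ultimately show ?thesis by eventually_elim simp
  qed
  define a where "a f i = l2_inner m f (e i)" for f i
  have upper: "(\<Sum>i\<in>F. (cmod (a f i))\<^sup>2) \<le> C\<^sup>2 * (l2_norm m f)\<^sup>2"
    if f: "f \<in> L2 m" and F: "finite F" "F \<subseteq> I" for f F
  proof -
    define S where "S = (\<Sum>i\<in>F. (cmod (a f i))\<^sup>2)"
    define g where "g x = (\<Sum>i\<in>F. a f i * b i x)" for x
    have g: "g \<in> L2 m" unfolding g_def using F on by (intro L2_lincomb) (auto simp: orthonormal_def)
    have eF: "(\<lambda>x. \<Sum>i\<in>F. a f i * e i x) \<in> L2 m" using F e by (intro L2_lincomb) auto
    have Ug: "U g \<in> L2 m" using U g by (auto simp: l2_bounded_operator_def)
    have norm_g: "(l2_norm m g)\<^sup>2 = S"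
      unfolding g_def S_def by (rule orthonormal_norm_lincomb[OF on F])
    have "complex_of_real S = (\<Sum>i\<in>F. cnj (a f i) * a f i)"
      unfolding S_def of_real_sum complex_norm_square by (simp add: mult.commute)
    also have "\<dots> = l2_inner m f (\<lambda>x. \<Sum>i\<in>F. a f i * e i x)"
      unfolding a_def using F e f by (intro l2_inner_lincomb_right[symmetric]) auto
    also have "\<dots> = l2_inner m f (U g)"
      using lin[OF F, of "a f"] eF Ug f unfolding g_def[symmetric]
      by (intro l2_inner_AE_cong) (auto dest: L2_measurable)
    finally have eq: "complex_of_real S = l2_inner m f (U g)" .
    have "S \<ge> 0" unfolding S_def by (simp add: sum_nonneg)
    then have "S = cmod (l2_inner m f (U g))" by (simp flip: eq)
    also have "\<dots> \<le> l2_norm m f * (C * l2_norm m g)"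
      using l2_Cauchy_Schwarz[OF f Ug] mult_left_mono[OF C(2)[OF g], of "l2_norm m f"] by simp
    also have "\<dots> = (C * l2_norm m f) * sqrt S"
      using norm_g by (metis l2_norm_nonneg mult.assoc mult.commute real_sqrt_abs abs_of_nonneg)
    finally have "S \<le> (C * l2_norm m f) * sqrt S" .
    with \<open>S \<ge> 0\<close> have "sqrt S \<le> C * l2_norm m f \<or> S = 0"
      by (metis less_eq_real_def mult_le_cancel_right real_sqrt_gt_zero real_sqrt_mult_self abs_of_nonneg not_less)
    then have "S \<le> (C * l2_norm m f)\<^sup>2"
      using \<open>S \<ge> 0\<close> by (metis real_sqrt_le_iff sqrt_le_D zero_le_power2)
    then show ?thesis by (simp add: S_def power_mult_distrib)
  qed
  have lower: "(l2_norm m f)\<^sup>2 \<le> D\<^sup>2 * T"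
    if f: "f \<in> L2 m" and T: "\<And>F. finite F \<Longrightarrow> F \<subseteq> I \<Longrightarrow> (\<Sum>i\<in>F. (cmod (a f i))\<^sup>2) \<le> T" for f T
  proof -
    define g where "g = V f"
    have g: "g \<in> L2 m" using V f by (simp add: g_def l2_bounded_operator_def)
    have T0: "T \<ge> 0" using T[of "{}"] by simp
    \<comment> \<open>The error \<open>C * \<delta>\<close> comes from approximating \<open>V f\<close> by its expansion up to \<open>\<delta>\<close> and applying \<open>U\<close>.\<close>
    have step: "(l2_norm m f)\<^sup>2 \<le> l2_norm m f * (C * \<delta>) + l2_norm m f * (D * sqrt T)" if "\<delta> > 0" for \<delta>
    proof -
      obtain F where F: "finite F" "F \<subseteq> I" "l2_norm m (\<lambda>x. g x - (\<Sum>i\<in>F. l2_inner m g (b i) * b i x)) < \<delta>"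
        using orthonormal_expansion[OF on complete[OF g] \<open>\<delta> > 0\<close>] by blast
      define c where "c i = l2_inner m g (b i)" for i
      define p where "p x = (\<Sum>i\<in>F. c i * b i x)" for x
      define w where "w x = (\<Sum>i\<in>F. c i * e i x)" for x
      have p: "p \<in> L2 m" unfolding p_def using F on by (intro L2_lincomb) (auto simp: orthonormal_def)
      have w: "w \<in> L2 m" unfolding w_def using F e by (intro L2_lincomb) auto
      have gp: "(\<lambda>x. g x - p x) \<in> L2 m" using g p by (rule L2_diff)
      have "AE x in m. U (\<lambda>x. 1 * g x + (-1) * p x) x = 1 * U g x + (-1) * U p x"
        using U g p unfolding l2_bounded_operator_def by blast
      moreover have "AE x in m. U p x = w x"
        unfolding p_def w_def by (rule lin[OF F(1,2)])
      moreover have "AE x in m. U g x = f x" unfolding g_def by (rule UV[OF f])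
      ultimately have "AE x in m. f x - w x = U (\<lambda>x. g x - p x) x"
        by eventually_elim simp
      moreover have "U (\<lambda>x. g x - p x) \<in> L2 m" using U gp by (simp add: l2_bounded_operator_def)
      ultimately have "l2_norm m (\<lambda>x. f x - w x) = l2_norm m (U (\<lambda>x. g x - p x))"
        using f w by (intro l2_norm_AE_cong) (auto dest: L2_measurable)
      also have "\<dots> \<le> C * l2_norm m (\<lambda>x. g x - p x)" by (rule C(2)[OF gp])
      also have "\<dots> \<le> C * \<delta>" using C(1) F(3) by (simp add: p_def c_def)
      finally have fw: "l2_norm m (\<lambda>x. f x - w x) \<le> C * \<delta>" .
      have "l2_inner m f f = l2_inner m f (\<lambda>x. f x - w x) + l2_inner m f w"
        using f w by (simp add: l2_inner_diff_right)
      then have "(l2_norm m f)\<^sup>2 \<le> cmod (l2_inner m f (\<lambda>x. f x - w x)) + cmod (l2_inner m f w)"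
        by (metis l2_inner_self norm_of_real norm_triangle_ineq abs_of_nonneg zero_le_power2)
      also have "cmod (l2_inner m f (\<lambda>x. f x - w x)) \<le> l2_norm m f * (C * \<delta>)"
        using l2_Cauchy_Schwarz[OF f L2_diff[OF f w]] mult_left_mono[OF fw, of "l2_norm m f"] by simp
      also have "cmod (l2_inner m f w) \<le> l2_norm m f * (D * sqrt T)"
      proof (rule power2_le_imp_le)
        have "l2_inner m f w = (\<Sum>i\<in>F. cnj (c i) * a f i)"
          unfolding w_def a_def using F(2) e f by (intro l2_inner_lincomb_right) auto
        then have "(cmod (l2_inner m f w))\<^sup>2 \<le> (\<Sum>i\<in>F. cmod (cnj (c i)) * cmod (a f i))\<^sup>2"
          by (auto simp: norm_mult intro!: power_mono sum_norm_le)
        also have "\<dots> \<le> (\<Sum>i\<in>F. (cmod (cnj (c i)))\<^sup>2) * (\<Sum>i\<in>F. (cmod (a f i))\<^sup>2)"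
          by (rule Cauchy_Schwarz_ineq_sum)
        also have "\<dots> \<le> (l2_norm m g)\<^sup>2 * T"
          using Bessel_inequality[OF on F(1,2) g] T[OF F(1,2)] by (intro mult_mono) (auto simp: c_def sum_nonneg)
        also have "\<dots> \<le> (D * l2_norm m f)\<^sup>2 * T"
          using D(2)[OF f] T0 unfolding g_def[symmetric] by (intro mult_right_mono power_mono) auto
        also have "\<dots> = (l2_norm m f * (D * sqrt T))\<^sup>2" using T0 by (simp add: power_mult_distrib)
        finally show "(cmod (l2_inner m f w))\<^sup>2 \<le> (l2_norm m f * (D * sqrt T))\<^sup>2" .
      qed (use D T0 in simp)
      finally show ?thesis by simp
    qed
    have "(l2_norm m f)\<^sup>2 \<le> l2_norm m f * (D * sqrt T) + \<epsilon>" if "\<epsilon> > 0" for \<epsilon>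
    proof -
      have "l2_norm m f * (C * (\<epsilon> / (l2_norm m f * C + 1))) \<le> \<epsilon>"
      proof -
        have "0 < l2_norm m f * C + 1" using C(1) by (simp add: add_nonneg_pos)
        then show ?thesis using \<open>\<epsilon> > 0\<close> by (simp add: pos_divide_le_eq algebra_simps)
      qed
      moreover have "\<epsilon> / (l2_norm m f * C + 1) > 0"
        using C(1) \<open>\<epsilon> > 0\<close> by (simp add: add_nonneg_pos)
      ultimately show ?thesis using step by fastforce
    qed
    then have le: "(l2_norm m f)\<^sup>2 \<le> l2_norm m f * (D * sqrt T)"
      by (rule field_le_epsilon)
    have "l2_norm m f \<le> D * sqrt T"
    proof (cases "l2_norm m f = 0")
      case True
      then show ?thesis using D T0 by simp
    next
      case False
      then have "0 < l2_norm m f" by (simp add: less_le)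
      then show ?thesis using le by (simp add: power2_eq_square)
    qed
    then have "(l2_norm m f)\<^sup>2 \<le> (D * sqrt T)\<^sup>2" by (intro power_mono) auto
    then show ?thesis using T0 by (simp add: power_mult_distrib)
  qed
  have "bessel_bound m e I (C\<^sup>2)"
    unfolding bessel_bound_def a_def[symmetric]
  proof (intro conjI ballI)
    fix f assume f: "f \<in> L2 m"
    show "(\<Sum>\<^sub>\<infinity>i\<in>I. ennreal ((cmod (a f i))\<^sup>2)) \<le> ennreal (C\<^sup>2 * (l2_norm m f)\<^sup>2)"
      by (subst infsum_ennreal_le_iff) (auto intro: upper[OF f])
  qed (use C in simp)
  moreover have "lower_frame_bound m e I (1 / D\<^sup>2)"
    unfolding lower_frame_bound_def a_def[symmetric]
  proof (intro conjI ballI)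
    fix f assume f: "f \<in> L2 m"
    have s: "(\<lambda>i. (cmod (a f i))\<^sup>2) summable_on I"
      by (rule nonneg_bounded_partial_sums_imp_summable_on[where C = "C\<^sup>2 * (l2_norm m f)\<^sup>2"])
        (auto intro!: eventually_finite_subsets_at_top_weakI upper[OF f])
    define T where "T = (\<Sum>\<^sub>\<infinity>i\<in>I. (cmod (a f i))\<^sup>2)"
    have "(\<Sum>i\<in>F. (cmod (a f i))\<^sup>2) \<le> T" if "finite F" "F \<subseteq> I" for F
      unfolding T_def using s that by (intro finite_sum_le_infsum) auto
    then have "1 / D\<^sup>2 * (l2_norm m f)\<^sup>2 \<le> T"
      using lower[OF f, of T] D by (simp add: field_simps)
    moreover have "(\<Sum>\<^sub>\<infinity>i\<in>I. ennreal ((cmod (a f i))\<^sup>2)) = ennreal T"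
      unfolding T_def by (rule infsum_ennreal_eq[OF has_sum_infsum[OF s]]) simp
    ultimately show "ennreal (1 / D\<^sup>2 * (l2_norm m f)\<^sup>2) \<le> (\<Sum>\<^sub>\<infinity>i\<in>I. ennreal ((cmod (a f i))\<^sup>2))"
      by (simp add: ennreal_leI)
  qed (use D in simp)
  ultimately show ?thesis unfolding frame_def by blast
qed

section \<open>Periodization over a tiling by finitely many translates\<close>

text \<open>The action of a finite abelian group of translations together with a measurable set of
  representatives of its orbits. The group law is present only as the reindexing \<open>\<sigma>\<close> that
  composition with a translation induces.\<close>

locale tiling = prob_space m
  for m :: "'x measure" +
  fixes T :: "nat \<Rightarrow> 'x \<Rightarrow> 'x" and r :: nat and \<Omega> :: "'x set"
  assumes r_pos: "0 < r"
    and T_measurable: "k < r \<Longrightarrow> T k \<in> m \<rightarrow>\<^sub>M m"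
    and T_distr: "k < r \<Longrightarrow> distr m m (T k) = m"
    and T_0: "x \<in> space m \<Longrightarrow> T 0 x = x"
    and T_commute: "k < r \<Longrightarrow> l < r \<Longrightarrow> x \<in> space m \<Longrightarrow> T k (T l x) = T l (T k x)"
    and T_comp: "k < r \<Longrightarrow> \<exists>\<sigma>. bij_betw \<sigma> {..<r} {..<r} \<and> (\<forall>l<r. \<forall>x\<in>space m. T l (T k x) = T (\<sigma> l) x)"
    and \<Omega>_sets [measurable]: "\<Omega> \<in> sets m"
    and \<Omega>_unique: "x \<in> space m \<Longrightarrow> \<exists>!k. k < r \<and> T k x \<in> \<Omega>"
begin

definition periodize :: "('x \<Rightarrow> 'b::comm_monoid_add) \<Rightarrow> 'x \<Rightarrow> 'b" where
  "periodize f x = (\<Sum>k<r. f (T k x))"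

definition periodic :: "('x \<Rightarrow> 'b) \<Rightarrow> bool" where
  "periodic f \<longleftrightarrow> (\<forall>k<r. \<forall>x\<in>space m. f (T k x) = f x)"

lemma periodicD: "periodic f \<Longrightarrow> k < r \<Longrightarrow> x \<in> space m \<Longrightarrow> f (T k x) = f x"
  by (simp add: periodic_def)

lemma T_space: "k < r \<Longrightarrow> x \<in> space m \<Longrightarrow> T k x \<in> space m"
  using T_measurable by (rule measurable_space)

lemma \<Omega>_space: "x \<in> \<Omega> \<Longrightarrow> x \<in> space m"
  using sets.sets_into_space[OF \<Omega>_sets] by blast

lemma measurable_T: "k < r \<Longrightarrow> f \<in> m \<rightarrow>\<^sub>M N \<Longrightarrow> (\<lambda>x. f (T k x)) \<in> m \<rightarrow>\<^sub>M N"
  using measurable_compose[OF T_measurable] .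

lemma periodic_periodize: "periodic (periodize f)"
  unfolding periodic_def
proof (intro allI impI ballI)
  fix k x assume kx: "k < r" "x \<in> space m"
  obtain \<sigma> where \<sigma>: "bij_betw \<sigma> {..<r} {..<r}" "\<forall>l<r. \<forall>x\<in>space m. T l (T k x) = T (\<sigma> l) x"
    using T_comp[OF kx(1)] by blast
  have "periodize f (T k x) = (\<Sum>l<r. f (T (\<sigma> l) x))"
    unfolding periodize_def using \<sigma>(2) kx(2) by (intro sum.cong) auto
  also have "\<dots> = periodize f x"
    unfolding periodize_def by (rule sum.reindex_bij_betw[OF \<sigma>(1)])
  finally show "periodize f (T k x) = periodize f x" .
qed

definition inv_index :: "nat \<Rightarrow> nat" where
  "inv_index k = (SOME l. l < r \<and> (\<forall>x\<in>space m. T l (T k x) = x))"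

lemma inv_index:
  assumes "k < r"
  shows "inv_index k < r" "x \<in> space m \<Longrightarrow> T (inv_index k) (T k x) = x"
    "x \<in> space m \<Longrightarrow> T k (T (inv_index k) x) = x"
proof -
  obtain \<sigma> where \<sigma>: "bij_betw \<sigma> {..<r} {..<r}" "\<forall>l<r. \<forall>x\<in>space m. T l (T k x) = T (\<sigma> l) x"
    using T_comp[OF assms] by blast
  then obtain l where "l < r" "\<sigma> l = 0"
    using r_pos by (metis bij_betw_imp_surj_on imageE lessThan_iff)
  then have "l < r \<and> (\<forall>x\<in>space m. T l (T k x) = x)" using \<sigma>(2) T_0 by simp
  then have *: "inv_index k < r \<and> (\<forall>x\<in>space m. T (inv_index k) (T k x) = x)"
    unfolding inv_index_def by (rule someI)
  then show "inv_index k < r" "x \<in> space m \<Longrightarrow> T (inv_index k) (T k x) = x" by auto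
  then show "x \<in> space m \<Longrightarrow> T k (T (inv_index k) x) = x"
    using T_commute[OF assms, of "inv_index k" x] * by simp
qed

text \<open>Translations commute, so a coincidence of \<open>T k\<close> and \<open>T l\<close> at \<open>x\<close> persists at every translate
  of \<open>x\<close>, in particular at one which \<open>T k\<close> carries into \<open>\<Omega>\<close>.\<close>

lemma T_free:
  assumes "k < r" "l < r" "x \<in> space m" "T k x = T l x"
  shows "k = l"
proof -
  obtain i where i: "i < r" "T i (T k x) \<in> \<Omega>"
    using \<Omega>_unique[OF T_space[OF assms(1,3)]] by blast
  have "T k (T i x) \<in> \<Omega>" "T l (T i x) \<in> \<Omega>"
    using i assms T_commute[of i k x] T_commute[of i l x] by auto
  then show ?thesis
    using \<Omega>_unique[OF T_space[OF i(1) assms(3)]] assms(1,2) by blast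
qed

lemma bij_inv_index: "bij_betw inv_index {..<r} {..<r}"
proof -
  obtain x where x: "x \<in> space m" using not_empty by blast
  have "inj_on inv_index {..<r}"
  proof (rule inj_onI)
    fix k l assume kl: "k \<in> {..<r}" "l \<in> {..<r}" "inv_index k = inv_index l"
    define y where "y = T (inv_index k) x"
    have y: "y \<in> space m" using kl inv_index(1)[of k] T_space x by (simp add: y_def)
    have "T k y = T l y" using kl inv_index(3)[of k x] inv_index(3)[of l x] x by (simp add: y_def)
    then show "k = l" using T_free[OF _ _ y] kl by blast
  qed
  moreover have "inv_index ` {..<r} \<subseteq> {..<r}" using inv_index(1) by auto
  ultimately show ?thesis
    by (simp add: bij_betw_def endo_inj_surj)
qed

lemma translate_in_\<Omega>_iff:
  assumes "\<xi> \<in> \<Omega>" "k < r" "l < r"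
  shows "T (inv_index l) (T k \<xi>) \<in> \<Omega> \<longleftrightarrow> l = k"
proof
  note \<xi> = \<Omega>_space[OF assms(1)]
  assume *: "T (inv_index l) (T k \<xi>) \<in> \<Omega>"
  have "T (inv_index k) (T k \<xi>) \<in> \<Omega>" using inv_index(2)[OF assms(2) \<xi>] assms(1) by simp
  then have "inv_index l = inv_index k"
    using \<Omega>_unique[OF T_space[OF assms(2) \<xi>]] * inv_index(1)[OF assms(2)] inv_index(1)[OF assms(3)] by blast
  then show "l = k" using bij_inv_index assms(2,3) by (auto simp: bij_betw_def dest: inj_onD)
qed (use assms inv_index(2) \<Omega>_space in simp)

lemma T_in_\<Omega>_iff: "\<xi> \<in> \<Omega> \<Longrightarrow> k < r \<Longrightarrow> T k \<xi> \<in> \<Omega> \<longleftrightarrow> k = 0"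
  using \<Omega>_unique[OF \<Omega>_space[of \<xi>]] T_0[OF \<Omega>_space[of \<xi>]] r_pos by metis

lemma AE_T:
  assumes "k < r" "AE x in m. P x"
  shows "AE x in m. P (T k x)"
  using AE_distrD[OF T_measurable[OF assms(1)], of P] assms(2) unfolding T_distr[OF assms(1)] .

text \<open>Every point is a translate of a point of \<open>\<Omega>\<close>, and translations preserve null sets.\<close>

lemma AE_fiberI:
  assumes "AE \<xi> in m. \<xi> \<in> \<Omega> \<longrightarrow> (\<forall>k<r. P (T k \<xi>))"
  shows "AE x in m. P x"
proof -
  have "AE x in m. \<forall>l\<in>{..<r}. T l x \<in> \<Omega> \<longrightarrow> (\<forall>k<r. P (T k (T l x)))"
    using AE_T[OF _ assms] by (intro AE_finite_allI) auto
  then show ?thesis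
  proof (rule AE_mp, intro AE_I2 impI)
    fix x assume x: "x \<in> space m" and *: "\<forall>l\<in>{..<r}. T l x \<in> \<Omega> \<longrightarrow> (\<forall>k<r. P (T k (T l x)))"
    obtain l where l: "l < r" "T l x \<in> \<Omega>" using \<Omega>_unique[OF x] by blast
    then show "P x" using * inv_index(1,2)[OF l(1)] x by force
  qed
qed

lemma AE_fiberD:
  assumes "AE x in m. P x"
  shows "AE \<xi> in m. \<forall>k<r. P (T k \<xi>)"
proof -
  have "AE \<xi> in m. \<forall>k\<in>{..<r}. P (T k \<xi>)"
    using AE_T[OF _ assms] by (intro AE_finite_allI) auto
  then show ?thesis by (simp add: Ball_def)
qed

lemma integrable_T:
  fixes f :: "'x \<Rightarrow> 'b::{banach, second_countable_topology}"
  assumes "k < r" "integrable m f"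
  shows "integrable m (\<lambda>x. f (T k x))"
  using integrable_distr[OF T_measurable[OF assms(1)], of f] T_distr assms by simp

lemma integral_T:
  fixes f :: "'x \<Rightarrow> 'b::{banach, second_countable_topology}"
  assumes "k < r" "f \<in> borel_measurable m"
  shows "(LINT x|m. f (T k x)) = (LINT x|m. f x)"
  using integral_distr[OF T_measurable[OF assms(1)] assms(2)] T_distr assms by simp

lemma measurable_periodize [measurable]:
  fixes f :: "'x \<Rightarrow> 'b::{second_countable_topology, topological_comm_monoid_add}"
  assumes "f \<in> borel_measurable m"
  shows "periodize f \<in> borel_measurable m"
  unfolding periodize_def[abs_def] using assms measurable_T by (intro borel_measurable_sum) auto

lemma integrable_periodize:
  fixes f :: "'x \<Rightarrow> 'b::{banach, second_countable_topology}"
  assumes "integrable m f"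
  shows "integrable m (periodize f)"
  unfolding periodize_def[abs_def] using assms by (intro Bochner_Integration.integrable_sum integrable_T) auto

text \<open>The translates of the indicator of \<open>\<Omega>\<close> are a partition of unity; each summand is moved back
  to \<open>\<Omega>\<close> by an inverse translation.\<close>

lemma integral_fiber:
  fixes f :: "'x \<Rightarrow> 'b::{banach, second_countable_topology}"
  assumes f: "integrable m f"
  shows "(LINT x|m. f x) = (LINT \<xi>:\<Omega>|m. periodize f \<xi>)"
proof -
  have fm [measurable]: "f \<in> borel_measurable m" using f by simp
  have int: "integrable m (\<lambda>x. indicat_real \<Omega> (T k x) *\<^sub>R f x)" if k: "k < r" for k
  proof -
    have "(\<lambda>x. indicat_real \<Omega> (T k x)) \<in> borel_measurable m"
      using k by (intro measurable_T) measurable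
    then show ?thesis
      using f by (intro Bochner_Integration.integrable_bound[OF f]) (auto simp: indicator_def)
  qed
  have one: "(\<Sum>k<r. indicat_real \<Omega> (T k x)) = 1" if x: "x \<in> space m" for x
  proof -
    obtain k where k: "k < r" "T k x \<in> \<Omega>" "\<And>l. l < r \<Longrightarrow> T l x \<in> \<Omega> \<Longrightarrow> l = k"
      using \<Omega>_unique[OF x] by blast
    have "indicat_real \<Omega> (T l x) = (if l = k then 1 else 0)" if "l \<in> {..<r}" for l
      using k(2) k(3)[of l] that by (cases "l = k") (auto simp: indicator_def)
    then have "(\<Sum>k<r. indicat_real \<Omega> (T k x)) = (\<Sum>l<r. if l = k then 1 else 0)"
      by (intro sum.cong refl)
    then show ?thesis using k(1) by simp
  qed
  have "(LINT x|m. f x) = (LINT x|m. (\<Sum>k<r. indicat_real \<Omega> (T k x) *\<^sub>R f x))"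
    by (intro Bochner_Integration.integral_cong) (auto simp flip: scaleR_sum_left simp: one)
  also have "\<dots> = (\<Sum>k<r. LINT x|m. indicat_real \<Omega> (T k x) *\<^sub>R f x)"
    using int by (intro Bochner_Integration.integral_sum) auto
  also have "\<dots> = (\<Sum>k<r. LINT x|m. indicat_real \<Omega> x *\<^sub>R f (T (inv_index k) x))"
  proof (intro sum.cong refl)
    fix k assume "k \<in> {..<r}"
    then have k: "k < r" by simp
    note i = inv_index[OF k]
    have "(LINT x|m. indicat_real \<Omega> (T k x) *\<^sub>R f x) =
        (LINT x|m. indicat_real \<Omega> (T k (T (inv_index k) x)) *\<^sub>R f (T (inv_index k) x))"
      by (rule integral_T[OF i(1), symmetric]) (use int[OF k] in simp)
    also have "\<dots> = (LINT x|m. indicat_real \<Omega> x *\<^sub>R f (T (inv_index k) x))"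
      by (intro Bochner_Integration.integral_cong) (auto simp: i(3))
    finally show "(LINT x|m. indicat_real \<Omega> (T k x) *\<^sub>R f x) =
        (LINT x|m. indicat_real \<Omega> x *\<^sub>R f (T (inv_index k) x))" .
  qed
  also have "\<dots> = (\<Sum>k<r. LINT x|m. indicat_real \<Omega> x *\<^sub>R f (T k x))"
    by (rule sum.reindex_bij_betw[OF bij_inv_index, of "\<lambda>k. LINT x|m. indicat_real \<Omega> x *\<^sub>R f (T k x)"])
  also have "\<dots> = (LINT x|m. (\<Sum>k<r. indicat_real \<Omega> x *\<^sub>R f (T k x)))"
    using integrable_T[OF _ f] integrable_mult_indicator[OF \<Omega>_sets]
    by (intro Bochner_Integration.integral_sum[symmetric]) auto
  also have "\<dots> = (LINT \<xi>:\<Omega>|m. periodize f \<xi>)"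
    by (simp add: set_lebesgue_integral_def periodize_def scaleR_sum_right)
  finally show ?thesis .
qed

lemma integral_periodic:
  fixes f :: "'x \<Rightarrow> 'b::{banach, second_countable_topology}"
  assumes f: "integrable m f" and p: "periodic f"
  shows "(LINT x|m. f x) = real r *\<^sub>R (LINT \<xi>:\<Omega>|m. f \<xi>)"
proof -
  have "(LINT x|m. f x) = (LINT \<xi>:\<Omega>|m. periodize f \<xi>)" by (rule integral_fiber[OF f])
  also have "\<dots> = (LINT \<xi>:\<Omega>|m. real r *\<^sub>R f \<xi>)"
    unfolding set_lebesgue_integral_def
    by (intro Bochner_Integration.integral_cong) (auto simp: periodize_def periodicD[OF p] sum_constant_scaleR indicator_def)
  also have "\<dots> = real r *\<^sub>R (LINT \<xi>:\<Omega>|m. f \<xi>)" by simp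
  finally show ?thesis .
qed

lemma measure_\<Omega>: "measure m \<Omega> = 1 / real r"
  using integral_periodic[of "\<lambda>_. 1 :: real"] r_pos
  by (simp add: periodic_def set_lebesgue_integral_def prob_space field_simps)

lemma \<Omega>_not_null: "\<not> (AE x in m. x \<notin> \<Omega>)"
proof
  assume "AE x in m. x \<notin> \<Omega>"
  then have "measure m \<Omega> = 0" using \<Omega>_sets by (simp add: prob_eq_0)
  then show False using measure_\<Omega> r_pos by simp
qed

lemma L2_T: "k < r \<Longrightarrow> f \<in> L2 m \<Longrightarrow> (\<lambda>x. f (T k x)) \<in> L2 m"
  using integrable_T[of k "\<lambda>x. (cmod (f x))\<^sup>2"] measurable_T[of k f borel] by (auto simp: L2_def)

lemma L2_periodize: "f \<in> L2 m \<Longrightarrow> periodize f \<in> L2 m"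
  unfolding periodize_def[abs_def] by (intro L2_sum L2_T) auto

lemma l2_norm_fiber:
  assumes "f \<in> L2 m"
  shows "(l2_norm m f)\<^sup>2 = (LINT \<xi>:\<Omega>|m. norm_sq r (\<lambda>k. f (T k \<xi>)))"
  unfolding l2_norm_sq integral_fiber[OF L2_integrable[OF assms]] periodize_def norm_sq_def ..

lemma integral_periodize_mult:
  fixes g h :: "'x \<Rightarrow> complex"
  assumes gh: "integrable m (\<lambda>x. g x * h x)" and h: "periodic h"
  shows "(LINT x|m. periodize g x * h x) = of_nat r * (LINT x|m. g x * h x)"
proof -
  have "(LINT x|m. periodize g x * h x) = (LINT x|m. (\<Sum>k<r. g (T k x) * h (T k x)))"
    by (intro Bochner_Integration.integral_cong)
      (auto simp: periodize_def sum_distrib_right periodicD[OF h] intro!: sum.cong)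
  also have "\<dots> = (\<Sum>k<r. LINT x|m. g (T k x) * h (T k x))"
    using integrable_T[OF _ gh] by (intro Bochner_Integration.integral_sum) auto
  also have "\<dots> = (\<Sum>k<r. LINT x|m. g x * h x)"
    using integral_T[of _ "\<lambda>x. g x * h x"] gh by (intro sum.cong) auto
  finally show ?thesis by simp
qed

text \<open>The function with prescribed fibers: at \<open>T k \<xi>\<close> with \<open>\<xi> \<in> \<Omega>\<close> its value is \<open>p k \<xi>\<close>. In the
  sum, the inverse translation of index \<open>k\<close> detects whether \<open>x\<close> lies in the translate of \<open>\<Omega>\<close> by
  \<open>T k\<close>.\<close>

definition lift :: "(nat \<Rightarrow> 'x \<Rightarrow> complex) \<Rightarrow> 'x \<Rightarrow> complex" where
  "lift p x = (\<Sum>k<r. indicator \<Omega> (T (inv_index k) x) * p k (T (inv_index k) x))"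

lemma lift_T:
  assumes "\<xi> \<in> \<Omega>" "k < r"
  shows "lift p (T k \<xi>) = p k \<xi>"
proof -
  have "lift p (T k \<xi>) = (\<Sum>l<r. if l = k then p l \<xi> else 0)"
    unfolding lift_def using translate_in_\<Omega>_iff[OF assms] inv_index(2)[OF assms(2) \<Omega>_space[OF assms(1)]]
    by (intro sum.cong) (auto simp: indicator_def)
  then show ?thesis using assms(2) by simp
qed

lemma lift_L2:
  assumes "\<And>k. k < r \<Longrightarrow> (\<lambda>x. indicator \<Omega> x * p k x) \<in> L2 m"
  shows "lift p \<in> L2 m"
  unfolding lift_def[abs_def]
  using L2_T[OF inv_index(1) assms] by (intro L2_sum) auto

text \<open>A bound on the fibers that holds pointwise is a bound on norms. Operators that act fiber by
  fiber are shown to be bounded in this way.\<close>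

lemma lift_L2_bound:
  assumes p: "\<And>k. k < r \<Longrightarrow> p k \<in> borel_measurable m" and f: "f \<in> L2 m"
    and le: "AE \<xi> in m. \<xi> \<in> \<Omega> \<longrightarrow> norm_sq r (\<lambda>k. p k \<xi>) \<le> C * norm_sq r (\<lambda>k. f (T k \<xi>))" and C: "0 \<le> C"
  shows "lift p \<in> L2 m" "(l2_norm m (lift p))\<^sup>2 \<le> C * (l2_norm m f)\<^sup>2"
proof -
  have int: "integrable m (\<lambda>\<xi>. indicator \<Omega> \<xi> *\<^sub>R (C * norm_sq r (\<lambda>k. f (T k \<xi>))))"
    unfolding norm_sq_def using integrable_T[OF _ L2_integrable[OF f]]
    by (intro integrable_mult_indicator \<Omega>_sets integrable_mult_right Bochner_Integration.integrable_sum) auto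
  show L: "lift p \<in> L2 m"
  proof (rule lift_L2)
    fix k assume k: "k < r"
    have [measurable]: "p k \<in> borel_measurable m" using p[OF k] .
    have "integrable m (\<lambda>x. (cmod (indicator \<Omega> x * p k x))\<^sup>2)"
    proof (rule Bochner_Integration.integrable_bound[OF int])
      show "AE x in m. norm ((cmod (indicator \<Omega> x * p k x))\<^sup>2) \<le>
          norm (indicator \<Omega> x *\<^sub>R (C * norm_sq r (\<lambda>k. f (T k x))))"
        using le
      proof eventually_elim
        case (elim x)
        have "(cmod (p k x))\<^sup>2 \<le> norm_sq r (\<lambda>k. p k x)"
          unfolding norm_sq_def using k by (intro member_le_sum) auto
        with elim show ?case by (auto simp: indicator_def)
      qed
    qed measurable
    then show "(\<lambda>x. indicator \<Omega> x * p k x) \<in> L2 m" by (simp add: L2_def)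
  qed
  have "(l2_norm m (lift p))\<^sup>2 = (LINT \<xi>:\<Omega>|m. norm_sq r (\<lambda>k. lift p (T k \<xi>)))"
    by (rule l2_norm_fiber[OF L])
  also have "\<dots> \<le> (LINT \<xi>:\<Omega>|m. C * norm_sq r (\<lambda>k. f (T k \<xi>)))"
    unfolding set_lebesgue_integral_def
  proof (rule integral_mono_AE)
    show "integrable m (\<lambda>\<xi>. indicator \<Omega> \<xi> *\<^sub>R norm_sq r (\<lambda>k. lift p (T k \<xi>)))"
      unfolding norm_sq_def using integrable_T[OF _ L2_integrable[OF L]]
      by (intro integrable_mult_indicator \<Omega>_sets Bochner_Integration.integrable_sum) auto
    show "AE \<xi> in m. indicator \<Omega> \<xi> *\<^sub>R norm_sq r (\<lambda>k. lift p (T k \<xi>)) \<le>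
        indicator \<Omega> \<xi> *\<^sub>R (C * norm_sq r (\<lambda>k. f (T k \<xi>)))"
      using le by eventually_elim (auto simp: indicator_def lift_T norm_sq_def)
  qed (rule int)
  also have "\<dots> = C * (l2_norm m f)\<^sup>2"
    unfolding l2_norm_fiber[OF f] by simp
  finally show "(l2_norm m (lift p))\<^sup>2 \<le> C * (l2_norm m f)\<^sup>2" .
qed

lemma fiber_point:
  assumes "x \<in> space m"
  obtains \<xi> k where "\<xi> \<in> \<Omega>" "k < r" "x = T k \<xi>"
proof -
  obtain l where l: "l < r" "T l x \<in> \<Omega>" using \<Omega>_unique[OF assms] by blast
  then show thesis
    using inv_index(1,2)[OF l(1)] assms by (intro that[of "T l x" "inv_index l"]) auto
qed

lemma periodize_T_supported:
  assumes "\<And>x. x \<in> space m \<Longrightarrow> x \<notin> \<Omega> \<Longrightarrow> h x = 0" "\<xi> \<in> \<Omega>" "k < r"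
  shows "periodize h (T k \<xi>) = h \<xi>"
proof -
  note \<xi> = \<Omega>_space[OF assms(2)]
  have "periodize h (T k \<xi>) = periodize h \<xi>"
    by (rule periodicD[OF periodic_periodize assms(3) \<xi>])
  also have "\<dots> = (\<Sum>l<r. if l = 0 then h \<xi> else 0)"
    unfolding periodize_def using assms(1) T_space[OF _ \<xi>] T_in_\<Omega>_iff[OF assms(2)] T_0[OF \<xi>]
    by (intro sum.cong) auto
  finally show ?thesis using r_pos by simp
qed

lemma lift_linear: "lift (\<lambda>k \<xi>. c * p k \<xi> + d * q k \<xi>) x = c * lift p x + d * lift q x"
  unfolding lift_def sum_distrib_left sum.distrib[symmetric] by (intro sum.cong) (auto simp: algebra_simps)

end

section \<open>Frame bounds on the fibers\<close>

text \<open>The functions \<open>\<psi> i\<close> stand for the characters that come from \<open>M\<close>. Density is required for all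
  integrable weights because of the weight given by the squared modulus of \<open>G j\<close>: approximating
  \<open>p\<close> with this weight means approximating \<open>cnj (G j) * p\<close> by combinations of the system, although
  \<open>G j\<close> may be unbounded.\<close>

locale fiberization = tiling m T r \<Omega>
  for m :: "'x measure" and T r \<Omega> +
  fixes \<psi> :: "'i \<Rightarrow> 'x \<Rightarrow> complex" and M :: "'i set"
    and s :: nat and G :: "nat \<Rightarrow> 'x \<Rightarrow> complex"
  assumes \<psi>_measurable: "i \<in> M \<Longrightarrow> \<psi> i \<in> borel_measurable m"
    and \<psi>_norm: "i \<in> M \<Longrightarrow> x \<in> space m \<Longrightarrow> cmod (\<psi> i x) = 1"
    and \<psi>_periodic: "i \<in> M \<Longrightarrow> periodic (\<psi> i)"
    and \<psi>_orthogonal: "i \<in> M \<Longrightarrow> i' \<in> M \<Longrightarrow> i \<noteq> i' \<Longrightarrow> l2_inner m (\<psi> i) (\<psi> i') = 0"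
    and \<psi>_dense: "p \<in> borel_measurable m \<Longrightarrow> (\<And>x. x \<in> space m \<Longrightarrow> cmod (p x) \<le> B) \<Longrightarrow> periodic p \<Longrightarrow>
      integrable m w \<Longrightarrow> (\<And>x. x \<in> space m \<Longrightarrow> 0 \<le> w x) \<Longrightarrow> \<epsilon> > 0 \<Longrightarrow>
      \<exists>F c. finite F \<and> F \<subseteq> M \<and> (LINT x|m. w x * (cmod (p x - (\<Sum>i\<in>F. c i * \<psi> i x)))\<^sup>2) < \<epsilon>"
    and G_L2: "j \<in> {1..s} \<Longrightarrow> G j \<in> L2 m"
begin

definition sys :: "'i \<times> nat \<Rightarrow> 'x \<Rightarrow> complex" where
  "sys = (\<lambda>(i, j) x. cnj (G j x) * \<psi> i x)"

definition fib :: "'x \<Rightarrow> nat \<Rightarrow> nat \<Rightarrow> complex" where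
  "fib x j k = G (Suc j) (T k x)"

abbreviation fiber :: "('x \<Rightarrow> complex) \<Rightarrow> 'x \<Rightarrow> nat \<Rightarrow> complex" where
  "fiber f x \<equiv> \<lambda>k. f (T k x)"

text \<open>The operator inequality \<open>a\<^sup>* a \<le> C\<close> at almost every point of \<open>\<Omega>\<close>, where \<open>a\<close> is the matrix
  \<open>fib \<xi>\<close>; the predicate after it is the inequality \<open>C \<le> a\<^sup>* a\<close>.\<close>

definition upper :: "real \<Rightarrow> bool" where
  "upper C \<longleftrightarrow> (AE \<xi> in m. \<xi> \<in> \<Omega> \<longrightarrow> (\<forall>v. norm_sq s (mat_app r (fib \<xi>) v) \<le> C * norm_sq r v))"

definition lower :: "real \<Rightarrow> bool" where
  "lower C \<longleftrightarrow> (AE \<xi> in m. \<xi> \<in> \<Omega> \<longrightarrow> (\<forall>v. C * norm_sq r v \<le> norm_sq s (mat_app r (fib \<xi>) v)))"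

lemma \<psi>_bounded_mult_L2: "f \<in> L2 m \<Longrightarrow> i \<in> M \<Longrightarrow> (\<lambda>x. f x * \<psi> i x) \<in> L2 m"
  by (rule L2_dominated[of f m _ 1])
    (simp_all add: norm_mult \<psi>_norm borel_measurable_times L2_measurable \<psi>_measurable)

lemma \<psi>_L2: "i \<in> M \<Longrightarrow> \<psi> i \<in> L2 m"
  using \<psi>_bounded_mult_L2[of "\<lambda>_. 1" i] by (simp add: L2_def)

lemma \<psi>_orthonormal: "orthonormal m \<psi> M"
proof -
  have "l2_inner m (\<psi> i) (\<psi> i) = 1" if "i \<in> M" for i
  proof -
    have "(l2_norm m (\<psi> i))\<^sup>2 = (LINT x|m. 1)"
      unfolding l2_norm_sq using \<psi>_norm[OF that] by (intro Bochner_Integration.integral_cong) auto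
    then show ?thesis by (simp add: l2_inner_self prob_space)
  qed
  then show ?thesis using \<psi>_orthogonal \<psi>_L2 by (auto simp: orthonormal_def)
qed

lemma sys_L2: "i \<in> M \<times> {1..s} \<Longrightarrow> sys i \<in> L2 m"
  using \<psi>_bounded_mult_L2[OF L2_cnj[OF G_L2]] by (auto simp: sys_def)

lemma fib_measurable:
  assumes "j < s" "k < r"
  shows "(\<lambda>x. fib x j k) \<in> borel_measurable m"
  unfolding fib_def using assms G_L2[of "Suc j"] measurable_T[OF assms(2), of "G (Suc j)" borel]
  by (auto dest: L2_measurable)

lemma mat_app_fib_measurable:
  assumes "j < s" "\<And>k. k < r \<Longrightarrow> (\<lambda>x. v x k) \<in> borel_measurable m"
  shows "(\<lambda>x. mat_app r (fib x) (v x) j) \<in> borel_measurable m"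
  unfolding mat_app_def using fib_measurable[OF assms(1)] assms(2)
  by (intro borel_measurable_sum borel_measurable_times) auto

lemma norm_sq_fib_measurable:
  assumes "\<And>k. k < r \<Longrightarrow> (\<lambda>x. v x k) \<in> borel_measurable m"
  shows "(\<lambda>x. norm_sq s (mat_app r (fib x) (v x))) \<in> borel_measurable m"
  unfolding norm_sq_def using mat_app_fib_measurable[OF _ assms]
  by (intro borel_measurable_sum borel_measurable_power borel_measurable_norm) auto

text \<open>Truncated functions are bounded and still periodic, so that density applies to them with
  weight \<open>1\<close>.\<close>

lemma periodic_in_closed_span:
  assumes p: "p \<in> L2 m" "periodic p"
  shows "p \<in> closed_span m \<psi> M"
proof (rule closed_span_closed[OF \<psi>_L2 p(1)])
  fix \<epsilon> :: real assume "\<epsilon> > 0"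
  note [measurable] = L2_measurable[OF p(1)]
  define q where "q n x = (if cmod (p x) \<le> real n then p x else 0)" for n x
  have q_meas [measurable]: "q n \<in> borel_measurable m" for n unfolding q_def by measurable
  have q_L2: "q n \<in> L2 m" for n
    by (rule L2_dominated[OF p(1), of _ 1]) (auto simp: q_def)
  have q_span: "q n \<in> closed_span m \<psi> M" for n
  proof (rule closed_spanI[OF q_L2])
    fix \<delta> :: real assume "\<delta> > 0"
    have per: "periodic (q n)" using p(2) by (auto simp: q_def periodic_def)
    have "\<exists>F c. finite F \<and> F \<subseteq> M \<and> (LINT x|m. 1 * (cmod (q n x - (\<Sum>i\<in>F. c i * \<psi> i x)))\<^sup>2) < \<delta>\<^sup>2"
      using \<open>\<delta> > 0\<close> by (intro \<psi>_dense[OF q_meas _ per, where B = "real n"]) (auto simp: q_def)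
    then obtain F c where F: "finite F" "F \<subseteq> M" "(LINT x|m. 1 * (cmod (q n x - (\<Sum>i\<in>F. c i * \<psi> i x)))\<^sup>2) < \<delta>\<^sup>2"
      by blast
    then have "(l2_norm m (\<lambda>x. q n x - (\<Sum>i\<in>F. c i * \<psi> i x)))\<^sup>2 < \<delta>\<^sup>2"
      by (simp add: l2_norm_sq)
    then have "l2_norm m (\<lambda>x. q n x - (\<Sum>i\<in>F. c i * \<psi> i x)) < \<delta>"
      using \<open>\<delta> > 0\<close> by (auto intro: power2_less_imp_less)
    then show "\<exists>F c. finite F \<and> F \<subseteq> M \<and> l2_norm m (\<lambda>x. q n x - (\<Sum>i\<in>F. c i * \<psi> i x)) < \<delta>"
      using F(1,2) by blast
  qed
  have "(\<lambda>n. LINT x|m. (cmod (p x - q n x))\<^sup>2) \<longlonglongrightarrow> (LINT x|m. 0)"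
  proof (rule integral_dominated_convergence[where w = "\<lambda>x. (cmod (p x))\<^sup>2"])
    show "AE x in m. (\<lambda>n. (cmod (p x - q n x))\<^sup>2) \<longlonglongrightarrow> 0"
    proof (intro AE_I2)
      fix x
      obtain N where "cmod (p x) \<le> real N" using real_arch_simple by blast
      then have "\<forall>n\<ge>N. (cmod (p x - q n x))\<^sup>2 = 0" by (auto simp: q_def)
      then show "(\<lambda>n. (cmod (p x - q n x))\<^sup>2) \<longlonglongrightarrow> 0"
        by (intro tendsto_eventually) (auto simp: eventually_sequentially)
    qed
    show "AE x in m. norm ((cmod (p x - q n x))\<^sup>2) \<le> (cmod (p x))\<^sup>2" for n
      by (auto simp: q_def)
  qed (use L2_integrable[OF p(1)] in auto)
  then have "(\<lambda>n. (l2_norm m (\<lambda>x. p x - q n x))\<^sup>2) \<longlonglongrightarrow> 0" by (simp add: l2_norm_sq)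
  then have "\<forall>\<^sub>F n in sequentially. (l2_norm m (\<lambda>x. p x - q n x))\<^sup>2 < \<epsilon>\<^sup>2"
    using \<open>\<epsilon> > 0\<close> by (intro order_tendstoD(2)[of _ 0]) auto
  then obtain n where "(l2_norm m (\<lambda>x. p x - q n x))\<^sup>2 < \<epsilon>\<^sup>2"
    by (auto simp: eventually_sequentially)
  then have "l2_norm m (\<lambda>x. p x - q n x) < \<epsilon>"
    using \<open>\<epsilon> > 0\<close> by (auto intro: power2_less_imp_less)
  then show "\<exists>g\<in>closed_span m \<psi> M. l2_norm m (\<lambda>x. p x - g x) < \<epsilon>" using q_span by blast
qed

text \<open>Since \<open>\<psi> i\<close> is periodic, its coefficient in \<open>g\<close> is \<open>1 / r\<close> times that in the periodization,
  while the integral of a periodic function is \<open>r\<close> times its integral over \<open>\<Omega>\<close>. Squaring the first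
  factor leaves \<open>1 / r\<close> in Parseval's identity.\<close>

lemma fiber_Parseval:
  assumes g: "integrable m g" and S: "periodize g \<in> L2 m"
  shows "((\<lambda>i. (cmod (LINT x|m. g x * cnj (\<psi> i x)))\<^sup>2) has_sum
    (1 / real r * (LINT \<xi>:\<Omega>|m. (cmod (periodize g \<xi>))\<^sup>2))) M"
proof -
  have coeff: "(LINT x|m. g x * cnj (\<psi> i x)) = l2_inner m (periodize g) (\<psi> i) / of_nat r" if i: "i \<in> M" for i
  proof -
    have [measurable]: "\<psi> i \<in> borel_measurable m" "g \<in> borel_measurable m"
      using \<psi>_measurable[OF i] g by auto
    have "integrable m (\<lambda>x. g x * cnj (\<psi> i x))"
      by (rule Bochner_Integration.integrable_bound[OF g]) (auto simp: norm_mult \<psi>_norm[OF i])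
    moreover have "periodic (\<lambda>x. cnj (\<psi> i x))"
      using \<psi>_periodic[OF i] by (auto simp: periodic_def)
    ultimately have "(LINT x|m. periodize g x * cnj (\<psi> i x)) = of_nat r * (LINT x|m. g x * cnj (\<psi> i x))"
      by (rule integral_periodize_mult)
    then show ?thesis using r_pos by (simp add: l2_inner_def)
  qed
  have per: "periodic (\<lambda>x. (cmod (periodize g x))\<^sup>2)"
    using periodic_periodize[of g] by (auto simp: periodic_def)
  have "((\<lambda>i. (cmod (l2_inner m (periodize g) (\<psi> i)))\<^sup>2) has_sum (l2_norm m (periodize g))\<^sup>2) M"
    by (rule Parseval[OF \<psi>_orthonormal periodic_in_closed_span[OF S periodic_periodize]])
  then have "((\<lambda>i. 1 / (real r)\<^sup>2 * (cmod (l2_inner m (periodize g) (\<psi> i)))\<^sup>2) has_sum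
      (1 / (real r)\<^sup>2 * (l2_norm m (periodize g))\<^sup>2)) M"
    by (rule has_sum_cmult_right)
  moreover have "1 / (real r)\<^sup>2 * (l2_norm m (periodize g))\<^sup>2 = 1 / real r * (LINT \<xi>:\<Omega>|m. (cmod (periodize g \<xi>))\<^sup>2)"
    unfolding l2_norm_sq integral_periodic[OF L2_integrable[OF S] per] using r_pos
    by (simp add: power2_eq_square)
  ultimately show ?thesis
    by (subst has_sum_cong[OF arg_cong[OF coeff]]) (simp_all add: norm_divide power_divide)
qed

lemma periodize_G:
  "periodize (\<lambda>x. f x * G (Suc j) x) x = mat_app r (fib x) (fiber f x) j"
  by (simp add: periodize_def mat_app_def fib_def mult.commute)

text \<open>The identity behind all bounds: the coordinates of \<open>mat_app r (fib \<xi>) (fiber f \<xi>)\<close> are the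
  periodizations of the products \<open>f * G j\<close>, to which Parseval's identity applies for each \<open>j\<close>
  separately.\<close>

lemma frame_sum:
  assumes f: "f \<in> L2 m" and S: "\<And>j. j < s \<Longrightarrow> periodize (\<lambda>x. f x * G (Suc j) x) \<in> L2 m"
  shows "(\<Sum>\<^sub>\<infinity>i\<in>M \<times> {1..s}. ennreal ((cmod (l2_inner m f (sys i)))\<^sup>2)) =
    ennreal (1 / real r * (LINT \<xi>:\<Omega>|m. norm_sq s (mat_app r (fib \<xi>) (fiber f \<xi>))))"
proof (rule infsum_ennreal_eq)
  have 1: "((\<lambda>i. (cmod (l2_inner m f (sys (i, j))))\<^sup>2) has_sum
      (1 / real r * (LINT \<xi>:\<Omega>|m. (cmod (mat_app r (fib \<xi>) (fiber f \<xi>) (j - 1)))\<^sup>2))) M"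
    if j: "j \<in> {1..s}" for j
  proof -
    have [simp]: "Suc (j - Suc 0) = j" using j by simp
    have "((\<lambda>i. (cmod (LINT x|m. (f x * G j x) * cnj (\<psi> i x)))\<^sup>2) has_sum
      (1 / real r * (LINT \<xi>:\<Omega>|m. (cmod (periodize (\<lambda>x. f x * G j x) \<xi>))\<^sup>2))) M"
      using j S[of "j - 1"] by (intro fiber_Parseval L2_mult_integrable f G_L2) auto
    then show ?thesis
      using periodize_G[of f "j - 1"] by (simp add: l2_inner_def sys_def mult.assoc)
  qed
  have int: "integrable m (\<lambda>\<xi>. indicator \<Omega> \<xi> *\<^sub>R (cmod (mat_app r (fib \<xi>) (fiber f \<xi>) j))\<^sup>2)" if "j < s" for j
    using L2_integrable[OF S[OF that]] unfolding periodize_G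
    by (intro integrable_mult_indicator \<Omega>_sets)
  have "(\<Sum>j\<in>{1..s}. 1 / real r * (LINT \<xi>:\<Omega>|m. (cmod (mat_app r (fib \<xi>) (fiber f \<xi>) (j - 1)))\<^sup>2)) =
      (\<Sum>j<s. 1 / real r * (LINT \<xi>:\<Omega>|m. (cmod (mat_app r (fib \<xi>) (fiber f \<xi>) j))\<^sup>2))"
    by (intro sum.reindex_bij_witness[of _ Suc "\<lambda>j. j - 1"]) auto
  also have "\<dots> = 1 / real r * (LINT \<xi>:\<Omega>|m. norm_sq s (mat_app r (fib \<xi>) (fiber f \<xi>)))"
    unfolding set_lebesgue_integral_def norm_sq_def scaleR_sum_right sum_distrib_left[symmetric]
    using int by (subst Bochner_Integration.integral_sum) auto
  finally have total: "(\<Sum>j\<in>{1..s}. 1 / real r * (LINT \<xi>:\<Omega>|m. (cmod (mat_app r (fib \<xi>) (fiber f \<xi>) (j - 1)))\<^sup>2)) =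
      1 / real r * (LINT \<xi>:\<Omega>|m. norm_sq s (mat_app r (fib \<xi>) (fiber f \<xi>)))" .
  have "((\<lambda>(i, j). (cmod (l2_inner m f (sys (i, j))))\<^sup>2) has_sum
      (1 / real r * (LINT \<xi>:\<Omega>|m. norm_sq s (mat_app r (fib \<xi>) (fiber f \<xi>))))) (M \<times> {1..s})"
    unfolding total[symmetric] by (rule has_sum_product_finite[OF finite_atLeastAtMost 1])
  then show "((\<lambda>i. (cmod (l2_inner m f (sys i)))\<^sup>2) has_sum
      (1 / real r * (LINT \<xi>:\<Omega>|m. norm_sq s (mat_app r (fib \<xi>) (fiber f \<xi>))))) (M \<times> {1..s})"
    unfolding case_prod_unfold prod.collapse .
qed simp

text \<open>The squared modulus of the periodization is dominated by \<open>C\<close> times the periodization of the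
  squared modulus of \<open>f\<close>, on \<open>\<Omega>\<close> by hypothesis and then everywhere, as both sides are periodic.\<close>

lemma periodize_G_L2:
  assumes f: "f \<in> L2 m" and "j < s"
    and le: "AE \<xi> in m. \<xi> \<in> \<Omega> \<longrightarrow> norm_sq s (mat_app r (fib \<xi>) (fiber f \<xi>)) \<le> C * norm_sq r (fiber f \<xi>)"
  shows "periodize (\<lambda>x. f x * G (Suc j) x) \<in> L2 m"
proof -
  define g where "g = periodize (\<lambda>x. f x * G (Suc j) x)"
  define n where "n x = norm_sq r (fiber f x)" for x
  have n: "n = periodize (\<lambda>x. (cmod (f x))\<^sup>2)" by (simp add: n_def norm_sq_def periodize_def fun_eq_iff)
  have G: "G (Suc j) \<in> L2 m" using \<open>j < s\<close> by (intro G_L2) auto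
  have g_meas: "g \<in> borel_measurable m" unfolding g_def
    using f G by (intro measurable_periodize borel_measurable_times L2_measurable)
  have g_per: "periodic g" unfolding g_def by (rule periodic_periodize)
  have n_per: "periodic n" unfolding n by (rule periodic_periodize)
  have "AE x in m. (cmod (g x))\<^sup>2 \<le> C * n x"
  proof (rule AE_fiberI)
    show "AE \<xi> in m. \<xi> \<in> \<Omega> \<longrightarrow> (\<forall>k<r. (cmod (g (T k \<xi>)))\<^sup>2 \<le> C * n (T k \<xi>))"
      using le
    proof (rule AE_mp, intro AE_I2 impI allI)
      fix \<xi> k assume \<xi>: "\<xi> \<in> space m" "\<xi> \<in> \<Omega>" and k: "k < r"
        and *: "\<xi> \<in> \<Omega> \<longrightarrow> norm_sq s (mat_app r (fib \<xi>) (fiber f \<xi>)) \<le> C * norm_sq r (fiber f \<xi>)"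
      have "(cmod (g \<xi>))\<^sup>2 \<le> norm_sq s (mat_app r (fib \<xi>) (fiber f \<xi>))"
        unfolding g_def periodize_G norm_sq_def using \<open>j < s\<close>
        by (intro member_le_sum[of j "{..<s}" "\<lambda>j. (cmod (mat_app r (fib \<xi>) (fiber f \<xi>) j))\<^sup>2"]) auto
      also have "\<dots> \<le> C * n \<xi>" using * \<xi> by (simp add: n_def)
      finally show "(cmod (g (T k \<xi>)))\<^sup>2 \<le> C * n (T k \<xi>)"
        using periodicD[OF g_per k \<xi>(1)] periodicD[OF n_per k \<xi>(1)] by simp
    qed
  qed
  moreover have "integrable m (\<lambda>x. C * n x)"
    unfolding n by (intro integrable_mult_right integrable_periodize L2_integrable f)
  ultimately have "integrable m (\<lambda>x. (cmod (g x))\<^sup>2)"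
    using g_meas
    by (elim Bochner_Integration.integrable_bound) (auto elim!: eventually_mono simp: abs_le_iff)
  with g_meas show ?thesis by (simp add: L2_def g_def)
qed

text \<open>The test set is the part of \<open>\<Omega>\<close> where \<open>h\<close> is positive and \<open>b \<le> N\<close>; an integral that is not
  positive forces it to be null. The bound on \<open>b\<close> keeps the test integrals finite, and the
  sublevel sets of \<open>b\<close> exhaust \<open>\<Omega>\<close>.\<close>

lemma AE_nonpos_from_tests:
  fixes h b :: "'x \<Rightarrow> real"
  assumes [measurable]: "h \<in> borel_measurable m" "b \<in> borel_measurable m"
    and test: "\<And>N E. E \<in> sets m \<Longrightarrow> E \<subseteq> \<Omega> \<Longrightarrow> \<forall>x\<in>E. b x \<le> real N \<Longrightarrow>
      integrable m (\<lambda>x. indicator E x * h x) \<and> (LINT x|m. indicator E x * h x) \<le> 0"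
  shows "AE \<xi> in m. \<xi> \<in> \<Omega> \<longrightarrow> h \<xi> \<le> 0"
proof -
  define E where "E N = {x \<in> \<Omega>. b x \<le> real N \<and> 0 < h x}" for N :: nat
  have E_sets: "E N \<in> sets m" for N
  proof -
    have "E N = \<Omega> \<inter> {x \<in> space m. b x \<le> real N \<and> 0 < h x}"
      unfolding E_def using \<Omega>_space by auto
    then show ?thesis by simp
  qed
  have "AE x in m. x \<notin> E N" for N
  proof -
    have *: "integrable m (\<lambda>x. indicator (E N) x * h x)" "(LINT x|m. indicator (E N) x * h x) \<le> 0"
    proof -
      have "E N \<subseteq> \<Omega>" "\<forall>x\<in>E N. b x \<le> real N" by (auto simp: E_def)
      from test[OF E_sets this] show "integrable m (\<lambda>x. indicator (E N) x * h x)"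
        "(LINT x|m. indicator (E N) x * h x) \<le> 0" by blast+
    qed
    have nn: "0 \<le> indicator (E N) x * h x" for x by (auto simp: E_def indicator_def)
    then have "0 \<le> (LINT x|m. indicator (E N) x * h x)" by (intro integral_nonneg_AE) simp
    with *(2) have "(LINT x|m. indicator (E N) x * h x) = 0" by simp
    then have "AE x in m. indicator (E N) x * h x = 0"
      using integral_nonneg_eq_0_iff_AE[OF *(1)] nn by simp
    then show ?thesis by eventually_elim (auto simp: E_def indicator_def)
  qed
  then have "AE x in m. \<forall>N. x \<notin> E N" by (simp add: AE_all_countable)
  then show ?thesis
  proof eventually_elim
    case (elim x)
    obtain N :: nat where "b x \<le> real N" using real_arch_simple by blast
    with elim[rule_format, of N] show ?case by (auto simp: E_def)
  qed
qed

definition entries_sq :: "'x \<Rightarrow> real" where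
  "entries_sq x = (\<Sum>j<s. \<Sum>k<r. (cmod (fib x j k))\<^sup>2)"

lemma entries_sq_measurable [measurable]: "entries_sq \<in> borel_measurable m"
  unfolding entries_sq_def[abs_def]
  using fib_measurable by (intro borel_measurable_sum borel_measurable_power borel_measurable_norm) auto

lemma mat_app_fib_le: "norm_sq s (mat_app r (fib x) v) \<le> entries_sq x * norm_sq r v"
  unfolding entries_sq_def by (rule norm_sq_mat_app_le)

lemma norm_sq_const_measurable: "(\<lambda>x. norm_sq s (mat_app r (fib x) v)) \<in> borel_measurable m"
  by (rule norm_sq_fib_measurable) simp

text \<open>The function whose fiber is the constant vector \<open>v\<close> over \<open>E\<close> and zero elsewhere. The entries
  of the matrices are bounded on \<open>E\<close>, so that \<open>frame_sum\<close> holds for it even if the system is not a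
  Bessel sequence.\<close>

lemma test_function:
  fixes v :: "nat \<Rightarrow> complex"
  assumes E: "E \<in> sets m" "E \<subseteq> \<Omega>" and N: "\<forall>x\<in>E. entries_sq x \<le> real N"
  defines "f \<equiv> lift (\<lambda>k \<xi>. indicator E \<xi> * v k)"
  shows "f \<in> L2 m"
    and "(l2_norm m f)\<^sup>2 = (LINT \<xi>|m. indicator E \<xi> * norm_sq r v)"
    and "(\<Sum>\<^sub>\<infinity>i\<in>M \<times> {1..s}. ennreal ((cmod (l2_inner m f (sys i)))\<^sup>2)) =
      ennreal (1 / real r * (LINT \<xi>|m. indicator E \<xi> * norm_sq s (mat_app r (fib \<xi>) v)))"
    and "integrable m (\<lambda>\<xi>. indicator E \<xi> * norm_sq s (mat_app r (fib \<xi>) v))"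
proof -
  note [measurable] = E(1) norm_sq_const_measurable
  have fib_f: "fiber f \<xi> k = indicator E \<xi> * v k" if "\<xi> \<in> \<Omega>" "k < r" for \<xi> k
    unfolding f_def using that by (rule lift_T)
  have app: "norm_sq s (mat_app r (fib \<xi>) (fiber f \<xi>)) = indicator E \<xi> * norm_sq s (mat_app r (fib \<xi>) v)"
    "norm_sq r (fiber f \<xi>) = indicator E \<xi> * norm_sq r v" if "\<xi> \<in> \<Omega>" for \<xi>
    unfolding norm_sq_def mat_app_def using fib_f[OF that] by (auto simp: indicator_def)
  show f: "f \<in> L2 m" unfolding f_def
  proof (rule lift_L2)
    fix k
    show "(\<lambda>x. indicator \<Omega> x * (indicator E x * v k)) \<in> L2 m"
      by (rule L2_dominated[of "\<lambda>_. v k" m _ 1]) (auto simp: L2_def indicator_def)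
  qed
  show "(l2_norm m f)\<^sup>2 = (LINT \<xi>|m. indicator E \<xi> * norm_sq r v)"
    unfolding l2_norm_fiber[OF f] set_lebesgue_integral_def
    using E(2) app(2) by (intro Bochner_Integration.integral_cong) (auto simp: indicator_def)
  have "norm_sq s (mat_app r (fib \<xi>) (fiber f \<xi>)) \<le> real N * norm_sq r (fiber f \<xi>)" if "\<xi> \<in> \<Omega>" for \<xi>
    unfolding app[OF that] using mat_app_fib_le[of \<xi> v] mult_right_mono[OF bspec[OF N, of \<xi>], of "norm_sq r v"]
    by (auto simp: indicator_def norm_sq_nonneg)
  then have "periodize (\<lambda>x. f x * G (Suc j) x) \<in> L2 m" if "j < s" for j
    using f that by (intro periodize_G_L2[where C = "real N"]) auto
  then have "(\<Sum>\<^sub>\<infinity>i\<in>M \<times> {1..s}. ennreal ((cmod (l2_inner m f (sys i)))\<^sup>2)) =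
      ennreal (1 / real r * (LINT \<xi>:\<Omega>|m. norm_sq s (mat_app r (fib \<xi>) (fiber f \<xi>))))"
    by (rule frame_sum[OF f])
  also have "(LINT \<xi>:\<Omega>|m. norm_sq s (mat_app r (fib \<xi>) (fiber f \<xi>))) =
      (LINT \<xi>|m. indicator E \<xi> * norm_sq s (mat_app r (fib \<xi>) v))"
    unfolding set_lebesgue_integral_def
    using E(2) app(1) by (intro Bochner_Integration.integral_cong) (auto simp: indicator_def)
  finally show "(\<Sum>\<^sub>\<infinity>i\<in>M \<times> {1..s}. ennreal ((cmod (l2_inner m f (sys i)))\<^sup>2)) =
      ennreal (1 / real r * (LINT \<xi>|m. indicator E \<xi> * norm_sq s (mat_app r (fib \<xi>) v)))" .
  show "integrable m (\<lambda>\<xi>. indicator E \<xi> * norm_sq s (mat_app r (fib \<xi>) v))"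
  proof (rule integrable_const_bound[where B = "real N * norm_sq r v"])
    show "AE \<xi> in m. norm (indicator E \<xi> * norm_sq s (mat_app r (fib \<xi>) v)) \<le> real N * norm_sq r v"
      using mat_app_fib_le[of _ v] mult_right_mono[OF bspec[OF N], of _ "norm_sq r v"]
      by (intro AE_I2) (auto simp: indicator_def norm_sq_nonneg intro: order_trans)
  qed measurable
qed

lemma fiber_norms_integrable:
  assumes "f \<in> L2 m" and S: "\<And>j. j < s \<Longrightarrow> periodize (\<lambda>x. f x * G (Suc j) x) \<in> L2 m"
  shows "integrable m (\<lambda>\<xi>. indicator \<Omega> \<xi> *\<^sub>R norm_sq s (mat_app r (fib \<xi>) (fiber f \<xi>)))"
    and "integrable m (\<lambda>\<xi>. indicator \<Omega> \<xi> *\<^sub>R norm_sq r (fiber f \<xi>))"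
proof -
  show "integrable m (\<lambda>\<xi>. indicator \<Omega> \<xi> *\<^sub>R norm_sq s (mat_app r (fib \<xi>) (fiber f \<xi>)))"
    unfolding norm_sq_def using L2_integrable[OF S] unfolding periodize_G
    by (intro integrable_mult_indicator \<Omega>_sets Bochner_Integration.integrable_sum) auto
  show "integrable m (\<lambda>\<xi>. indicator \<Omega> \<xi> *\<^sub>R norm_sq r (fiber f \<xi>))"
    unfolding norm_sq_def using integrable_T[OF _ L2_integrable[OF assms(1)]]
    by (intro integrable_mult_indicator \<Omega>_sets Bochner_Integration.integrable_sum) auto
qed

lemma upper_periodize_L2:
  assumes "upper C" "f \<in> L2 m" "j < s"
  shows "periodize (\<lambda>x. f x * G (Suc j) x) \<in> L2 m"
  using assms(2,3)
proof (rule periodize_G_L2[where C = C])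
  show "AE \<xi> in m. \<xi> \<in> \<Omega> \<longrightarrow> norm_sq s (mat_app r (fib \<xi>) (fiber f \<xi>)) \<le> C * norm_sq r (fiber f \<xi>)"
    using assms(1) unfolding upper_def by eventually_elim blast
qed

lemma frame_sum_upper:
  assumes U: "upper C" and f: "f \<in> L2 m"
  shows "(\<Sum>\<^sub>\<infinity>i\<in>M \<times> {1..s}. ennreal ((cmod (l2_inner m f (sys i)))\<^sup>2)) =
    ennreal (1 / real r * (LINT \<xi>:\<Omega>|m. norm_sq s (mat_app r (fib \<xi>) (fiber f \<xi>))))"
  by (rule frame_sum[OF f]) (rule upper_periodize_L2[OF U f])

lemma test_integrable: "E \<in> sets m \<Longrightarrow> integrable m (\<lambda>\<xi>. indicator E \<xi> * (c::real))"
  by (intro integrable_mult_left integrable_real_indicator) (simp_all add: emeasure_eq_measure)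

lemma upperI_tests:
  assumes test: "\<And>E v N. E \<in> sets m \<Longrightarrow> E \<subseteq> \<Omega> \<Longrightarrow> \<forall>x\<in>E. entries_sq x \<le> real N \<Longrightarrow>
      (LINT \<xi>|m. indicator E \<xi> * norm_sq s (mat_app r (fib \<xi>) v)) \<le> (LINT \<xi>|m. indicator E \<xi> * (C * norm_sq r v))"
  shows "upper C"
proof -
  obtain D :: "(nat \<Rightarrow> complex) set" where D: "countable D"
    "\<And>s a x w. \<forall>v\<in>D. norm_sq s (mat_app r a v) \<le> x * norm_sq r v \<Longrightarrow>
       norm_sq s (mat_app r a w) \<le> x * norm_sq r w"
    by (rule countable_dense_test_vectors[where n = r]) blast
  have ptw: "AE \<xi> in m. \<xi> \<in> \<Omega> \<longrightarrow> norm_sq s (mat_app r (fib \<xi>) v) - C * norm_sq r v \<le> 0" for v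
  proof (rule AE_nonpos_from_tests[where b = entries_sq])
    fix N E assume E: "E \<in> sets m" "E \<subseteq> \<Omega>" "\<forall>x\<in>E. entries_sq x \<le> real N"
    note I = test_function(4)[OF E, of v] test_integrable[OF E(1), of "C * norm_sq r v"]
    show "integrable m (\<lambda>x. indicator E x * (norm_sq s (mat_app r (fib x) v) - C * norm_sq r v)) \<and>
        (LINT x|m. indicator E x * (norm_sq s (mat_app r (fib x) v) - C * norm_sq r v)) \<le> 0"
      unfolding right_diff_distrib using I test[OF E, of v]
      by (simp add: Bochner_Integration.integral_diff)
  qed (use norm_sq_const_measurable in measurable)
  have "AE \<xi> in m. \<forall>v\<in>D. \<xi> \<in> \<Omega> \<longrightarrow> norm_sq s (mat_app r (fib \<xi>) v) - C * norm_sq r v \<le> 0"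
    unfolding AE_ball_countable[OF D(1)] using ptw by blast
  then show ?thesis
    unfolding upper_def by eventually_elim (use D(2) in auto)
qed

lemma lowerI_tests:
  assumes test: "\<And>E v N. E \<in> sets m \<Longrightarrow> E \<subseteq> \<Omega> \<Longrightarrow> \<forall>x\<in>E. entries_sq x \<le> real N \<Longrightarrow>
      (LINT \<xi>|m. indicator E \<xi> * (C * norm_sq r v)) \<le> (LINT \<xi>|m. indicator E \<xi> * norm_sq s (mat_app r (fib \<xi>) v))"
  shows "lower C"
proof -
  obtain D :: "(nat \<Rightarrow> complex) set" where D: "countable D"
    "\<And>s a x w. \<forall>v\<in>D. x * norm_sq r v \<le> norm_sq s (mat_app r a v) \<Longrightarrow>
       x * norm_sq r w \<le> norm_sq s (mat_app r a w)"
    by (rule countable_dense_test_vectors[where n = r]) blast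
  have ptw: "AE \<xi> in m. \<xi> \<in> \<Omega> \<longrightarrow> C * norm_sq r v - norm_sq s (mat_app r (fib \<xi>) v) \<le> 0" for v
  proof (rule AE_nonpos_from_tests[where b = entries_sq])
    fix N E assume E: "E \<in> sets m" "E \<subseteq> \<Omega>" "\<forall>x\<in>E. entries_sq x \<le> real N"
    note I = test_function(4)[OF E, of v] test_integrable[OF E(1), of "C * norm_sq r v"]
    show "integrable m (\<lambda>x. indicator E x * (C * norm_sq r v - norm_sq s (mat_app r (fib x) v))) \<and>
        (LINT x|m. indicator E x * (C * norm_sq r v - norm_sq s (mat_app r (fib x) v))) \<le> 0"
      unfolding right_diff_distrib using I test[OF E, of v]
      by (simp add: Bochner_Integration.integral_diff)
  qed (use norm_sq_const_measurable in measurable)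
  have "AE \<xi> in m. \<forall>v\<in>D. \<xi> \<in> \<Omega> \<longrightarrow> C * norm_sq r v - norm_sq s (mat_app r (fib \<xi>) v) \<le> 0"
    unfolding AE_ball_countable[OF D(1)] using ptw by blast
  then show ?thesis
    unfolding lower_def by eventually_elim (use D(2) in auto)
qed

text \<open>A fiberwise inequality can be integrated; conversely, a Bessel bound is tested on functions
  with constant fibers. The factor \<open>r\<close> compensates for \<open>1 / r\<close> in \<open>frame_sum\<close>.\<close>

lemma bessel_bound_iff:
  assumes "0 < B"
  shows "bessel_bound m sys (M \<times> {1..s}) B \<longleftrightarrow> upper (real r * B)"
proof
  assume U: "upper (real r * B)"
  have "(\<Sum>\<^sub>\<infinity>i\<in>M \<times> {1..s}. ennreal ((cmod (l2_inner m f (sys i)))\<^sup>2)) \<le> ennreal (B * (l2_norm m f)\<^sup>2)"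
    if f: "f \<in> L2 m" for f
  proof -
    note I = fiber_norms_integrable[OF f upper_periodize_L2[OF U f]]
    have "(LINT \<xi>:\<Omega>|m. norm_sq s (mat_app r (fib \<xi>) (fiber f \<xi>))) \<le>
        (LINT \<xi>|m. (real r * B) * (indicator \<Omega> \<xi> *\<^sub>R norm_sq r (fiber f \<xi>)))"
      unfolding set_lebesgue_integral_def
    proof (rule integral_mono_AE[OF I(1) integrable_mult_right[OF I(2)]])
      show "AE \<xi> in m. indicator \<Omega> \<xi> *\<^sub>R norm_sq s (mat_app r (fib \<xi>) (fiber f \<xi>)) \<le>
          (real r * B) * (indicator \<Omega> \<xi> *\<^sub>R norm_sq r (fiber f \<xi>))"
        using U unfolding upper_def by eventually_elim (auto simp: indicator_def)
    qed
    also have "\<dots> = real r * (B * (l2_norm m f)\<^sup>2)"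
      by (simp add: l2_norm_fiber[OF f] set_lebesgue_integral_def)
    finally show ?thesis
      unfolding frame_sum_upper[OF U f] using r_pos
      by (intro ennreal_leI) (simp add: field_simps)
  qed
  then show "bessel_bound m sys (M \<times> {1..s}) B" using assms by (simp add: bessel_bound_def)
next
  assume Bb: "bessel_bound m sys (M \<times> {1..s}) B"
  show "upper (real r * B)"
  proof (rule upperI_tests)
    fix E v N assume E: "E \<in> sets m" "E \<subseteq> \<Omega>" "\<forall>x\<in>E. entries_sq x \<le> real N"
    note t = test_function[OF E, of v]
    have "ennreal (1 / real r * (LINT \<xi>|m. indicator E \<xi> * norm_sq s (mat_app r (fib \<xi>) v))) \<le>
        ennreal (B * (LINT \<xi>|m. indicator E \<xi> * norm_sq r v))"
      using Bb t(1) unfolding bessel_bound_def t(2,3)[symmetric] by blast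
    moreover have "0 \<le> (LINT \<xi>|m. indicator E \<xi> * norm_sq r v)"
      by (intro integral_nonneg_AE AE_I2) (simp add: norm_sq_nonneg)
    ultimately have "1 / real r * (LINT \<xi>|m. indicator E \<xi> * norm_sq s (mat_app r (fib \<xi>) v)) \<le>
        B * (LINT \<xi>|m. indicator E \<xi> * norm_sq r v)"
      using assms by (subst (asm) ennreal_le_iff) auto
    then show "(LINT \<xi>|m. indicator E \<xi> * norm_sq s (mat_app r (fib \<xi>) v)) \<le>
        (LINT \<xi>|m. indicator E \<xi> * (real r * B * norm_sq r v))"
      using r_pos by (simp add: field_simps)
  qed
qed

text \<open>The argument for Bessel bounds with inequalities reversed. The upper bound makes \<open>frame_sum\<close>
  available for every \<open>f\<close>.\<close>

lemma lower_frame_bound_iff: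
  assumes "0 < A" and U: "upper C"
  shows "lower_frame_bound m sys (M \<times> {1..s}) A \<longleftrightarrow> lower (real r * A)"
proof
  assume L: "lower (real r * A)"
  have "ennreal (A * (l2_norm m f)\<^sup>2) \<le> (\<Sum>\<^sub>\<infinity>i\<in>M \<times> {1..s}. ennreal ((cmod (l2_inner m f (sys i)))\<^sup>2))"
    if f: "f \<in> L2 m" for f
  proof -
    note I = fiber_norms_integrable[OF f upper_periodize_L2[OF U f]]
    have "real r * (A * (l2_norm m f)\<^sup>2) = (LINT \<xi>|m. (real r * A) * (indicator \<Omega> \<xi> *\<^sub>R norm_sq r (fiber f \<xi>)))"
      by (simp add: l2_norm_fiber[OF f] set_lebesgue_integral_def)
    also have "\<dots> \<le> (LINT \<xi>:\<Omega>|m. norm_sq s (mat_app r (fib \<xi>) (fiber f \<xi>)))"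
      unfolding set_lebesgue_integral_def
    proof (rule integral_mono_AE[OF integrable_mult_right[OF I(2)] I(1)])
      show "AE \<xi> in m. (real r * A) * (indicator \<Omega> \<xi> *\<^sub>R norm_sq r (fiber f \<xi>)) \<le>
          indicator \<Omega> \<xi> *\<^sub>R norm_sq s (mat_app r (fib \<xi>) (fiber f \<xi>))"
        using L unfolding lower_def by eventually_elim (auto simp: indicator_def)
    qed
    finally show ?thesis
      unfolding frame_sum_upper[OF U f] using r_pos
      by (intro ennreal_leI) (simp add: field_simps)
  qed
  then show "lower_frame_bound m sys (M \<times> {1..s}) A" using assms by (simp add: lower_frame_bound_def)
next
  assume Lb: "lower_frame_bound m sys (M \<times> {1..s}) A"
  show "lower (real r * A)"
  proof (rule lowerI_tests)
    fix E v N assume E: "E \<in> sets m" "E \<subseteq> \<Omega>" "\<forall>x\<in>E. entries_sq x \<le> real N"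
    note t = test_function[OF E, of v]
    have "ennreal (A * (LINT \<xi>|m. indicator E \<xi> * norm_sq r v)) \<le>
        ennreal (1 / real r * (LINT \<xi>|m. indicator E \<xi> * norm_sq s (mat_app r (fib \<xi>) v)))"
      using Lb t(1) unfolding lower_frame_bound_def t(2,3)[symmetric] by blast
    moreover have "0 \<le> (LINT \<xi>|m. indicator E \<xi> * norm_sq s (mat_app r (fib \<xi>) v))"
      by (intro integral_nonneg_AE AE_I2) (simp add: norm_sq_nonneg)
    ultimately have "A * (LINT \<xi>|m. indicator E \<xi> * norm_sq r v) \<le>
        1 / real r * (LINT \<xi>|m. indicator E \<xi> * norm_sq s (mat_app r (fib \<xi>) v))"
      by (subst (asm) ennreal_le_iff) auto
    then show "(LINT \<xi>|m. indicator E \<xi> * (real r * A * norm_sq r v)) \<le>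
        (LINT \<xi>|m. indicator E \<xi> * norm_sq s (mat_app r (fib \<xi>) v))"
      using r_pos by (simp add: field_simps)
  qed
qed

lemma bessel_sequence_iff: "bessel_sequence m sys (M \<times> {1..s}) \<longleftrightarrow> (\<exists>C>0. upper C)"
proof
  assume "bessel_sequence m sys (M \<times> {1..s})"
  then obtain B where "0 < B" "bessel_bound m sys (M \<times> {1..s}) B"
    unfolding bessel_sequence_def bessel_bound_def by blast
  then show "\<exists>C>0. upper C"
    using bessel_bound_iff r_pos by (intro exI[of _ "real r * B"]) auto
next
  assume "\<exists>C>0. upper C"
  then obtain C where "C > 0" "upper C" by blast
  then show "bessel_sequence m sys (M \<times> {1..s})"
    unfolding bessel_sequence_def using bessel_bound_iff[of "C / real r"] r_pos by auto
qed

lemma frame_iff: "frame m sys (M \<times> {1..s}) \<longleftrightarrow> (\<exists>C>0. upper C) \<and> (\<exists>c>0. lower c)"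
proof
  assume "frame m sys (M \<times> {1..s})"
  then obtain A B where A: "0 < A" "lower_frame_bound m sys (M \<times> {1..s}) A"
    and B: "bessel_bound m sys (M \<times> {1..s}) B"
    unfolding frame_def lower_frame_bound_def by blast
  from B have "\<exists>C>0. upper C"
    unfolding bessel_sequence_iff[symmetric] bessel_sequence_def by blast
  moreover from this have "lower (real r * A)" using A lower_frame_bound_iff by blast
  ultimately show "(\<exists>C>0. upper C) \<and> (\<exists>c>0. lower c)"
    using A r_pos by (metis mult_pos_pos of_nat_0_less_iff)
next
  assume "(\<exists>C>0. upper C) \<and> (\<exists>c>0. lower c)"
  then obtain C c where C: "C > 0" "upper C" and c: "c > 0" "lower c" by blast
  have "lower_frame_bound m sys (M \<times> {1..s}) (c / real r)"
    using lower_frame_bound_iff[OF _ C(2), of "c / real r"] c r_pos by simp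
  moreover have "bessel_bound m sys (M \<times> {1..s}) (C / real r)"
    using bessel_bound_iff[of "C / real r"] C r_pos by simp
  ultimately show "frame m sys (M \<times> {1..s})" unfolding frame_def by blast
qed

end

section \<open>Completeness on the fibers\<close>

context fiberization
begin

text \<open>The squared norm of \<open>cnj (G j) * (p - q)\<close> is the squared norm of \<open>p - q\<close> with respect to an
  integrable weight, and for this weight \<open>p\<close> is approximated by combinations of the \<open>\<psi> i\<close>.\<close>

lemma span_periodic:
  assumes j: "j \<in> {1..s}" and p: "p \<in> borel_measurable m" "\<And>x. x \<in> space m \<Longrightarrow> cmod (p x) \<le> B" "periodic p"
  shows "(\<lambda>x. cnj (G j x) * p x) \<in> closed_span m sys (M \<times> {1..s})"
proof (rule closed_spanI)
  note G = G_L2[OF j]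
  note [measurable] = p(1) L2_measurable[OF G]
  show "(\<lambda>x. cnj (G j x) * p x) \<in> L2 m"
    by (rule L2_dominated[OF G, of _ B]) (auto simp: norm_mult mult.commute intro!: mult_right_mono p(2))
  fix \<epsilon> :: real assume "\<epsilon> > 0"
  then obtain F c where F: "finite F" "F \<subseteq> M"
    "(LINT x|m. (cmod (G j x))\<^sup>2 * (cmod (p x - (\<Sum>i\<in>F. c i * \<psi> i x)))\<^sup>2) < \<epsilon>\<^sup>2"
    using \<psi>_dense[OF p L2_integrable[OF G], of "\<epsilon>\<^sup>2"] by auto
  define d where "d = (\<lambda>(i, j' :: nat). c i)"
  have "(\<Sum>i\<in>F \<times> {j}. d i * sys i x) = cnj (G j x) * (\<Sum>i\<in>F. c i * \<psi> i x)" for x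
    unfolding sum.cartesian_product' by (simp add: d_def sys_def sum_distrib_left mult.left_commute)
  then have "(l2_norm m (\<lambda>x. cnj (G j x) * p x - (\<Sum>i\<in>F \<times> {j}. d i * sys i x)))\<^sup>2 =
      (LINT x|m. (cmod (G j x))\<^sup>2 * (cmod (p x - (\<Sum>i\<in>F. c i * \<psi> i x)))\<^sup>2)"
    unfolding l2_norm_sq by (simp add: norm_mult power_mult_distrib flip: right_diff_distrib)
  then have "l2_norm m (\<lambda>x. cnj (G j x) * p x - (\<Sum>i\<in>F \<times> {j}. d i * sys i x)) < \<epsilon>"
    using F(3) \<open>\<epsilon> > 0\<close> by (auto intro: power2_less_imp_less)
  then show "\<exists>F c. finite F \<and> F \<subseteq> M \<times> {1..s} \<and>
      l2_norm m (\<lambda>x. cnj (G j x) * p x - (\<Sum>i\<in>F. c i * sys i x)) < \<epsilon>"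
    using F(1,2) j by (intro exI[of _ "F \<times> {j}"] exI[of _ d]) auto
qed

lemma sys_T: "i \<in> M \<Longrightarrow> k < r \<Longrightarrow> x \<in> space m \<Longrightarrow> sys (i, j) (T k x) = cnj (G j (T k x)) * \<psi> i x"
  by (simp add: sys_def periodicD[OF \<psi>_periodic])

text \<open>The function whose fibers are all equal to the unit vector with index \<open>k\<close> is a limit of
  combinations of the system, almost everywhere along a subsequence. The fibers of these
  combinations lie in the range of the conjugate transpose, to which every kernel vector \<open>w\<close> is
  orthogonal; in the limit, \<open>w k = 0\<close>.\<close>

lemma complete_imp_injective:
  assumes "complete_system m sys (M \<times> {1..s})"
  shows "AE \<xi> in m. \<xi> \<in> \<Omega> \<longrightarrow> injective s r (fib \<xi>)"
proof -
  have "AE \<xi> in m. \<xi> \<in> \<Omega> \<longrightarrow> (\<forall>w. (\<forall>j<s. mat_app r (fib \<xi>) w j = 0) \<longrightarrow> w k = 0)" if k: "k < r" for k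
  proof -
    define f where "f = lift (\<lambda>l \<xi>. if l = k then 1 else 0)"
    have f: "f \<in> L2 m" unfolding f_def
    proof (rule lift_L2)
      fix l
      show "(\<lambda>x. indicator \<Omega> x * (if l = k then 1 else 0)) \<in> L2 m"
        by (rule L2_dominated[of "\<lambda>_. 1" m _ 1]) (auto simp: L2_def indicator_def)
    qed
    have span: "f \<in> closed_span m sys (M \<times> {1..s})"
      using assms f complete_system_iff by blast
    have "\<exists>p. finite (fst p) \<and> fst p \<subseteq> M \<times> {1..s} \<and>
        l2_norm m (\<lambda>x. f x - (\<Sum>i\<in>fst p. snd p i * sys i x)) < 1 / real (Suc n)" for n
    proof -
      have "0 < 1 / real (Suc n)" by simp
      with span obtain F c where "finite F" "F \<subseteq> M \<times> {1..s}"
        "l2_norm m (\<lambda>x. f x - (\<Sum>i\<in>F. c i * sys i x)) < 1 / real (Suc n)"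
        unfolding closed_span_def by blast
      then show ?thesis by (intro exI[of _ "(F, c)"]) simp
    qed
    from choice[OF allI[OF this]] obtain p where p: "\<forall>n. finite (fst (p n)) \<and> fst (p n) \<subseteq> M \<times> {1..s} \<and>
        l2_norm m (\<lambda>x. f x - (\<Sum>i\<in>fst (p n). snd (p n) i * sys i x)) < 1 / real (Suc n)" ..
    define F c where "F n = fst (p n)" and "c n = snd (p n)" for n
    have F: "finite (F n)" "F n \<subseteq> M \<times> {1..s}"
      "l2_norm m (\<lambda>x. f x - (\<Sum>i\<in>F n. c n i * sys i x)) < 1 / real (Suc n)" for n
      using p by (auto simp: F_def c_def)
    define g where "g n x = (\<Sum>i\<in>F n. c n i * sys i x)" for n x
    have g: "g n \<in> L2 m" for n unfolding g_def using F(2) sys_L2 by (intro L2_lincomb) blast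
    define u where "u n x = (cmod (f x - g n x))\<^sup>2" for n x
    have u_int: "integrable m (u n)" for n unfolding u_def by (intro L2_integrable L2_diff f g)
    have "(\<lambda>n. LINT x|m. norm (u n x)) \<longlonglongrightarrow> 0"
    proof (rule real_tendsto_sandwich[OF _ _ tendsto_const])
      show "\<forall>\<^sub>F n in sequentially. (LINT x|m. norm (u n x)) \<le> (1 / real (Suc n))\<^sup>2"
      proof (intro always_eventually allI)
        fix n
        have "(LINT x|m. norm (u n x)) = (l2_norm m (\<lambda>x. f x - g n x))\<^sup>2"
          by (simp add: l2_norm_sq u_def)
        also have "\<dots> \<le> (1 / real (Suc n))\<^sup>2"
          using F(3)[of n] by (intro power_mono) (auto simp: g_def)
        finally show "(LINT x|m. norm (u n x)) \<le> (1 / real (Suc n))\<^sup>2" .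
      qed
      show "(\<lambda>n. (1 / real (Suc n))\<^sup>2) \<longlonglongrightarrow> 0"
        using tendsto_power[OF LIMSEQ_inverse_real_of_nat, of 2] by (simp add: inverse_eq_divide)
    qed simp
    then obtain t where t: "strict_mono t" "AE x in m. (\<lambda>n. u (t n) x) \<longlonglongrightarrow> 0"
      using tendsto_L1_AE_subseq[where u = u, OF u_int] by blast
    from AE_fiberD[OF t(2)] show ?thesis
    proof (rule AE_mp, intro AE_I2 impI allI)
      fix \<xi> w assume \<xi>: "\<xi> \<in> space m" "\<xi> \<in> \<Omega>" and lim: "\<forall>l<r. (\<lambda>n. u (t n) (T l \<xi>)) \<longlonglongrightarrow> 0"
        and w: "\<forall>j<s. mat_app r (fib \<xi>) w j = 0"
      have "(\<lambda>n. g (t n) (T l \<xi>)) \<longlonglongrightarrow> (if l = k then 1 else 0)" if l: "l < r" for l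
      proof -
        have "(\<lambda>n. sqrt (u (t n) (T l \<xi>))) \<longlonglongrightarrow> sqrt 0"
          using lim l by (intro tendsto_real_sqrt) auto
        then have "(\<lambda>n. dist (g (t n) (T l \<xi>)) (f (T l \<xi>))) \<longlonglongrightarrow> 0"
          by (simp add: u_def dist_norm norm_minus_commute)
        then have "(\<lambda>n. g (t n) (T l \<xi>)) \<longlonglongrightarrow> f (T l \<xi>)" by (rule tendsto_dist_iff[THEN iffD2])
        then show ?thesis unfolding f_def lift_T[OF \<xi>(2) l] .
      qed
      then have "(\<lambda>n. \<Sum>l<r. g (t n) (T l \<xi>) * cnj (w l)) \<longlonglongrightarrow> (\<Sum>l<r. (if l = k then 1 else 0) * cnj (w l))"
        by (intro tendsto_sum tendsto_mult tendsto_const) simp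
      moreover have "(\<Sum>l<r. (if l = k then 1 else 0) * cnj (w l)) = cnj (w k)"
      proof -
        have "(\<Sum>l<r. (if l = k then 1 else 0) * cnj (w l)) = (\<Sum>l<r. if l = k then cnj (w l) else 0)"
          by (intro sum.cong) auto
        then show ?thesis using k by simp
      qed
      moreover have "(\<Sum>l<r. g n (T l \<xi>) * cnj (w l)) = 0" for n
      proof -
        have "(\<Sum>l<r. g n (T l \<xi>) * cnj (w l)) = (\<Sum>i\<in>F n. c n i * (\<Sum>l<r. sys i (T l \<xi>) * cnj (w l)))"
          unfolding g_def sum_distrib_right sum_distrib_left by (subst sum.swap) (simp add: mult.assoc)
        also have "\<dots> = 0"
        proof (intro sum.neutral ballI)
          fix p assume "p \<in> F n"
          then obtain i j where ij: "p = (i, j)" "i \<in> M" "j \<in> {1..s}" using F(2)[of n] by auto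
          have "(\<Sum>l<r. sys p (T l \<xi>) * cnj (w l)) = \<psi> i \<xi> * cnj (mat_app r (fib \<xi>) w (j - 1))"
            unfolding ij(1) mat_app_def cnj_sum sum_distrib_left using ij(2,3) \<xi>(1)
            by (intro sum.cong) (auto simp: sys_T fib_def)
          also have "\<dots> = 0"
          proof -
            have "j - 1 < s" using ij(3) by auto
            with w show ?thesis by simp
          qed
          finally show "c n p * (\<Sum>l<r. sys p (T l \<xi>) * cnj (w l)) = 0" by simp
        qed
        finally show ?thesis .
      qed
      ultimately have "(\<lambda>n. 0) \<longlonglongrightarrow> cnj (w k)" by simp
      then show "w k = 0" by (simp add: LIMSEQ_const_iff)
    qed
  qed
  then have "AE \<xi> in m. \<forall>k\<in>{..<r}. \<xi> \<in> \<Omega> \<longrightarrow> (\<forall>w. (\<forall>j<s. mat_app r (fib \<xi>) w j = 0) \<longrightarrow> w k = 0)"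
    by (intro AE_finite_allI) auto
  then show ?thesis by eventually_elim (auto simp: injective_def)
qed

text \<open>With \<open>P\<close> the pseudoinverse solution for the fiber of \<open>f\<close>, the function \<open>f\<close> is the sum over
  \<open>j\<close> of \<open>cnj (G j)\<close> times a periodic function. These periodic factors need not be bounded, so \<open>f\<close>
  is first restricted to the fibers over the set \<open>E N\<close> where they are at most \<open>N\<close>.\<close>

lemma injective_imp_complete:
  assumes inj: "AE \<xi> in m. \<xi> \<in> \<Omega> \<longrightarrow> injective s r (fib \<xi>)"
  shows "complete_system m sys (M \<times> {1..s})"
  unfolding complete_system_iff
proof
  fix f assume f: "f \<in> L2 m"
  note [measurable] = L2_measurable[OF f]
  define P where "P j \<xi> = solve s r (fib \<xi>) (fiber f \<xi>) j" for j \<xi>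
  have P_meas: "P j \<in> borel_measurable m" if "j < s" for j
    unfolding P_def using that fib_measurable measurable_T[OF _ L2_measurable[OF f]]
    by (intro measurable_solve) auto
  define E where "E N = {\<xi> \<in> \<Omega>. (\<Sum>j<s. cmod (P j \<xi>)) \<le> real N}" for N :: nat
  have E_sets [measurable]: "E N \<in> sets m" for N
  proof -
    have [measurable]: "(\<lambda>\<xi>. \<Sum>j<s. cmod (P j \<xi>)) \<in> borel_measurable m"
      using P_meas by (intro borel_measurable_sum borel_measurable_norm) auto
    have "E N = \<Omega> \<inter> {\<xi> \<in> space m. (\<Sum>j<s. cmod (P j \<xi>)) \<le> real N}"
      unfolding E_def using \<Omega>_space by auto
    then show ?thesis by simp
  qed
  define q where "q N j = periodize (\<lambda>x. indicator (E N) x * P j x)" for N j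
  have q_T: "q N j (T k \<xi>) = indicator (E N) \<xi> * P j \<xi>" if "\<xi> \<in> \<Omega>" "k < r" for N j k \<xi>
    unfolding q_def using that by (intro periodize_T_supported) (auto simp: E_def indicator_def)
  have q_bound: "cmod (q N j x) \<le> real N" if "x \<in> space m" "j < s" for N j x
  proof -
    obtain \<xi> k where \<xi>: "\<xi> \<in> \<Omega>" "k < r" "x = T k \<xi>" using fiber_point[OF \<open>x \<in> space m\<close>] .
    have "cmod (P j \<xi>) \<le> (\<Sum>j<s. cmod (P j \<xi>))"
      using \<open>j < s\<close> by (intro member_le_sum) auto
    then show ?thesis unfolding \<xi>(3) q_T[OF \<xi>(1,2)] by (auto simp: E_def indicator_def)
  qed
  define g where "g N x = (\<Sum>j<s. cnj (G (Suc j) x) * q N j x)" for N x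
  have g_span: "g N \<in> closed_span m sys (M \<times> {1..s})" for N
    unfolding g_def
  proof (rule closed_span_sum[OF sys_L2])
    fix j assume "j \<in> {..<s}"
    then have j: "j < s" by simp
    have "q N j \<in> borel_measurable m"
      unfolding q_def by (intro measurable_periodize borel_measurable_times P_meas[OF j]) measurable
    then show "(\<lambda>x. cnj (G (Suc j) x) * q N j x) \<in> closed_span m sys (M \<times> {1..s})"
      using j q_bound[OF _ j] by (intro span_periodic) (auto simp: q_def periodic_periodize)
  qed auto
  have g_T: "AE \<xi> in m. \<xi> \<in> \<Omega> \<longrightarrow> (\<forall>k<r. \<forall>N. g N (T k \<xi>) = indicator (E N) \<xi> * f (T k \<xi>))"
    using inj
  proof eventually_elim
    case (elim \<xi>)
    show ?case
    proof (intro impI allI)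
      fix k N assume \<xi>: "\<xi> \<in> \<Omega>" and k: "k < r"
      show "g N (T k \<xi>) = indicator (E N) \<xi> * f (T k \<xi>)"
      proof -
        have "g N (T k \<xi>) = indicator (E N) \<xi> * mat_app s (conj_transpose (fib \<xi>)) (\<lambda>j. P j \<xi>) k"
          unfolding g_def q_T[OF \<xi> k] mat_app_def conj_transpose_def fib_def sum_distrib_left
          by (intro sum.cong) (auto simp: mult.left_commute)
        then show ?thesis using solve_eq[of s r "fib \<xi>" k "fiber f \<xi>"] elim \<xi> k by (simp add: P_def)
      qed
    qed
  qed
  have "(\<lambda>N. LINT x|m. (cmod (f x - g N x))\<^sup>2) \<longlonglongrightarrow> (LINT x|m. 0)"
  proof (rule integral_dominated_convergence[where w = "\<lambda>x. (cmod (f x))\<^sup>2"])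
    show "(\<lambda>x. (cmod (f x - g N x))\<^sup>2) \<in> borel_measurable m" for N
      using L2_diff[OF f closed_span_L2[OF g_span]] by (auto simp: L2_def)
    show "AE x in m. (\<lambda>N. (cmod (f x - g N x))\<^sup>2) \<longlonglongrightarrow> 0"
    proof (rule AE_fiberI, use g_T in eventually_elim, intro impI allI)
      fix \<xi> k assume *: "\<xi> \<in> \<Omega> \<longrightarrow> (\<forall>k<r. \<forall>N. g N (T k \<xi>) = indicator (E N) \<xi> * f (T k \<xi>))"
        and \<xi>: "\<xi> \<in> \<Omega>" and k: "k < r"
      obtain N where "(\<Sum>j<s. cmod (P j \<xi>)) \<le> real N" using real_arch_simple by blast
      then have "\<xi> \<in> E n" if "n \<ge> N" for n using \<xi> that by (auto simp: E_def)
      then have "\<forall>n\<ge>N. (cmod (f (T k \<xi>) - g n (T k \<xi>)))\<^sup>2 = 0" using * \<xi> k by simp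
      then show "(\<lambda>N. (cmod (f (T k \<xi>) - g N (T k \<xi>)))\<^sup>2) \<longlonglongrightarrow> 0"
        by (intro tendsto_eventually) (auto simp: eventually_sequentially)
    qed
    show "AE x in m. norm ((cmod (f x - g N x))\<^sup>2) \<le> (cmod (f x))\<^sup>2" for N
      by (rule AE_fiberI, use g_T in eventually_elim) (auto simp: indicator_def)
  qed (use L2_integrable[OF f] in auto)
  then have lim: "(\<lambda>N. (l2_norm m (\<lambda>x. f x - g N x))\<^sup>2) \<longlonglongrightarrow> 0" by (simp add: l2_norm_sq)
  show "f \<in> closed_span m sys (M \<times> {1..s})"
  proof (rule closed_span_closed[OF sys_L2 f])
    fix \<epsilon> :: real assume "\<epsilon> > 0"
    then have "\<forall>\<^sub>F n in sequentially. (l2_norm m (\<lambda>x. f x - g n x))\<^sup>2 < \<epsilon>\<^sup>2"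
      by (intro order_tendstoD(2)[OF lim]) auto
    then obtain n where "(l2_norm m (\<lambda>x. f x - g n x))\<^sup>2 < \<epsilon>\<^sup>2"
      by (auto simp: eventually_sequentially)
    then have "l2_norm m (\<lambda>x. f x - g n x) < \<epsilon>"
      using \<open>\<epsilon> > 0\<close> by (auto intro: power2_less_imp_less)
    then show "\<exists>g\<in>closed_span m sys (M \<times> {1..s}). l2_norm m (\<lambda>x. f x - g x) < \<epsilon>" using g_span by blast
  qed
qed

end

section \<open>Riesz bases and square fiber matrices\<close>

context fiberization
begin

text \<open>Unit vectors turn the operator bound into a bound on each of the \<open>r\<close> columns.\<close>

lemma upper_entries:
  assumes "upper C"
  shows "AE \<xi> in m. \<xi> \<in> \<Omega> \<longrightarrow> (\<Sum>j<s. \<Sum>k<r. (cmod (conj_transpose (fib \<xi>) k j))\<^sup>2) \<le> real r * C"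
  using assms unfolding upper_def
proof eventually_elim
  case (elim \<xi>)
  show ?case
  proof
    assume \<xi>: "\<xi> \<in> \<Omega>"
    have "(\<Sum>j<s. (cmod (fib \<xi> j k))\<^sup>2) \<le> C" if k: "k < r" for k
    proof -
      define e where "e l = (if l = k then 1 else 0 :: complex)" for l
      have app: "mat_app r (fib \<xi>) e j = fib \<xi> j k" for j
      proof -
        have "mat_app r (fib \<xi>) e j = (\<Sum>l<r. if l = k then fib \<xi> j l else 0)"
          unfolding mat_app_def e_def by (intro sum.cong) auto
        then show ?thesis using k by simp
      qed
      have "norm_sq r e = 1"
      proof -
        have "norm_sq r e = (\<Sum>l<r. if l = k then 1 else 0)"
          unfolding norm_sq_def e_def by (intro sum.cong) auto
        then show ?thesis using k by simp
      qed
      moreover have "norm_sq s (mat_app r (fib \<xi>) e) \<le> C * norm_sq r e" using elim \<xi> by blast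
      ultimately show ?thesis unfolding norm_sq_def[of s] by (simp add: app)
    qed
    then have "(\<Sum>k<r. \<Sum>j<s. (cmod (fib \<xi> j k))\<^sup>2) \<le> (\<Sum>k<r. C)" by (intro sum_mono) auto
    then show "(\<Sum>j<s. \<Sum>k<r. (cmod (conj_transpose (fib \<xi>) k j))\<^sup>2) \<le> real r * C"
      by (subst sum.swap) (simp add: conj_transpose_def)
  qed
qed

lemma lower_imp_injective: "0 < c \<Longrightarrow> lower c \<Longrightarrow> AE \<xi> in m. \<xi> \<in> \<Omega> \<longrightarrow> injective s r (fib \<xi>)"
  unfolding lower_def by (auto elim!: eventually_mono intro: lower_bound_imp_injective)

lemma injective_imp_r_le_s:
  assumes "AE \<xi> in m. \<xi> \<in> \<Omega> \<longrightarrow> injective s r (fib \<xi>)"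
  shows "r \<le> s"
proof (rule ccontr)
  assume "\<not> r \<le> s"
  with assms have "AE \<xi> in m. \<xi> \<notin> \<Omega>"
    by (auto elim!: eventually_mono dest: injective_imp_le)
  with \<Omega>_not_null show False by simp
qed

text \<open>The coefficients \<open>c i * v j\<close> produce the function \<open>g * P\<close>, where \<open>P\<close> is the combination of
  the \<open>\<psi> i\<close> and \<open>g\<close> that of the conjugates of the \<open>G j\<close>. Letting \<open>P\<close> approach the periodization of
  the indicator of a set \<open>E\<close>, stability becomes an inequality between integrals over \<open>E\<close>, whence
  \<open>real r / C * norm_sq s v\<close> is at most the squared norm of \<open>a\<^sup>* v\<close> almost everywhere. So \<open>a\<^sup>*\<close>,
  which has \<open>s\<close> columns and \<open>r\<close> rows, is injective.\<close>

lemma stable_imp_s_le_r: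
  assumes "C > 0" and stable: "\<And>F c. finite F \<Longrightarrow> F \<subseteq> M \<times> {1..s} \<Longrightarrow>
    (\<Sum>i\<in>F. (cmod (c i))\<^sup>2) \<le> C * (l2_norm m (\<lambda>x. \<Sum>i\<in>F. c i * sys i x))\<^sup>2"
  shows "s \<le> r"
proof -
  define A where "A \<xi> = conj_transpose (fib \<xi>)" for \<xi>
  obtain D :: "(nat \<Rightarrow> complex) set" where D: "countable D"
    "\<And>n a x w. \<forall>v\<in>D. x * norm_sq s v \<le> norm_sq n (mat_app s a v) \<Longrightarrow>
       x * norm_sq s w \<le> norm_sq n (mat_app s a w)"
    by (rule countable_dense_test_vectors[where n = s]) blast
  have A_meas: "(\<lambda>\<xi>. norm_sq r (mat_app s (A \<xi>) v)) \<in> borel_measurable m" for v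
    unfolding norm_sq_def mat_app_def A_def conj_transpose_def
    using measurable_compose[OF fib_measurable cnj_measurable]
    by (intro borel_measurable_sum borel_measurable_power borel_measurable_norm borel_measurable_times) auto
  have ptw: "AE \<xi> in m. \<xi> \<in> \<Omega> \<longrightarrow> real r / C * norm_sq s v - norm_sq r (mat_app s (A \<xi>) v) \<le> 0" for v
  proof (rule AE_nonpos_from_tests[where b = entries_sq])
    fix N E assume E: "E \<in> sets m" "E \<subseteq> \<Omega>" "\<forall>x\<in>E. entries_sq x \<le> real N"
    note [measurable] = E(1) A_meas
    define q where "q = periodize (indicator E :: 'x \<Rightarrow> complex)"
    have q_T: "q (T k \<xi>) = indicator E \<xi>" if "\<xi> \<in> \<Omega>" "k < r" for \<xi> k
      unfolding q_def using that E(2) by (intro periodize_T_supported) (auto simp: indicator_def)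
    have q_meas [measurable]: "q \<in> borel_measurable m" unfolding q_def by measurable
    have q_bound: "cmod (q x) \<le> 1" if "x \<in> space m" for x
    proof -
      obtain \<xi> k where \<xi>: "\<xi> \<in> \<Omega>" "k < r" "x = T k \<xi>" using fiber_point[OF \<open>x \<in> space m\<close>] .
      show ?thesis unfolding \<xi>(3) q_T[OF \<xi>(1,2)] by (auto simp: indicator_def)
    qed
    have q_per: "periodic q" unfolding q_def by (rule periodic_periodize)
    have q_L2: "q \<in> L2 m"
      by (rule L2_dominated[of "\<lambda>_. 1" m _ 1]) (auto simp: L2_def q_bound)
    define g where "g x = (\<Sum>j<s. v j * cnj (G (Suc j) x))" for x
    have g_L2: "g \<in> L2 m" unfolding g_def by (intro L2_sum L2_cmult L2_cnj G_L2) auto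
    note [measurable] = L2_measurable[OF g_L2]
    have gq_L2: "(\<lambda>x. g x * q x) \<in> L2 m"
      by (rule L2_dominated[OF g_L2, of _ 1])
        (auto simp: norm_mult intro!: mult_left_le q_bound)
    have key: "sqrt (norm_sq s v) * l2_norm m q \<le> sqrt C * l2_norm m (\<lambda>x. g x * q x)"
    proof (rule field_le_epsilon)
      fix \<delta> :: real assume "\<delta> > 0"
      define K where "K = sqrt (norm_sq s v) + sqrt C"
      have K: "K > 0" unfolding K_def using \<open>C > 0\<close> norm_sq_nonneg[of s v]
        by (intro add_nonneg_pos) auto
      define \<epsilon> where "\<epsilon> = \<delta> / K"
      have \<epsilon>: "\<epsilon> > 0" using \<open>\<delta> > 0\<close> K by (simp add: \<epsilon>_def)
      \<comment> \<open>This weight controls \<open>q - P\<close> and \<open>g * (q - P)\<close> at the same time.\<close>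
      have w: "integrable m (\<lambda>x. 1 + (cmod (g x))\<^sup>2)"
        by (intro Bochner_Integration.integrable_add L2_integrable g_L2) simp
      obtain F c where F: "finite F" "F \<subseteq> M"
        "(LINT x|m. (1 + (cmod (g x))\<^sup>2) * (cmod (q x - (\<Sum>i\<in>F. c i * \<psi> i x)))\<^sup>2) < \<epsilon>\<^sup>2"
        using \<psi>_dense[OF q_meas q_bound q_per w, of "\<epsilon>\<^sup>2"] \<epsilon> by auto
      define P where "P x = (\<Sum>i\<in>F. c i * \<psi> i x)" for x
      have P_L2: "P \<in> L2 m" unfolding P_def using F(2) \<psi>_L2 by (intro L2_lincomb) auto
      define d where "d = (\<lambda>(i, j). c i * v (j - 1))"
      have sum_d: "(\<Sum>p\<in>F \<times> {1..s}. d p * sys p x) = g x * P x" for x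
      proof -
        have "(\<Sum>p\<in>F \<times> {1..s}. d p * sys p x) = (\<Sum>i\<in>F. \<Sum>j\<in>{1..s}. (c i * \<psi> i x) * (v (j - 1) * cnj (G j x)))"
          unfolding sum.cartesian_product by (intro sum.cong) (auto simp: d_def sys_def)
        also have "\<dots> = P x * (\<Sum>j\<in>{1..s}. v (j - 1) * cnj (G j x))"
          unfolding P_def sum_product ..
        also have "(\<Sum>j\<in>{1..s}. v (j - 1) * cnj (G j x)) = g x"
          unfolding g_def by (intro sum.reindex_bij_witness[of _ Suc "\<lambda>j. j - 1"]) auto
        finally show ?thesis by (simp add: mult.commute)
      qed
      have "(\<Sum>p\<in>F \<times> {1..s}. (cmod (d p))\<^sup>2) = (\<Sum>i\<in>F. \<Sum>j\<in>{1..s}. (cmod (c i))\<^sup>2 * (cmod (v (j - 1)))\<^sup>2)"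
        unfolding sum.cartesian_product
        by (intro sum.cong) (auto simp: d_def norm_mult power_mult_distrib)
      also have "\<dots> = (\<Sum>i\<in>F. (cmod (c i))\<^sup>2) * (\<Sum>j\<in>{1..s}. (cmod (v (j - 1)))\<^sup>2)"
        unfolding sum_product ..
      also have "(\<Sum>j\<in>{1..s}. (cmod (v (j - 1)))\<^sup>2) = norm_sq s v"
        unfolding norm_sq_def by (intro sum.reindex_bij_witness[of _ Suc "\<lambda>j. j - 1"]) auto
      also have "(\<Sum>i\<in>F. (cmod (c i))\<^sup>2) = (l2_norm m P)\<^sup>2"
        unfolding P_def by (rule orthonormal_norm_lincomb[OF \<psi>_orthonormal F(1,2), symmetric])
      finally have "(l2_norm m P)\<^sup>2 * norm_sq s v \<le> C * (l2_norm m (\<lambda>x. g x * P x))\<^sup>2"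
        using stable[of "F \<times> {1..s}" d] F(1,2) unfolding sum_d by (simp add: Sigma_mono)
      then have "sqrt ((l2_norm m P)\<^sup>2 * norm_sq s v) \<le> sqrt (C * (l2_norm m (\<lambda>x. g x * P x))\<^sup>2)"
        by (rule real_sqrt_le_mono)
      then have 1: "sqrt (norm_sq s v) * l2_norm m P \<le> sqrt C * l2_norm m (\<lambda>x. g x * P x)"
        by (simp add: real_sqrt_mult mult.commute)
      have P_bound: "cmod (P x) \<le> (\<Sum>i\<in>F. cmod (c i))" if "x \<in> space m" for x
        unfolding P_def using F(2) \<psi>_norm[OF _ that] by (intro sum_norm_le) (auto simp: norm_mult)
      have gP_L2: "(\<lambda>x. g x * P x) \<in> L2 m"
      proof (rule L2_dominated[OF g_L2])
        show "(\<lambda>x. g x * P x) \<in> borel_measurable m"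
          using L2_measurable[OF P_L2] by measurable
        show "AE x in m. cmod (g x * P x) \<le> (\<Sum>i\<in>F. cmod (c i)) * cmod (g x)"
          using mult_right_mono[OF P_bound, of _ "cmod (g _)"]
          by (intro AE_I2) (simp add: norm_mult mult.commute)
      qed
      have close: "l2_norm m (\<lambda>x. q x - P x) \<le> \<epsilon>" "l2_norm m (\<lambda>x. g x * P x - g x * q x) \<le> \<epsilon>"
      proof -
        have I: "integrable m (\<lambda>x. (cmod (q x - P x))\<^sup>2)" "integrable m (\<lambda>x. (cmod (g x * P x - g x * q x))\<^sup>2)"
          using L2_integrable[OF L2_diff[OF q_L2 P_L2]] L2_integrable[OF L2_diff[OF gP_L2 gq_L2]] .
        have eq: "(1 + (cmod (g x))\<^sup>2) * (cmod (q x - P x))\<^sup>2 =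
            (cmod (q x - P x))\<^sup>2 + (cmod (g x * P x - g x * q x))\<^sup>2" for x
          by (simp add: ring_distribs norm_mult power_mult_distrib norm_minus_commute flip: right_diff_distrib)
        have "(l2_norm m (\<lambda>x. q x - P x))\<^sup>2 + (l2_norm m (\<lambda>x. g x * P x - g x * q x))\<^sup>2 < \<epsilon>\<^sup>2"
          using F(3) I unfolding l2_norm_sq P_def[symmetric] eq by (simp add: Bochner_Integration.integral_add)
        then have "(l2_norm m (\<lambda>x. q x - P x))\<^sup>2 \<le> \<epsilon>\<^sup>2" "(l2_norm m (\<lambda>x. g x * P x - g x * q x))\<^sup>2 \<le> \<epsilon>\<^sup>2"
          using zero_le_power2[of "l2_norm m (\<lambda>x. q x - P x)"]
            zero_le_power2[of "l2_norm m (\<lambda>x. g x * P x - g x * q x)"] by linarith+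
        then show "l2_norm m (\<lambda>x. q x - P x) \<le> \<epsilon>" "l2_norm m (\<lambda>x. g x * P x - g x * q x) \<le> \<epsilon>"
          using \<epsilon> by (auto intro: power2_le_imp_le)
      qed
      have "l2_norm m q \<le> l2_norm m P + \<epsilon>"
        using l2_norm_add_le[OF P_L2 L2_diff[OF q_L2 P_L2]] close(1) by simp
      then have "sqrt (norm_sq s v) * l2_norm m q \<le> sqrt (norm_sq s v) * (l2_norm m P + \<epsilon>)"
        using norm_sq_nonneg[of s v] by (intro mult_left_mono) auto
      also have "\<dots> \<le> sqrt C * l2_norm m (\<lambda>x. g x * P x) + sqrt (norm_sq s v) * \<epsilon>"
        using 1 by (simp add: ring_distribs)
      also have "l2_norm m (\<lambda>x. g x * P x) \<le> l2_norm m (\<lambda>x. g x * q x) + \<epsilon>"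
        using l2_norm_add_le[OF gq_L2 L2_diff[OF gP_L2 gq_L2]] close(2) by simp
      finally have "sqrt (norm_sq s v) * l2_norm m q \<le> sqrt C * (l2_norm m (\<lambda>x. g x * q x) + \<epsilon>) + sqrt (norm_sq s v) * \<epsilon>"
        using \<open>C > 0\<close> by (simp add: mult_left_mono)
      also have "\<dots> = sqrt C * l2_norm m (\<lambda>x. g x * q x) + K * \<epsilon>" by (simp add: K_def algebra_simps)
      finally show "sqrt (norm_sq s v) * l2_norm m q \<le> sqrt C * l2_norm m (\<lambda>x. g x * q x) + \<delta>"
        using K by (simp add: \<epsilon>_def)
    qed
    have "(sqrt (norm_sq s v) * l2_norm m q)\<^sup>2 \<le> (sqrt C * l2_norm m (\<lambda>x. g x * q x))\<^sup>2"
      by (rule power_mono[OF key]) (simp add: norm_sq_nonneg)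
    then have key2: "norm_sq s v * (l2_norm m q)\<^sup>2 \<le> C * (l2_norm m (\<lambda>x. g x * q x))\<^sup>2"
      using \<open>C > 0\<close> by (simp add: power_mult_distrib norm_sq_nonneg)
    have nq: "(l2_norm m q)\<^sup>2 = (LINT \<xi>|m. indicator E \<xi> * real r)"
      unfolding l2_norm_fiber[OF q_L2] set_lebesgue_integral_def
      using E(2) by (intro Bochner_Integration.integral_cong) (auto simp: indicator_def norm_sq_def q_T)
    have gT: "norm_sq r (\<lambda>k. g (T k \<xi>) * q (T k \<xi>)) = indicator E \<xi> * norm_sq r (mat_app s (A \<xi>) v)" if "\<xi> \<in> \<Omega>" for \<xi>
    proof -
      have "g (T k \<xi>) = mat_app s (A \<xi>) v k" for k
        by (simp add: g_def mat_app_def A_def conj_transpose_def fib_def mult.commute)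
      then show ?thesis unfolding norm_sq_def using that by (auto simp: indicator_def q_T)
    qed
    have ngq: "(l2_norm m (\<lambda>x. g x * q x))\<^sup>2 = (LINT \<xi>|m. indicator E \<xi> * norm_sq r (mat_app s (A \<xi>) v))"
      unfolding l2_norm_fiber[OF gq_L2] set_lebesgue_integral_def
      using E(2) gT by (intro Bochner_Integration.integral_cong) (auto simp: indicator_def)
    have I1: "integrable m (\<lambda>\<xi>. indicator E \<xi> * (real r / C * norm_sq s v))" by (rule test_integrable[OF E(1)])
    have I2: "integrable m (\<lambda>\<xi>. indicator E \<xi> * norm_sq r (mat_app s (A \<xi>) v))"
    proof (rule integrable_const_bound[where B = "real N * norm_sq s v"])
      have "norm_sq r (mat_app s (A \<xi>) v) \<le> entries_sq \<xi> * norm_sq s v" for \<xi>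
        using norm_sq_mat_app_le[of r s "A \<xi>" v] unfolding entries_sq_def A_def conj_transpose_def
        by (subst sum.swap) simp
      then show "AE \<xi> in m. norm (indicator E \<xi> * norm_sq r (mat_app s (A \<xi>) v)) \<le> real N * norm_sq s v"
        using mult_right_mono[OF bspec[OF E(3)], of _ "norm_sq s v"]
        by (intro AE_I2) (auto simp: indicator_def norm_sq_nonneg intro: order_trans)
    qed measurable
    have "(LINT \<xi>|m. indicator E \<xi> * (real r / C * norm_sq s v)) \<le> (LINT \<xi>|m. indicator E \<xi> * norm_sq r (mat_app s (A \<xi>) v))"
      using key2 \<open>C > 0\<close> unfolding nq ngq by (simp add: field_simps)
    then show "integrable m (\<lambda>x. indicator E x * (real r / C * norm_sq s v - norm_sq r (mat_app s (A x) v))) \<and>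
        (LINT x|m. indicator E x * (real r / C * norm_sq s v - norm_sq r (mat_app s (A x) v))) \<le> 0"
      unfolding right_diff_distrib[of "indicator E _ :: real"] using I1 I2
      by (simp only: Bochner_Integration.integrable_diff Bochner_Integration.integral_diff) simp
  qed (use A_meas in measurable)
  have "AE \<xi> in m. \<forall>v\<in>D. \<xi> \<in> \<Omega> \<longrightarrow> real r / C * norm_sq s v - norm_sq r (mat_app s (A \<xi>) v) \<le> 0"
    unfolding AE_ball_countable[OF D(1)] using ptw by blast
  then have "AE \<xi> in m. \<xi> \<in> \<Omega> \<longrightarrow> s \<le> r"
  proof eventually_elim
    case (elim \<xi>)
    show ?case
    proof
      assume "\<xi> \<in> \<Omega>"
      then have "\<forall>v\<in>D. real r / C * norm_sq s v \<le> norm_sq r (mat_app s (A \<xi>) v)" using elim by auto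
      then have "injective r s (A \<xi>)"
        using \<open>C > 0\<close> r_pos by (intro lower_bound_imp_injective[of "real r / C"] D(2)) auto
      then show "s \<le> r" by (rule injective_imp_le)
    qed
  qed
  then have "\<not> s \<le> r \<Longrightarrow> AE \<xi> in m. \<xi> \<notin> \<Omega>" by (auto elim: eventually_mono)
  with \<Omega>_not_null show ?thesis by blast
qed

lemma riesz_imp_frame:
  assumes R: "riesz_basis m sys (M \<times> {1..s})"
  shows "frame m sys (M \<times> {1..s}) \<and> s = r"
proof
  show fr: "frame m sys (M \<times> {1..s})" by (rule riesz_basis_imp_frame[OF R sys_L2])
  then obtain c where "c > 0" "lower c" unfolding frame_iff by blast
  then have "r \<le> s" by (intro injective_imp_r_le_s lower_imp_injective)
  moreover obtain C where "C > 0" "\<And>F c. finite F \<Longrightarrow> F \<subseteq> M \<times> {1..s} \<Longrightarrow>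
    (\<Sum>i\<in>F. (cmod (c i))\<^sup>2) \<le> C * (l2_norm m (\<lambda>x. \<Sum>i\<in>F. c i * sys i x))\<^sup>2"
    using riesz_basis_stable[OF R sys_L2] by blast
  then have "s \<le> r" by (rule stable_imp_s_le_r)
  ultimately show "s = r" by simp
qed

text \<open>Each \<open>\<psi> i\<close> is restricted to one of the \<open>r\<close> translates of \<open>\<Omega>\<close>. The translates have measure
  \<open>1 / r\<close>, which the factor normalizes.\<close>

definition fiber_basis :: "'i \<times> nat \<Rightarrow> 'x \<Rightarrow> complex" where
  "fiber_basis = (\<lambda>(i, j). lift (\<lambda>k \<xi>. if Suc k = j then complex_of_real (sqrt (real r)) * \<psi> i \<xi> else 0))"

lemma fiber_basis_T:
  "\<xi> \<in> \<Omega> \<Longrightarrow> k < r \<Longrightarrow> fiber_basis (i, j) (T k \<xi>) = (if Suc k = j then complex_of_real (sqrt (real r)) * \<psi> i \<xi> else 0)"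
  unfolding fiber_basis_def by (simp add: lift_T)

lemma L2_indicator: "f \<in> L2 m \<Longrightarrow> (\<lambda>x. indicator \<Omega> x * f x) \<in> L2 m"
  by (rule L2_dominated[of f m _ 1]) (auto simp: indicator_def dest: L2_measurable intro!: borel_measurable_times)

lemma fiber_basis_L2: "i \<in> M \<Longrightarrow> fiber_basis (i, j) \<in> L2 m"
  unfolding fiber_basis_def case_prod_conv
proof (rule lift_L2)
  fix k assume "i \<in> M"
  then show "(\<lambda>x. indicator \<Omega> x * (if Suc k = j then complex_of_real (sqrt (real r)) * \<psi> i x else 0)) \<in> L2 m"
    by (cases "Suc k = j") (auto intro!: L2_indicator L2_cmult \<psi>_L2)
qed

lemma fiber_basis_inner:
  assumes i: "i \<in> M" "i' \<in> M" and j: "j \<in> {1..r}" "j' \<in> {1..r}"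
  shows "l2_inner m (fiber_basis (i, j)) (fiber_basis (i', j')) = (if i = i' \<and> j = j' then 1 else 0)"
proof -
  have "l2_inner m (fiber_basis (i, j)) (fiber_basis (i', j')) =
      (LINT \<xi>:\<Omega>|m. periodize (\<lambda>x. fiber_basis (i, j) x * cnj (fiber_basis (i', j') x)) \<xi>)"
    unfolding l2_inner_def using i by (intro integral_fiber L2_inner_integrable fiber_basis_L2)
  also have "\<dots> = (LINT \<xi>:\<Omega>|m. (if j = j' then of_nat r * (\<psi> i \<xi> * cnj (\<psi> i' \<xi>)) else 0))"
    unfolding set_lebesgue_integral_def
  proof (intro Bochner_Integration.integral_cong refl)
    fix \<xi>
    have "periodize (\<lambda>x. fiber_basis (i, j) x * cnj (fiber_basis (i', j') x)) \<xi> =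
        (if j = j' then of_nat r * (\<psi> i \<xi> * cnj (\<psi> i' \<xi>)) else 0)" if "\<xi> \<in> \<Omega>"
    proof -
      have "periodize (\<lambda>x. fiber_basis (i, j) x * cnj (fiber_basis (i', j') x)) \<xi> =
          (\<Sum>k<r. if k = j - 1 then (if j = j' then of_nat r * (\<psi> i \<xi> * cnj (\<psi> i' \<xi>)) else 0) else 0)"
        unfolding periodize_def
      proof (intro sum.cong refl)
        fix k assume "k \<in> {..<r}"
        have "complex_of_real (sqrt (real r)) * complex_of_real (sqrt (real r)) = of_nat r"
          by (metis of_real_mult of_real_of_nat_eq real_sqrt_mult_self abs_of_nat)
        then have "complex_of_real (sqrt (real r)) * \<psi> i \<xi> * cnj (complex_of_real (sqrt (real r)) * \<psi> i' \<xi>) =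
            of_nat r * (\<psi> i \<xi> * cnj (\<psi> i' \<xi>))"
          by (metis (no_types, lifting) complex_cnj_complex_of_real complex_cnj_mult mult.assoc mult.left_commute)
        then show "fiber_basis (i, j) (T k \<xi>) * cnj (fiber_basis (i', j') (T k \<xi>)) =
            (if k = j - 1 then (if j = j' then of_nat r * (\<psi> i \<xi> * cnj (\<psi> i' \<xi>)) else 0) else 0)"
          using j \<open>k \<in> {..<r}\<close> that by (auto simp: fiber_basis_T)
      qed
      also have "\<dots> = (if j = j' then of_nat r * (\<psi> i \<xi> * cnj (\<psi> i' \<xi>)) else 0)"
        using j by (subst sum.delta) auto
      finally show ?thesis .
    qed
    then show "indicator \<Omega> \<xi> *\<^sub>R periodize (\<lambda>x. fiber_basis (i, j) x * cnj (fiber_basis (i', j') x)) \<xi> =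
        indicator \<Omega> \<xi> *\<^sub>R (if j = j' then of_nat r * (\<psi> i \<xi> * cnj (\<psi> i' \<xi>)) else 0)"
      by (auto simp: indicator_def)
  qed
  also have "\<dots> = (if j = j' then l2_inner m (\<psi> i) (\<psi> i') else 0)"
  proof -
    have "integrable m (\<lambda>x. \<psi> i x * cnj (\<psi> i' x))" using i by (intro L2_inner_integrable \<psi>_L2)
    moreover have "periodic (\<lambda>x. \<psi> i x * cnj (\<psi> i' x))"
      using \<psi>_periodic[OF i(1)] \<psi>_periodic[OF i(2)] by (simp add: periodic_def)
    ultimately have "l2_inner m (\<psi> i) (\<psi> i') = real r *\<^sub>R (LINT \<xi>:\<Omega>|m. \<psi> i \<xi> * cnj (\<psi> i' \<xi>))"
      unfolding l2_inner_def by (rule integral_periodic)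
    then show ?thesis by (simp add: scaleR_conv_of_real)
  qed
  also have "\<dots> = (if i = i' \<and> j = j' then 1 else 0)"
    using \<psi>_orthonormal i by (auto simp: orthonormal_def)
  finally show ?thesis .
qed

text \<open>The part of \<open>f\<close> on one translate of \<open>\<Omega>\<close> is continued to a periodic function, expanded in the
  \<open>\<psi> i\<close>, and cut down to the translate again.\<close>

lemma fiber_basis_complete:
  assumes f: "f \<in> L2 m"
  shows "f \<in> closed_span m fiber_basis (M \<times> {1..r})"
proof -
  have bL: "fiber_basis p \<in> L2 m" if "p \<in> M \<times> {1..r}" for p using that fiber_basis_L2 by auto
  define g where "g j = lift (\<lambda>k \<xi>. if k = j then f (T k \<xi>) else 0)" for j
  have g_L2: "g j \<in> L2 m" if "j < r" for j
    unfolding g_def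
  proof (rule lift_L2)
    fix k assume "k < r"
    then show "(\<lambda>x. indicator \<Omega> x * (if k = j then f (T k x) else 0)) \<in> L2 m"
      by (cases "k = j") (auto intro!: L2_indicator L2_T f)
  qed
  have "g j \<in> closed_span m fiber_basis (M \<times> {1..r})" if j: "j < r" for j
  proof (rule closed_spanI[OF g_L2[OF j]])
    fix \<epsilon> :: real assume "\<epsilon> > 0"
    \<comment> \<open>The periodic function that agrees on \<open>\<Omega>\<close> with the part of \<open>f\<close> on the translate of index \<open>j\<close>.\<close>
    define q where "q = periodize (\<lambda>x. indicator \<Omega> x * f (T j x))"
    have q_L2: "q \<in> L2 m" unfolding q_def by (intro L2_periodize L2_indicator L2_T j f)
    have q: "q \<xi> = f (T j \<xi>)" if "\<xi> \<in> \<Omega>" for \<xi>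
      using periodize_T_supported[of "\<lambda>x. indicator \<Omega> x * f (T j x)" \<xi> 0] that r_pos T_0[OF \<Omega>_space[OF that]]
      by (simp add: q_def)
    obtain F c where F: "finite F" "F \<subseteq> M" "l2_norm m (\<lambda>x. q x - (\<Sum>i\<in>F. c i * \<psi> i x)) < \<epsilon>"
      using periodic_in_closed_span[OF q_L2] \<open>\<epsilon> > 0\<close> unfolding closed_span_def q_def
      by (auto simp: periodic_periodize)
    define h where "h x = q x - (\<Sum>i\<in>F. c i * \<psi> i x)" for x
    have h_L2: "h \<in> L2 m" unfolding h_def using F(2) \<psi>_L2 by (intro L2_diff q_L2 L2_lincomb) auto
    define d where "d = (\<lambda>(i, j' :: nat). c i / complex_of_real (sqrt (real r)))"
    have d: "(\<Sum>p\<in>F \<times> {Suc j}. d p * fiber_basis p x) = (\<Sum>i\<in>F. d (i, Suc j) * fiber_basis (i, Suc j) x)" for x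
      unfolding sum.cartesian_product' by simp
    define H where "H = lift (\<lambda>k \<xi>. if k = j then h \<xi> else 0)"
    have le: "AE \<xi> in m. \<xi> \<in> \<Omega> \<longrightarrow> norm_sq r (\<lambda>k. if k = j then h \<xi> else 0) \<le> 1 * norm_sq r (\<lambda>k. h (T k \<xi>))"
    proof (intro AE_I2 impI)
      fix \<xi> assume \<xi>: "\<xi> \<in> \<Omega>"
      have "norm_sq r (\<lambda>k. if k = j then h \<xi> else 0) = (\<Sum>k<r. if k = j then (cmod (h \<xi>))\<^sup>2 else 0)"
        unfolding norm_sq_def by (intro sum.cong) auto
      also have "\<dots> = (cmod (h (T 0 \<xi>)))\<^sup>2" using j T_0[OF \<Omega>_space[OF \<xi>]] by simp
      also have "\<dots> \<le> norm_sq r (\<lambda>k. h (T k \<xi>))"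
        unfolding norm_sq_def using r_pos
        by (intro member_le_sum[of 0 "{..<r}" "\<lambda>k. (cmod (h (T k \<xi>)))\<^sup>2"]) auto
      finally show "norm_sq r (\<lambda>k. if k = j then h \<xi> else 0) \<le> 1 * norm_sq r (\<lambda>k. h (T k \<xi>))" by simp
    qed
    have meas: "(\<lambda>\<xi>. if k = j then h \<xi> else 0) \<in> borel_measurable m" for k
      using L2_measurable[OF h_L2] by (cases "k = j") auto
    have "g j x - (\<Sum>p\<in>F \<times> {Suc j}. d p * fiber_basis p x) = H x" if "x \<in> space m" for x
    proof -
      obtain \<xi> k where \<xi>: "\<xi> \<in> \<Omega>" "k < r" "x = T k \<xi>" using fiber_point[OF \<open>x \<in> space m\<close>] .
      have "(\<Sum>i\<in>F. d (i, Suc j) * fiber_basis (i, Suc j) (T k \<xi>)) = (if k = j then (\<Sum>i\<in>F. c i * \<psi> i \<xi>) else 0)"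
        unfolding fiber_basis_T[OF \<xi>(1,2)] d_def using r_pos by (auto intro!: sum.cong)
      then show ?thesis
        unfolding d \<xi>(3) g_def H_def lift_T[OF \<xi>(1,2)] using q[OF \<xi>(1)] by (simp add: h_def)
    qed
    then have "l2_norm m (\<lambda>x. g j x - (\<Sum>p\<in>F \<times> {Suc j}. d p * fiber_basis p x)) = l2_norm m H"
      unfolding l2_norm_def by (intro arg_cong[where f = sqrt] Bochner_Integration.integral_cong) auto
    also have "\<dots> \<le> l2_norm m h"
      using lift_L2_bound(2)[OF meas h_L2 le] unfolding H_def by (auto intro: power2_le_imp_le)
    also have "\<dots> < \<epsilon>" using F(3) by (simp add: h_def[abs_def])
    finally show "\<exists>F c. finite F \<and> F \<subseteq> M \<times> {1..r} \<and>
        l2_norm m (\<lambda>x. g j x - (\<Sum>i\<in>F. c i * fiber_basis i x)) < \<epsilon>"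
      using F(1,2) j by (intro exI[of _ "F \<times> {Suc j}"] exI[of _ d]) auto
  qed
  then have sum: "(\<lambda>x. \<Sum>j<r. g j x) \<in> closed_span m fiber_basis (M \<times> {1..r})"
    by (intro closed_span_sum bL) auto
  have "f x = (\<Sum>j<r. g j x)" if "x \<in> space m" for x
  proof -
    obtain \<xi> k where \<xi>: "\<xi> \<in> \<Omega>" "k < r" "x = T k \<xi>" using fiber_point[OF \<open>x \<in> space m\<close>] .
    show ?thesis unfolding \<xi>(3) g_def lift_T[OF \<xi>(1,2)] using \<xi>(2) by simp
  qed
  then have "l2_norm m (\<lambda>x. f x - (\<Sum>j<r. g j x)) = 0"
    unfolding l2_norm_def by (simp cong: Bochner_Integration.integral_cong)
  then show ?thesis
    using sum by (intro closed_span_closed[OF bL f]) (auto intro!: bexI[of _ "\<lambda>x. \<Sum>j<r. g j x"])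
qed

lemma fiber_basis_orthonormal_basis: "orthonormal_basis m fiber_basis (M \<times> {1..r})"
  unfolding orthonormal_basis_def complete_system_iff
  using fiber_basis_L2 fiber_basis_inner fiber_basis_complete by auto

text \<open>The operator \<open>U\<close> applies \<open>a\<^sup>*\<close>, divided by the square root of \<open>r\<close>, to the fibers, and \<open>V\<close>
  applies the inverse, which for a square matrix is \<open>solve\<close>. The fiber of a member of the
  orthonormal basis is a multiple of a unit vector, so \<open>U\<close> maps it to a column of \<open>a\<^sup>*\<close>, which is
  a fiber of the system. The two bounds of the frame make \<open>U\<close> and \<open>V\<close> bounded.\<close>

lemma frame_imp_riesz:
  assumes fr: "frame m sys (M \<times> {1..s})" and sr: "s = r"
  shows "riesz_basis m sys (M \<times> {1..s})"
proof -
  obtain C c where C: "C > 0" "upper C" and c: "c > 0" "lower c"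
    using fr unfolding frame_iff by blast
  note inj = lower_imp_injective[OF c]
  define R where "R = complex_of_real (sqrt (real r))"
  have R: "R \<noteq> 0" using r_pos by (simp add: R_def)
  have R_norm: "(cmod R)\<^sup>2 = real r" by (simp add: R_def)
  define pU where "pU f k \<xi> = (1 / R) * mat_app r (conj_transpose (fib \<xi>)) (fiber f \<xi>) k" for f k \<xi>
  define pV where "pV f j \<xi> = R * solve r r (fib \<xi>) (fiber f \<xi>) j" for f j \<xi>
  define U where "U f = lift (pU f)" for f
  define V where "V f = lift (pV f)" for f
  have fib_f: "(\<lambda>x. f (T k x)) \<in> borel_measurable m" if "f \<in> L2 m" "k < r" for f k
    using measurable_T[OF that(2) L2_measurable[OF that(1)]] .
  have adj_meas: "(\<lambda>\<xi>. conj_transpose (fib \<xi>) k j) \<in> borel_measurable m" if "j < r" "k < r" for j k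
    unfolding conj_transpose_def using measurable_compose[OF fib_measurable cnj_measurable] that sr by simp
  have pU_meas: "pU f k \<in> borel_measurable m" if "f \<in> L2 m" "k < r" for f k
    unfolding pU_def mat_app_def using fib_f[OF that(1)] adj_meas that(2)
    by (intro borel_measurable_times borel_measurable_const borel_measurable_sum) auto
  have pV_meas: "pV f k \<in> borel_measurable m" if "f \<in> L2 m" "k < r" for f k
    unfolding pV_def using fib_f[OF that(1)] fib_measurable that(2) sr
    by (intro borel_measurable_times borel_measurable_const measurable_solve) auto
  have pU_le: "AE \<xi> in m. \<xi> \<in> \<Omega> \<longrightarrow> norm_sq r (\<lambda>k. pU f k \<xi>) \<le> C * norm_sq r (fiber f \<xi>)" for f
    using upper_entries[OF C(2)]
  proof eventually_elim
    case (elim \<xi>)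
    show ?case
    proof
      assume \<xi>: "\<xi> \<in> \<Omega>"
      have "norm_sq r (\<lambda>k. pU f k \<xi>) = (1 / real r) * norm_sq r (mat_app r (conj_transpose (fib \<xi>)) (fiber f \<xi>))"
        unfolding pU_def norm_sq_scale by (simp add: norm_divide power_divide R_norm)
      also have "\<dots> \<le> (1 / real r) * ((\<Sum>k<r. \<Sum>j<r. (cmod (conj_transpose (fib \<xi>) k j))\<^sup>2) * norm_sq r (fiber f \<xi>))"
        by (intro mult_left_mono norm_sq_mat_app_le) simp
      also have "\<dots> \<le> (1 / real r) * ((real r * C) * norm_sq r (fiber f \<xi>))"
        using elim \<xi> sr by (intro mult_left_mono mult_right_mono norm_sq_nonneg) (subst sum.swap, auto)
      finally show "norm_sq r (\<lambda>k. pU f k \<xi>) \<le> C * norm_sq r (fiber f \<xi>)" using r_pos by simp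
    qed
  qed
  have pV_le: "AE \<xi> in m. \<xi> \<in> \<Omega> \<longrightarrow> norm_sq r (\<lambda>k. pV f k \<xi>) \<le> (real r / c) * norm_sq r (fiber f \<xi>)" for f
    using c(2) unfolding lower_def
  proof eventually_elim
    case (elim \<xi>)
    show ?case
    proof
      assume \<xi>: "\<xi> \<in> \<Omega>"
      have "norm_sq r (\<lambda>k. pV f k \<xi>) = real r * norm_sq r (solve r r (fib \<xi>) (fiber f \<xi>))"
        unfolding pV_def norm_sq_scale R_norm ..
      also have "\<dots> \<le> real r * (norm_sq r (fiber f \<xi>) / c)"
        using elim \<xi> sr by (intro mult_left_mono norm_sq_solve_le c(1)) auto
      finally show "norm_sq r (\<lambda>k. pV f k \<xi>) \<le> (real r / c) * norm_sq r (fiber f \<xi>)" by simp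
    qed
  qed
  have U_L2: "U f \<in> L2 m" and U_norm: "(l2_norm m (U f))\<^sup>2 \<le> C * (l2_norm m f)\<^sup>2" if "f \<in> L2 m" for f
    unfolding U_def using C(1) lift_L2_bound[OF pU_meas[OF that] that pU_le] by auto
  have V_L2: "V f \<in> L2 m" and V_norm: "(l2_norm m (V f))\<^sup>2 \<le> (real r / c) * (l2_norm m f)\<^sup>2" if "f \<in> L2 m" for f
    unfolding V_def using c(1) lift_L2_bound[OF pV_meas[OF that] that pV_le] by auto
  have bound: "l2_norm m g \<le> sqrt K * l2_norm m f" if "(l2_norm m g)\<^sup>2 \<le> K * (l2_norm m f)\<^sup>2" for f g K
    using real_sqrt_le_mono[OF that] by (simp add: real_sqrt_mult)
  have U_lin: "U (\<lambda>y. a * f y + b * g y) x = a * U f x + b * U g x" for a b f g x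
    unfolding U_def lift_linear[symmetric]
    by (intro arg_cong[where f = "\<lambda>p. lift p x"] ext) (simp add: pU_def mat_app_add mat_app_scale ring_distribs)
  have V_lin: "V (\<lambda>y. a * f y + b * g y) x = a * V f x + b * V g x" for a b f g x
    unfolding V_def lift_linear[symmetric]
    by (intro arg_cong[where f = "\<lambda>p. lift p x"] ext) (simp add: pV_def solve_linear ring_distribs)
  have "l2_bounded_operator m U"
    unfolding l2_bounded_operator_def using U_L2 U_lin bound[OF U_norm] by (intro conjI exI[of _ "sqrt C"]) auto
  moreover have "l2_bounded_operator m V"
    unfolding l2_bounded_operator_def using V_L2 V_lin bound[OF V_norm] by (intro conjI exI[of _ "sqrt (real r / c)"]) auto
  moreover have "AE x in m. V (U f) x = f x" for f
  proof (rule AE_fiberI, use inj in eventually_elim, intro impI allI)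
    fix \<xi> k assume "\<xi> \<in> \<Omega> \<longrightarrow> injective s r (fib \<xi>)" and \<xi>: "\<xi> \<in> \<Omega>" and k: "k < r"
    then have i: "injective r r (fib \<xi>)" using sr by simp
    have "solve r r (fib \<xi>) (fiber (U f) \<xi>) = solve r r (fib \<xi>) (\<lambda>k. pU f k \<xi>)"
      unfolding U_def by (intro solve_cong lift_T[OF \<xi>])
    then have "V (U f) (T k \<xi>) = R * solve r r (fib \<xi>) (\<lambda>k. pU f k \<xi>) k"
      unfolding V_def lift_T[OF \<xi> k] pV_def by simp
    also have "\<dots> = solve r r (fib \<xi>) (mat_app r (conj_transpose (fib \<xi>)) (fiber f \<xi>)) k"
      using solve_linear[of r r "fib \<xi>" "1 / R" "mat_app r (conj_transpose (fib \<xi>)) (fiber f \<xi>)" 0 "\<lambda>_. 0" k] R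
      by (simp add: pU_def)
    also have "\<dots> = f (T k \<xi>)" by (rule solve_conj_transpose[OF i k])
    finally show "V (U f) (T k \<xi>) = f (T k \<xi>)" .
  qed
  moreover have "AE x in m. U (V f) x = f x" for f
  proof (rule AE_fiberI, use inj in eventually_elim, intro impI allI)
    fix \<xi> k assume "\<xi> \<in> \<Omega> \<longrightarrow> injective s r (fib \<xi>)" and \<xi>: "\<xi> \<in> \<Omega>" and k: "k < r"
    then have i: "injective r r (fib \<xi>)" using sr by simp
    have "mat_app r (conj_transpose (fib \<xi>)) (fiber (V f) \<xi>) = mat_app r (conj_transpose (fib \<xi>)) (\<lambda>k. pV f k \<xi>)"
      unfolding V_def by (intro mat_app_cong lift_T[OF \<xi>])
    then have "U (V f) (T k \<xi>) = (1 / R) * mat_app r (conj_transpose (fib \<xi>)) (\<lambda>k. pV f k \<xi>) k"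
      unfolding U_def lift_T[OF \<xi> k] pU_def by simp
    also have "\<dots> = mat_app r (conj_transpose (fib \<xi>)) (solve r r (fib \<xi>) (fiber f \<xi>)) k"
      unfolding pV_def mat_app_scale using R by simp
    also have "\<dots> = f (T k \<xi>)" by (rule solve_eq[OF i k])
    finally show "U (V f) (T k \<xi>) = f (T k \<xi>)" .
  qed
  moreover have "AE x in m. U (fiber_basis p) x = sys p x" if p: "p \<in> M \<times> {1..r}" for p
  proof (intro AE_I2)
    fix x assume x: "x \<in> space m"
    obtain i j where ij: "p = (i, Suc j)" "i \<in> M" "j < r"
      using p by (cases p; cases "snd p") auto
    obtain \<xi> k where \<xi>: "\<xi> \<in> \<Omega>" "k < r" "x = T k \<xi>" using fiber_point[OF x] .
    have "mat_app r (conj_transpose (fib \<xi>)) (fiber (fiber_basis p) \<xi>) k = (\<Sum>l<r. if l = j then conj_transpose (fib \<xi>) k l * (R * \<psi> i \<xi>) else 0)"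
      unfolding mat_app_def using fiber_basis_T[OF \<xi>(1)] by (intro sum.cong) (auto simp: ij(1) R_def)
    also have "\<dots> = conj_transpose (fib \<xi>) k j * (R * \<psi> i \<xi>)" using ij(3) by simp
    finally have "U (fiber_basis p) x = conj_transpose (fib \<xi>) k j * \<psi> i \<xi>"
      unfolding U_def \<xi>(3) lift_T[OF \<xi>(1,2)] pU_def using R by simp
    also have "\<dots> = sys p x"
      unfolding \<xi>(3) ij(1) using sys_T[OF ij(2) \<xi>(2) \<Omega>_space[OF \<xi>(1)]] by (simp add: conj_transpose_def fib_def)
    finally show "U (fiber_basis p) x = sys p x" .
  qed
  ultimately show ?thesis
    unfolding riesz_basis_def sr using fiber_basis_orthonormal_basis
    by (intro exI[of _ fiber_basis] exI[of _ U] exI[of _ V]) auto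
qed

end

section \<open>Extremal eigenvalues and optimal bounds\<close>

context fiberization
begin

definition fib_mat :: "'x \<Rightarrow> complex mat" where
  "fib_mat \<xi> = mat s r (\<lambda>(j, k). fib \<xi> j k)"

abbreviation "lmax \<xi> \<equiv> lambda_max (mat_adjoint (fib_mat \<xi>) * fib_mat \<xi>)"
abbreviation "lmin \<xi> \<equiv> lambda_min (mat_adjoint (fib_mat \<xi>) * fib_mat \<xi>)"

lemma lmax_le_iff: "lmax \<xi> \<le> x \<longleftrightarrow> (\<forall>v. norm_sq s (mat_app r (fib \<xi>) v) \<le> x * norm_sq r v)"
  unfolding fib_mat_def by (rule lambda_max_le_iff[OF r_pos])

lemma le_lmin_iff: "x \<le> lmin \<xi> \<longleftrightarrow> (\<forall>v. x * norm_sq r v \<le> norm_sq s (mat_app r (fib \<xi>) v))"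
  unfolding fib_mat_def by (rule le_lambda_min_iff[OF r_pos])

text \<open>The sublevel sets are described by the inequalities for a countable dense set of vectors.\<close>

lemma lmax_measurable: "(\<lambda>\<xi>. lmax \<xi>) \<in> borel_measurable m"
  and lmin_measurable: "(\<lambda>\<xi>. lmin \<xi>) \<in> borel_measurable m"
proof -
  obtain D :: "(nat \<Rightarrow> complex) set" where D: "countable D"
    "\<And>s a x w. \<forall>v\<in>D. norm_sq s (mat_app r a v) \<le> x * norm_sq r v \<Longrightarrow>
       norm_sq s (mat_app r a w) \<le> x * norm_sq r w"
    "\<And>s a x w. \<forall>v\<in>D. x * norm_sq r v \<le> norm_sq s (mat_app r a v) \<Longrightarrow>
       x * norm_sq r w \<le> norm_sq s (mat_app r a w)"
    by (rule countable_dense_test_vectors[where n = r]) blast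
  note [measurable] = norm_sq_const_measurable
  show "(\<lambda>\<xi>. lmax \<xi>) \<in> borel_measurable m"
    unfolding borel_measurable_iff_le
  proof
    fix x
    have "{\<xi> \<in> space m. lmax \<xi> \<le> x} = {\<xi> \<in> space m. \<forall>v\<in>D. norm_sq s (mat_app r (fib \<xi>) v) \<le> x * norm_sq r v}"
      unfolding lmax_le_iff using D(2) by blast
    also have "\<dots> \<in> sets m"
      by (intro sets.sets_Collect_countable_All'[OF _ D(1)]) measurable
    finally show "{\<xi> \<in> space m. lmax \<xi> \<le> x} \<in> sets m" .
  qed
  show "(\<lambda>\<xi>. lmin \<xi>) \<in> borel_measurable m"
    unfolding borel_measurable_iff_ge
  proof
    fix x
    have "{\<xi> \<in> space m. x \<le> lmin \<xi>} = {\<xi> \<in> space m. \<forall>v\<in>D. x * norm_sq r v \<le> norm_sq s (mat_app r (fib \<xi>) v)}"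
      unfolding le_lmin_iff using D(3) by blast
    also have "\<dots> \<in> sets m"
      by (intro sets.sets_Collect_countable_All'[OF _ D(1)]) measurable
    finally show "{\<xi> \<in> space m. x \<le> lmin \<xi>} \<in> sets m" .
  qed
qed

lemma AE_\<Omega>_iff: "(AE \<xi> in restrict_space m \<Omega>. P \<xi>) \<longleftrightarrow> (AE \<xi> in m. \<xi> \<in> \<Omega> \<longrightarrow> P \<xi>)"
  by (rule AE_restrict_space_iff) simp

lemma beta_le_iff: "beta_const m \<Omega> fib_mat \<le> ereal C \<longleftrightarrow> upper C"
proof -
  have meas: "(\<lambda>\<xi>. ereal (lmax \<xi>)) \<in> borel_measurable (restrict_space m \<Omega>)"
    by (intro borel_measurable_ereal measurable_restrict_space1 lmax_measurable)
  have "beta_const m \<Omega> fib_mat \<le> ereal C \<longleftrightarrow> (AE \<xi> in restrict_space m \<Omega>. ereal (lmax \<xi>) \<le> ereal C)"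
  proof
    assume *: "beta_const m \<Omega> fib_mat \<le> ereal C"
    from esssup_AE[of "\<lambda>\<xi>. ereal (lmax \<xi>)" "restrict_space m \<Omega>"]
    show "AE \<xi> in restrict_space m \<Omega>. ereal (lmax \<xi>) \<le> ereal C"
      by (rule eventually_mono) (rule order_trans[OF _ *[unfolded beta_const_def]])
  next
    assume "AE \<xi> in restrict_space m \<Omega>. ereal (lmax \<xi>) \<le> ereal C"
    then show "beta_const m \<Omega> fib_mat \<le> ereal C"
      unfolding beta_const_def by (intro esssup_I meas)
  qed
  also have "\<dots> \<longleftrightarrow> upper C"
    unfolding AE_\<Omega>_iff upper_def ereal_less_eq lmax_le_iff ..
  finally show ?thesis .
qed

lemma le_alpha_iff: "ereal C \<le> alpha_const m \<Omega> fib_mat \<longleftrightarrow> lower C"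
proof -
  define E where "E = esssup (restrict_space m \<Omega>) (\<lambda>\<xi>. - ereal (lmin \<xi>))"
  have meas: "(\<lambda>\<xi>. - ereal (lmin \<xi>)) \<in> borel_measurable (restrict_space m \<Omega>)"
    by (intro borel_measurable_uminus_ereal borel_measurable_ereal measurable_restrict_space1 lmin_measurable)
  have alpha: "alpha_const m \<Omega> fib_mat = - E"
    by (simp add: alpha_const_def essinf_def E_def)
  have "ereal C \<le> - E \<longleftrightarrow> E \<le> - ereal C" by (metis ereal_minus_le_minus ereal_uminus_uminus)
  also have "\<dots> \<longleftrightarrow> (AE \<xi> in restrict_space m \<Omega>. - ereal (lmin \<xi>) \<le> - ereal C)"
  proof
    assume *: "E \<le> - ereal C"
    from esssup_AE[of "\<lambda>\<xi>. - ereal (lmin \<xi>)" "restrict_space m \<Omega>"]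
    show "AE \<xi> in restrict_space m \<Omega>. - ereal (lmin \<xi>) \<le> - ereal C"
      by (rule eventually_mono) (rule order_trans[OF _ *[unfolded E_def]])
  next
    assume "AE \<xi> in restrict_space m \<Omega>. - ereal (lmin \<xi>) \<le> - ereal C"
    then show "E \<le> - ereal C" unfolding E_def by (intro esssup_I meas)
  qed
  also have "\<dots> \<longleftrightarrow> lower C"
    unfolding AE_\<Omega>_iff lower_def ereal_minus_le_minus ereal_less_eq le_lmin_iff ..
  finally show ?thesis unfolding alpha .
qed

lemma upper_nonneg:
  assumes "upper C"
  shows "0 \<le> C"
proof (rule ccontr)
  assume "\<not> 0 \<le> C"
  have "AE \<xi> in m. \<xi> \<notin> \<Omega>"
    using assms unfolding upper_def
  proof eventually_elim
    case (elim \<xi>)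
    show ?case
    proof
      assume "\<xi> \<in> \<Omega>"
      then have "norm_sq s (mat_app r (fib \<xi>) (\<lambda>_. 1)) \<le> C * norm_sq r (\<lambda>_. 1)" using elim by blast
      moreover have "norm_sq r (\<lambda>_. 1) = real r" by (simp add: norm_sq_def)
      ultimately have "0 \<le> C * real r" using norm_sq_nonneg order_trans by metis
      with \<open>\<not> 0 \<le> C\<close> r_pos show False by (simp add: zero_le_mult_iff)
    qed
  qed
  with \<Omega>_not_null show False by blast
qed

lemma lower_le_upper:
  assumes "lower c" "upper C"
  shows "c \<le> C"
proof (rule ccontr)
  assume "\<not> c \<le> C"
  have "AE \<xi> in m. \<xi> \<notin> \<Omega>"
    using assms unfolding lower_def upper_def
  proof eventually_elim
    case (elim \<xi>)
    show ?case
    proof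
      assume "\<xi> \<in> \<Omega>"
      then have "c * norm_sq r (\<lambda>_. 1) \<le> C * norm_sq r (\<lambda>_. 1)" using elim order_trans by blast
      moreover have "norm_sq r (\<lambda>_. 1) = real r" by (simp add: norm_sq_def)
      ultimately show False using \<open>\<not> c \<le> C\<close> r_pos by simp
    qed
  qed
  with \<Omega>_not_null show False by blast
qed

lemma upper_mono: "upper C \<Longrightarrow> C \<le> C' \<Longrightarrow> upper C'"
  unfolding beta_le_iff[symmetric] by (meson ereal_less_eq(3) order_trans)

lemma bessel_imp_beta:
  assumes "bessel_sequence m sys (M \<times> {1..s})"
  obtains b where "0 \<le> b" "beta_const m \<Omega> fib_mat = ereal b" "upper b"
proof -
  obtain C where C: "upper C" using assms unfolding bessel_sequence_iff by blast
  have "\<not> beta_const m \<Omega> fib_mat \<le> ereal (-1)" unfolding beta_le_iff using upper_nonneg by force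
  then obtain b where b: "beta_const m \<Omega> fib_mat = ereal b"
    using C unfolding beta_le_iff[symmetric] by (cases "beta_const m \<Omega> fib_mat") auto
  then have "upper b" unfolding beta_le_iff[symmetric] by simp
  then show thesis using b upper_nonneg that by blast
qed

lemma bessel_iff_beta: "bessel_sequence m sys (M \<times> {1..s}) \<longleftrightarrow> beta_const m \<Omega> fib_mat < \<infinity>"
proof
  assume "bessel_sequence m sys (M \<times> {1..s})"
  then show "beta_const m \<Omega> fib_mat < \<infinity>" by (elim bessel_imp_beta) simp
next
  assume "beta_const m \<Omega> fib_mat < \<infinity>"
  then obtain C where "beta_const m \<Omega> fib_mat \<le> ereal C"
    by (cases "beta_const m \<Omega> fib_mat") auto
  then have "upper (max C 1)" unfolding beta_le_iff by (rule upper_mono) simp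
  then show "bessel_sequence m sys (M \<times> {1..s})"
    unfolding bessel_sequence_iff by (intro exI[of _ "max C 1"]) auto
qed

text \<open>The Bessel bounds are the positive numbers from \<open>b / real r\<close> on, where \<open>b\<close> is the essential
  supremum of the largest eigenvalue. If \<open>b = 0\<close>, then the infimum is not attained.\<close>

lemma optimal_upper_bound_eq:
  assumes "bessel_sequence m sys (M \<times> {1..s})"
  shows "ereal (optimal_upper_bound m sys (M \<times> {1..s})) = beta_const m \<Omega> fib_mat / ereal (real r)"
proof -
  obtain b where b: "0 \<le> b" "beta_const m \<Omega> fib_mat = ereal b" using bessel_imp_beta[OF assms] by blast
  have "{B. bessel_bound m sys (M \<times> {1..s}) B} = {B. 0 < B \<and> b \<le> real r * B}"
  proof (intro Collect_cong)
    fix B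
    have "bessel_bound m sys (M \<times> {1..s}) B \<Longrightarrow> 0 < B" by (simp add: bessel_bound_def)
    then show "bessel_bound m sys (M \<times> {1..s}) B \<longleftrightarrow> 0 < B \<and> b \<le> real r * B"
      using bessel_bound_iff[of B] beta_le_iff[of "real r * B"] unfolding b(2) by auto
  qed
  moreover have "Inf {B. 0 < B \<and> b \<le> real r * B} = b / real r"
  proof (rule cInf_eq_non_empty)
    have "0 < b / real r + 1 \<and> b \<le> real r * (b / real r + 1)"
      using b(1) r_pos by (simp add: field_simps add_nonneg_pos)
    then show "{B. 0 < B \<and> b \<le> real r * B} \<noteq> {}" by blast
    show "b / real r \<le> B" if "B \<in> {B. 0 < B \<and> b \<le> real r * B}" for B
      using that r_pos by (simp add: field_simps)
    fix y assume y: "\<And>B. B \<in> {B. 0 < B \<and> b \<le> real r * B} \<Longrightarrow> y \<le> B"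
    show "y \<le> b / real r"
    proof (rule field_le_epsilon)
      fix \<epsilon> :: real assume "\<epsilon> > 0"
      then show "y \<le> b / real r + \<epsilon>" using b(1) r_pos by (intro y) (simp add: field_simps add_nonneg_pos)
    qed
  qed
  ultimately show ?thesis using r_pos by (simp add: optimal_upper_bound_def b(2))
qed

lemma frame_iff_alpha_beta:
  "frame m sys (M \<times> {1..s}) \<longleftrightarrow> 0 < alpha_const m \<Omega> fib_mat \<and>
     alpha_const m \<Omega> fib_mat \<le> beta_const m \<Omega> fib_mat \<and> beta_const m \<Omega> fib_mat < \<infinity>"
proof -
  have pos: "(\<exists>c>0. lower c) \<longleftrightarrow> 0 < alpha_const m \<Omega> fib_mat"
  proof
    assume "\<exists>c>0. lower c"
    then obtain c where "c > 0" "ereal c \<le> alpha_const m \<Omega> fib_mat" unfolding le_alpha_iff by blast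
    then show "0 < alpha_const m \<Omega> fib_mat" by (metis ereal_less(2) order_less_le_trans)
  next
    assume "0 < alpha_const m \<Omega> fib_mat"
    then obtain c where "0 < ereal c" "ereal c < alpha_const m \<Omega> fib_mat" using ereal_dense2 by blast
    then show "\<exists>c>0. lower c" unfolding le_alpha_iff[symmetric] by (auto intro: less_imp_le)
  qed
  have le: "alpha_const m \<Omega> fib_mat \<le> beta_const m \<Omega> fib_mat"
  proof (rule ccontr)
    assume "\<not> ?thesis"
    then have "beta_const m \<Omega> fib_mat < alpha_const m \<Omega> fib_mat" by simp
    then obtain x where x: "beta_const m \<Omega> fib_mat < ereal x" "ereal x < alpha_const m \<Omega> fib_mat"
      using ereal_dense2 by blast
    obtain y where y: "ereal x < ereal y" "ereal y < alpha_const m \<Omega> fib_mat" using ereal_dense2[OF x(2)] by blast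
    have "upper x" "lower y" using x(1) y(2) by (simp_all flip: beta_le_iff le_alpha_iff)
    then show False using lower_le_upper y(1) by force
  qed
  show ?thesis
    unfolding frame_iff pos[symmetric] bessel_sequence_iff[symmetric] bessel_iff_beta using le by blast
qed

lemma optimal_lower_bound_eq:
  assumes "frame m sys (M \<times> {1..s})"
  shows "ereal (optimal_lower_bound m sys (M \<times> {1..s})) = alpha_const m \<Omega> fib_mat / ereal (real r)"
proof -
  obtain C where C: "upper C" using assms unfolding frame_iff by blast
  have "0 < alpha_const m \<Omega> fib_mat" "alpha_const m \<Omega> fib_mat < \<infinity>"
    using assms unfolding frame_iff_alpha_beta by auto
  then obtain a where a: "0 < a" "alpha_const m \<Omega> fib_mat = ereal a"
    by (cases "alpha_const m \<Omega> fib_mat") auto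
  have "{A. lower_frame_bound m sys (M \<times> {1..s}) A} = {A. 0 < A \<and> real r * A \<le> a}"
  proof (intro Collect_cong)
    fix A
    have "lower_frame_bound m sys (M \<times> {1..s}) A \<Longrightarrow> 0 < A" by (simp add: lower_frame_bound_def)
    then show "lower_frame_bound m sys (M \<times> {1..s}) A \<longleftrightarrow> 0 < A \<and> real r * A \<le> a"
      using lower_frame_bound_iff[OF _ C, of A] le_alpha_iff[of "real r * A"] unfolding a(2) by auto
  qed
  moreover have "Sup {A. 0 < A \<and> real r * A \<le> a} = a / real r"
    by (rule cSup_eq_maximum) (use a(1) r_pos in \<open>auto simp: field_simps\<close>)
  ultimately show ?thesis using r_pos by (simp add: optimal_lower_bound_def a(2))
qed

lemma complete_iff_rank:
  "complete_system m sys (M \<times> {1..s}) \<longleftrightarrow> (AE \<xi> in restrict_space m \<Omega>. matrix_rank (fib_mat \<xi>) = r)"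
  unfolding fib_mat_def matrix_rank_eq_iff_injective AE_\<Omega>_iff
  using complete_imp_injective injective_imp_complete by blast

end

section \<open>Characters separate points from subgroups\<close>

definition nat_mult :: "nat \<Rightarrow> 'g::ab_group_add \<Rightarrow> 'g" where
  "nat_mult n y = (\<Sum>i<n. y)"

definition int_mult :: "int \<Rightarrow> 'g::ab_group_add \<Rightarrow> 'g" where
  "int_mult i y = nat_mult (nat i) y - nat_mult (nat (- i)) y"

lemma nat_mult_simps [simp]: "nat_mult 0 y = 0" "nat_mult (Suc n) y = y + nat_mult n y"
  by (simp_all add: nat_mult_def add.commute)

lemma nat_mult_add: "nat_mult (m + n) y = nat_mult m y + nat_mult n y"
  by (induction m) (simp_all add: add.assoc)

lemma int_mult_diff: "int_mult (int m - int n) y = nat_mult m y - nat_mult n y"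
proof (cases "n \<le> m")
  case True
  then obtain k where "m = n + k" using le_Suc_ex by blast
  then show ?thesis by (simp add: int_mult_def nat_mult_add)
next
  case False
  then obtain k where "n = m + k" using le_Suc_ex by (metis nat_le_linear)
  then show ?thesis by (simp add: int_mult_def nat_mult_add)
qed

lemma int_mult_add: "int_mult (i + j) y = int_mult i y + int_mult j y"
proof -
  obtain a b c d where "i = int a - int b" "j = int c - int d" by (metis int_diff_cases)
  moreover from this have "i + j = int (a + c) - int (b + d)" by simp
  ultimately show ?thesis by (simp only: int_mult_diff nat_mult_add) (simp add: algebra_simps)
qed

lemma int_mult_simps [simp]: "int_mult 0 y = 0" "int_mult 1 y = y"
  by (simp_all add: int_mult_def)

lemma int_mult_minus: "int_mult (- i) y = - int_mult i y"
  by (simp add: int_mult_def)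

lemma int_mult_of_nat: "int_mult (int n) y = nat_mult n y"
  by (simp add: int_mult_def)

lemma int_mult_mult: "int_mult (i * j) y = int_mult i (int_mult j y)"
proof -
  have nat: "int_mult (int n * j) y = nat_mult n (int_mult j y)" for n
    by (induction n) (simp_all add: ring_distribs int_mult_add)
  show ?thesis
  proof (cases i rule: int_cases2)
    case (nonneg n)
    then show ?thesis using nat by (simp add: int_mult_of_nat)
  next
    case (nonpos n)
    then show ?thesis using nat[of n] by (simp add: int_mult_minus int_mult_of_nat)
  qed
qed

text \<open>A unitary character of a subgroup of \<open>H\<close>, given by its graph, so that the union of a chain
  of extensions is again such a graph. That the relation is single-valued is required only at \<open>0\<close>,
  from which it follows everywhere.\<close>

definition character_graph :: "'g::ab_group_add set \<Rightarrow> ('g \<times> complex) set \<Rightarrow> bool" where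
  "character_graph H R \<longleftrightarrow> (0, 1) \<in> R \<and>
     (\<forall>a z b w. (a, z) \<in> R \<longrightarrow> (b, w) \<in> R \<longrightarrow> (a + b, z * w) \<in> R) \<and>
     (\<forall>a z. (a, z) \<in> R \<longrightarrow> (- a, inverse z) \<in> R \<and> a \<in> H \<and> cmod z = 1) \<and>
     (\<forall>z. (0, z) \<in> R \<longrightarrow> z = 1)"

lemma character_graphD:
  assumes "character_graph H R"
  shows "(0, 1) \<in> R" "(a, z) \<in> R \<Longrightarrow> (b, w) \<in> R \<Longrightarrow> (a + b, z * w) \<in> R"
    "(a, z) \<in> R \<Longrightarrow> (- a, inverse z) \<in> R" "(a, z) \<in> R \<Longrightarrow> a \<in> H" "(a, z) \<in> R \<Longrightarrow> cmod z = 1"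
    "(0, z) \<in> R \<Longrightarrow> z = 1"
  using assms unfolding character_graph_def by blast+

lemma character_graph_unique:
  assumes "character_graph H R" "(a, z) \<in> R" "(a, w) \<in> R"
  shows "z = w"
proof -
  have "(a + - a, z * inverse w) \<in> R"
    using character_graphD(2)[OF assms(1,2) character_graphD(3)[OF assms(1,3)]] .
  then have "z * inverse w = 1" using character_graphD(6)[OF assms(1)] by simp
  moreover have "w \<noteq> 0" using character_graphD(5)[OF assms(1,3)] by auto
  ultimately show ?thesis by (simp add: field_simps)
qed

lemma character_graph_nat_mult:
  assumes "character_graph H R" "(a, z) \<in> R"
  shows "(nat_mult n a, z ^ n) \<in> R"
  by (induction n) (simp_all add: character_graphD(1)[OF assms(1)] character_graphD(2)[OF assms(1,2)])

lemma character_graph_int_mult: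
  assumes R: "character_graph H R" "(a, z) \<in> R"
  shows "(int_mult i a, z powi i) \<in> R"
proof (cases i rule: int_cases2)
  case (nonneg n)
  then show ?thesis using character_graph_nat_mult[OF R, of n] by (simp add: int_mult_of_nat)
next
  case (nonpos n)
  then show ?thesis
    using character_graphD(3)[OF R(1) character_graph_nat_mult[OF R, of n]]
    by (simp add: int_mult_minus int_mult_of_nat power_int_minus)
qed

lemma exists_unit_root:
  assumes "cmod w = 1" "n \<ge> 2"
  obtains z where "cmod z = 1" "z ^ n = w" "z \<noteq> 1"
proof (cases "w = 1")
  case True
  define z where "z = cis (2 * pi / real n)"
  have "z ^ n = 1" using assms(2) by (simp add: z_def Complex.DeMoivre)
  moreover have "z \<noteq> 1"
  proof
    assume "z = 1"
    then have "cos (2 * pi / real n) = 1" by (simp add: z_def complex_eq_iff)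
    moreover have "0 < 2 * pi / real n" "2 * pi / real n \<le> pi"
      using assms(2) by (simp_all add: field_simps)
    then have "cos (2 * pi / real n) < cos 0" by (intro cos_monotone_0_pi) auto
    ultimately show False by simp
  qed
  ultimately show thesis using True by (intro that[of z]) (simp_all add: z_def)
next
  case False
  define z where "z = cis (Arg w / real n)"
  have "z ^ n = cis (Arg w)" using assms(2) by (simp add: z_def Complex.DeMoivre)
  also have "\<dots> = w" using assms(1) cis_Arg[of w] by (metis norm_zero sgn_eq zero_neq_one div_by_1 of_real_1)
  finally have "z ^ n = w" .
  moreover from this have "z \<noteq> 1" using False by auto
  ultimately show thesis by (intro that[of z]) (simp_all add: z_def)
qed

text \<open>The integers whose multiple of \<open>y\<close> lies in the domain form a subgroup. If it is trivial,
  then the value at \<open>y\<close> is free. Otherwise it is generated by some \<open>n\<close>, which is not \<open>1\<close> as \<open>y\<close> is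
  outside the domain, and the value must be an \<open>n\<close>th root of the given value at \<open>n\<close> times \<open>y\<close>; for
  \<open>n \<ge> 2\<close> there is such a root other than \<open>1\<close>.\<close>

lemma character_graph_extend:
  assumes H: "additive_subgroup H" and R: "character_graph H R" and y: "y \<in> H" "y \<notin> Domain R"
  obtains z R' where "character_graph H R'" "R \<subseteq> R'" "(y, z) \<in> R'" "z \<noteq> 1"
proof -
  note RD = character_graphD[OF R]
  define I where "I = {i. int_mult i y \<in> Domain R}"
  have I_diff: "i - j \<in> I" if "i \<in> I" "j \<in> I" for i j
  proof -
    obtain u v where "(int_mult i y, u) \<in> R" "(int_mult j y, v) \<in> R" using \<open>i \<in> I\<close> \<open>j \<in> I\<close> by (auto simp: I_def)
    then have "(int_mult i y + - int_mult j y, u * inverse v) \<in> R" using RD(2,3) by blast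
    then show ?thesis using int_mult_add[of i "- j" y] by (auto simp: I_def int_mult_minus)
  qed
  obtain z where z: "cmod z = 1" "z \<noteq> 1" "\<And>i w. (int_mult i y, w) \<in> R \<Longrightarrow> w = z powi i"
  proof (cases "\<exists>n>0. int n \<in> I")
    case False
    have "i = 0" if "i \<in> I" for i
    proof (rule ccontr)
      assume "i \<noteq> 0"
      have "0 \<in> I" using RD(1) by (auto simp: I_def)
      then have "- i \<in> I" using I_diff[of 0 i] that by simp
      with that \<open>i \<noteq> 0\<close> have "int (nat \<bar>i\<bar>) \<in> I" by (cases "i \<ge> 0") auto
      moreover have "nat \<bar>i\<bar> > 0" using \<open>i \<noteq> 0\<close> by simp
      ultimately show False using False by blast
    qed
    \<comment> \<open>Any value other than \<open>1\<close> on the unit circle could be chosen at \<open>y\<close>.\<close>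
    then have "w = (-1) powi i" if "(int_mult i y, w) \<in> R" for i w
      using that RD(6)[of w] by (force simp: I_def)
    then show thesis by (intro that[of "-1"]) auto
  next
    case True
    \<comment> \<open>The generator of the subgroup \<open>I\<close> of the integers.\<close>
    define n where "n = (LEAST n. n > 0 \<and> int n \<in> I)"
    have n: "n > 0" "int n \<in> I" using LeastI_ex[OF True] by (auto simp: n_def)
    have least: "k = 0" if "k < n" "int k \<in> I" for k
      using not_less_Least[of k "\<lambda>n. n > 0 \<and> int n \<in> I"] that by (auto simp: n_def)
    have "n \<noteq> 1" using n(2) y(2) by (auto simp: I_def)
    then have n2: "n \<ge> 2" using n(1) by linarith
    obtain w0 where w0: "(int_mult (int n) y, w0) \<in> R" using n(2) by (auto simp: I_def)
    obtain z where z: "cmod z = 1" "z ^ n = w0" "z \<noteq> 1"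
      using exists_unit_root[OF RD(5)[OF w0] n2] .
    have "w = z powi i" if "(int_mult i y, w) \<in> R" for i w
    proof -
      have iI: "i \<in> I" using that by (auto simp: I_def)
      have qI: "(int_mult (q * int n) y, w0 powi q) \<in> R" for q
        unfolding int_mult_mult by (rule character_graph_int_mult[OF R w0])
      then have "(i div int n) * int n \<in> I" by (force simp: I_def)
      then have "i mod int n \<in> I" using I_diff[OF iI] by (metis minus_div_mult_eq_mod)
      moreover have "0 \<le> i mod int n" "i mod int n < int n" using n(1) by simp_all
      ultimately have "nat (i mod int n) = 0" by (intro least) auto
      then have "i mod int n = 0" using \<open>0 \<le> i mod int n\<close> by linarith
      then have i: "i = (i div int n) * int n" by (metis add.right_neutral div_mult_mod_eq)
      then have "w = w0 powi (i div int n)"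
        using character_graph_unique[OF R that] qI[of "i div int n"] by simp
      also have "\<dots> = (z powi int n) powi (i div int n)" by (simp add: z(2))
      also have "\<dots> = z powi (int n * (i div int n))" by (rule power_int_mult[symmetric])
      also have "int n * (i div int n) = i" using i by (metis mult.commute)
      finally show ?thesis .
    qed
    with z show thesis by (intro that[of z]) auto
  qed
  have z0: "z \<noteq> 0" using z(1) by auto
  define R' where "R' = {(a + int_mult i y, w * z powi i) | a w i. (a, w) \<in> R}"
  have R'I: "(a + int_mult i y, w * z powi i) \<in> R'" if "(a, w) \<in> R" for a w i
    using that by (auto simp: R'_def)
  have sub: "R \<subseteq> R'"
  proof
    fix p assume "p \<in> R"
    then show "p \<in> R'" using R'I[of "fst p" "snd p" 0] by simp
  qed
  have nat_H: "nat_mult n y \<in> H" for n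
    by (induction n) (use H y(1) in \<open>auto simp: additive_subgroup_def\<close>)
  then have int_H: "int_mult i y \<in> H" for i
    using H unfolding int_mult_def additive_subgroup_def by (metis diff_conv_add_uminus)
  have "character_graph H R'"
    unfolding character_graph_def
  proof (intro conjI allI impI)
    show "(0, 1) \<in> R'" using sub RD(1) by blast
  next
    fix a u b v assume "(a, u) \<in> R'" "(b, v) \<in> R'"
    then obtain a' u' i b' v' j where *: "a = a' + int_mult i y" "u = u' * z powi i" "(a', u') \<in> R"
      "b = b' + int_mult j y" "v = v' * z powi j" "(b', v') \<in> R"
      unfolding R'_def by blast
    have "((a' + b') + int_mult (i + j) y, (u' * v') * z powi (i + j)) \<in> R'"
      by (intro R'I RD(2) *)
    moreover have "(a' + b') + int_mult (i + j) y = a + b" by (simp add: * int_mult_add algebra_simps)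
    moreover have "(u' * v') * z powi (i + j) = u * v" using z0 by (simp add: * power_int_add)
    ultimately show "(a + b, u * v) \<in> R'" by simp
  next
    fix a u assume "(a, u) \<in> R'"
    then obtain a' u' i where *: "a = a' + int_mult i y" "u = u' * z powi i" "(a', u') \<in> R"
      unfolding R'_def by blast
    have "(- a' + int_mult (- i) y, inverse u' * z powi (- i)) \<in> R'"
      by (intro R'I RD(3) *)
    moreover have "- a' + int_mult (- i) y = - a" by (simp add: * int_mult_minus)
    moreover have "inverse u' * z powi (- i) = inverse u" by (simp add: * power_int_minus)
    ultimately show "(- a, inverse u) \<in> R'" by simp
    show "a \<in> H" using H RD(4)[OF *(3)] int_H[of i] by (simp add: *(1) additive_subgroup_def)
    show "cmod u = 1" using RD(5)[OF *(3)] z(1) by (simp add: *(2) norm_mult norm_power_int)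
  next
    fix u assume "(0, u) \<in> R'"
    then obtain a' u' i where *: "0 = a' + int_mult i y" "u = u' * z powi i" "(a', u') \<in> R"
      unfolding R'_def by blast
    have "(int_mult i y, inverse u') \<in> R"
      using RD(3)[OF *(3)] *(1) by (metis add_eq_0_iff)
    then have "inverse u' = z powi i" by (rule z(3))
    moreover have "u' \<noteq> 0" using RD(5)[OF *(3)] by auto
    ultimately show "u = 1" by (simp add: *(2) flip: \<open>inverse u' = z powi i\<close>)
  qed
  moreover have "(y, z) \<in> R'" using R'I[OF RD(1), of 1] by simp
  ultimately show thesis using sub z(2) by (intro that)
qed

text \<open>The trivial character of \<open>K\<close> is extended to \<open>x\<close> with a value other than \<open>1\<close>, and then to all
  of \<open>H\<close> by Zorn's lemma.\<close>

lemma separating_character: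
  fixes H K :: "'g::ab_group_add set"
  assumes H: "additive_subgroup H" and K: "additive_subgroup K" "K \<subseteq> H" and x: "x \<in> H" "x \<notin> K"
  obtains \<chi>' :: "'g \<Rightarrow> complex" where "\<And>a. a \<in> H \<Longrightarrow> cmod (\<chi>' a) = 1"
    "\<And>a b. a \<in> H \<Longrightarrow> b \<in> H \<Longrightarrow> \<chi>' (a + b) = \<chi>' a * \<chi>' b" "\<And>a. a \<in> K \<Longrightarrow> \<chi>' a = 1" "\<chi>' x \<noteq> 1"
proof -
  define R0 :: "('g \<times> complex) set" where "R0 = K \<times> {1}"
  have R0: "character_graph H R0"
    using K unfolding character_graph_def R0_def additive_subgroup_def by auto
  have "x \<notin> Domain R0" using x(2) by (auto simp: R0_def)
  then obtain z R1 where R1: "character_graph H R1" "R0 \<subseteq> R1" "(x, z) \<in> R1" "z \<noteq> 1"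
    using character_graph_extend[OF H R0 x(1)] by blast
  \<comment> \<open>A maximal extension is defined on all of \<open>H\<close>, since any other could be extended by one more element.\<close>
  define \<A> where "\<A> = {R. character_graph H R \<and> R1 \<subseteq> R}"
  have "\<exists>R\<in>\<A>. \<forall>X\<in>\<A>. R \<subseteq> X \<longrightarrow> X = R"
  proof (rule subset_Zorn_nonempty)
    show "\<A> \<noteq> {}" using R1(1) by (auto simp: \<A>_def)
    fix \<C> assume C: "\<C> \<noteq> {}" "subset.chain \<A> \<C>"
    then have CA: "\<And>R. R \<in> \<C> \<Longrightarrow> character_graph H R \<and> R1 \<subseteq> R"
      by (auto simp: subset.chain_def \<A>_def)
    have "(a + b, u * v) \<in> \<Union>\<C>" if "(a, u) \<in> \<Union>\<C>" "(b, v) \<in> \<Union>\<C>" for a b u v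
    proof -
      obtain R S where RS: "R \<in> \<C>" "(a, u) \<in> R" "S \<in> \<C>" "(b, v) \<in> S"
        using \<open>(a, u) \<in> \<Union>\<C>\<close> \<open>(b, v) \<in> \<Union>\<C>\<close> by blast
      then have "R \<subseteq> S \<or> S \<subseteq> R" using C(2) by (auto simp: subset.chain_def)
      then obtain Q where "Q \<in> \<C>" "(a, u) \<in> Q" "(b, v) \<in> Q" using RS by blast
      then show ?thesis using CA[of Q] character_graphD(2)[of H Q] by blast
    qed
    moreover have "(0, 1) \<in> \<Union>\<C>" using C(1) CA character_graphD(1) by blast
    moreover have "(- a, inverse u) \<in> \<Union>\<C> \<and> a \<in> H \<and> cmod u = 1" if "(a, u) \<in> \<Union>\<C>" for a u
    proof -
      obtain R where "R \<in> \<C>" "(a, u) \<in> R" using \<open>(a, u) \<in> \<Union>\<C>\<close> by (rule UnionE)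
      then show ?thesis using CA[of R] character_graphD(3,4,5)[of H R a u] by blast
    qed
    moreover have "u = 1" if "(0, u) \<in> \<Union>\<C>" for u
    proof -
      obtain R where "R \<in> \<C>" "(0, u) \<in> R" using \<open>(0, u) \<in> \<Union>\<C>\<close> by (rule UnionE)
      then show ?thesis using CA[of R] character_graphD(6)[of H R u] by blast
    qed
    ultimately have "character_graph H (\<Union>\<C>)"
      unfolding character_graph_def by (intro conjI allI impI) simp_all
    then show "\<Union>\<C> \<in> \<A>" using C(1) CA unfolding \<A>_def by blast
  qed
  then obtain R where RA: "R \<in> \<A>" and RM: "\<forall>X\<in>\<A>. R \<subseteq> X \<longrightarrow> X = R" by (rule bexE)
  have R: "character_graph H R" "R1 \<subseteq> R" using RA by (simp_all add: \<A>_def)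
  have max: "X = R" if "character_graph H X" "R \<subseteq> X" for X
    using RM that R(2) by (auto simp: \<A>_def)
  have total: "a \<in> Domain R" if "a \<in> H" for a
  proof (rule ccontr)
    assume "a \<notin> Domain R"
    then obtain z R' where "character_graph H R'" "R \<subseteq> R'" "(a, z) \<in> R'"
      using character_graph_extend[OF H R(1) \<open>a \<in> H\<close> \<open>a \<notin> Domain R\<close>] by blast
    then show False using max[of R'] \<open>a \<notin> Domain R\<close> by blast
  qed
  define c where "c a = (THE w. (a, w) \<in> R)" for a
  have c_eq: "c a = w" if "(a, w) \<in> R" for a w
    unfolding c_def using that character_graph_unique[OF R(1)] by blast
  have c: "(a, c a) \<in> R" if "a \<in> H" for a using total[OF that] c_eq by blast
  show thesis
  proof (rule that)
    show "cmod (c a) = 1" if "a \<in> H" for a using character_graphD(5)[OF R(1) c[OF that]] .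
    show "c (a + b) = c a * c b" if "a \<in> H" "b \<in> H" for a b
      by (rule c_eq[OF character_graphD(2)[OF R(1) c[OF that(1)] c[OF that(2)]]])
    show "c a = 1" if "a \<in> K" for a using that R(2) R1(2) by (intro c_eq) (auto simp: R0_def)
    show "c x \<noteq> 1" using c_eq[of x z] R(2) R1(3,4) by auto
  qed
qed

section \<open>Closure under bounded pointwise limits\<close>

inductive_set bounded_closure :: "'x set \<Rightarrow> ('x \<Rightarrow> complex) set \<Rightarrow> ('x \<Rightarrow> complex) set"
  for X :: "'x set" and A :: "('x \<Rightarrow> complex) set" where
  base: "f \<in> A \<Longrightarrow> f \<in> bounded_closure X A"
| linear: "f \<in> bounded_closure X A \<Longrightarrow> g \<in> bounded_closure X A \<Longrightarrow>
    (\<lambda>x. a * f x + b * g x) \<in> bounded_closure X A"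
| limit: "(\<And>n. f n \<in> bounded_closure X A) \<Longrightarrow> (\<And>n x. x \<in> X \<Longrightarrow> cmod (f n x) \<le> B) \<Longrightarrow>
    (\<And>x. x \<in> X \<Longrightarrow> (\<lambda>n. f n x) \<longlonglongrightarrow> g x) \<Longrightarrow> g \<in> bounded_closure X A"

text \<open>The algebraic identities are demanded on \<open>X\<close> only: evaluations of characters satisfy them on
  the dual group and not on arbitrary functions.\<close>

locale function_star_algebra =
  fixes X :: "'x set" and A :: "('x \<Rightarrow> complex) set"
  assumes bounded: "f \<in> A \<Longrightarrow> \<exists>B. \<forall>x\<in>X. cmod (f x) \<le> B"
    and mult: "f \<in> A \<Longrightarrow> g \<in> A \<Longrightarrow> \<exists>h\<in>A. \<forall>x\<in>X. h x = f x * g x"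
    and cnj: "f \<in> A \<Longrightarrow> \<exists>h\<in>A. \<forall>x\<in>X. h x = cnj (f x)"
    and one: "\<exists>h\<in>A. \<forall>x\<in>X. h x = 1"
begin

abbreviation "C \<equiv> bounded_closure X A"

lemma closure_bounded: "f \<in> C \<Longrightarrow> \<exists>B. \<forall>x\<in>X. cmod (f x) \<le> B"
proof (induction rule: bounded_closure.induct)
  case (base f)
  then show ?case by (rule bounded)
next
  case (linear f g a b)
  then obtain B1 B2 where B: "\<forall>x\<in>X. cmod (f x) \<le> B1" "\<forall>x\<in>X. cmod (g x) \<le> B2" by blast
  have "cmod (a * f x + b * g x) \<le> cmod a * B1 + cmod b * B2" if "x \<in> X" for x
  proof -
    have "cmod (a * f x + b * g x) \<le> cmod a * cmod (f x) + cmod b * cmod (g x)"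
      by (metis norm_mult norm_triangle_ineq)
    also have "\<dots> \<le> cmod a * B1 + cmod b * B2"
      using B that by (intro add_mono mult_left_mono) auto
    finally show ?thesis .
  qed
  then show ?case by blast
next
  case (limit f B g)
  have "cmod (g x) \<le> B" if "x \<in> X" for x
    using limit.hyps(2)[OF that] tendsto_norm[OF limit.hyps(3)[OF that]]
    by (intro LIMSEQ_le_const2) auto
  then show ?case by blast
qed

text \<open>The constant sequence \<open>f\<close> converges to \<open>g\<close> on \<open>X\<close>.\<close>

lemma closure_cong:
  assumes "f \<in> C" "\<And>x. x \<in> X \<Longrightarrow> f x = g x"
  shows "g \<in> C"
proof -
  obtain B where B: "\<forall>x\<in>X. cmod (f x) \<le> B" using closure_bounded[OF assms(1)] by blast
  show ?thesis
  proof (rule bounded_closure.limit[of "\<lambda>_. f" X A B])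
    show "f \<in> C" by (rule assms(1))
    show "cmod (f x) \<le> B" if "x \<in> X" for x using B that by blast
    show "(\<lambda>_. f x) \<longlonglongrightarrow> g x" if "x \<in> X" for x using assms(2)[OF that] by simp
  qed
qed

lemma closure_one: "(\<lambda>_. 1) \<in> C"
proof -
  obtain h where h: "h \<in> A" "\<forall>x\<in>X. h x = 1" using one by blast
  show ?thesis by (rule closure_cong[OF bounded_closure.base[OF h(1)]]) (use h(2) in blast)
qed

lemma closure_scale: "f \<in> C \<Longrightarrow> (\<lambda>x. c * f x) \<in> C"
  using bounded_closure.linear[of f X A f c 0] by simp

lemma closure_const: "(\<lambda>_. c) \<in> C"
  using closure_scale[OF closure_one, of c] by simp

lemma closure_add: "f \<in> C \<Longrightarrow> g \<in> C \<Longrightarrow> (\<lambda>x. f x + g x) \<in> C"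
  using bounded_closure.linear[of f X A g 1 1] by simp

lemma closure_diff: "f \<in> C \<Longrightarrow> g \<in> C \<Longrightarrow> (\<lambda>x. f x - g x) \<in> C"
  using bounded_closure.linear[of f X A g 1 "-1"] by simp

lemma closure_sum: "(\<And>i. i \<in> I \<Longrightarrow> f i \<in> C) \<Longrightarrow> (\<lambda>x. \<Sum>i\<in>I. f i x) \<in> C"
  by (induction I rule: infinite_finite_induct) (auto intro: closure_const closure_add)

lemma closure_cnj: "f \<in> C \<Longrightarrow> (\<lambda>x. cnj (f x)) \<in> C"
proof (induction rule: bounded_closure.induct)
  case (base f)
  obtain h where h: "h \<in> A" "\<forall>x\<in>X. h x = cnj (f x)" using cnj[OF base] by blast
  show ?case by (rule closure_cong[OF bounded_closure.base[OF h(1)]]) (use h(2) in blast)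
next
  case (linear f g a b)
  then show ?case using bounded_closure.linear[of _ X A _ "cnj a" "cnj b"] by simp
next
  case (limit f B g)
  show ?case
    by (rule bounded_closure.limit[of "\<lambda>n x. cnj (f n x)" X A B])
      (use limit in \<open>auto intro: tendsto_cnj\<close>)
qed

text \<open>An induction on each factor in turn: the first factor runs through the closure while the
  second is in \<open>A\<close>, and then the second runs through the closure.\<close>

lemma closure_mult:
  assumes "f \<in> C" "g \<in> C"
  shows "(\<lambda>x. f x * g x) \<in> C"
proof -
  have mult_base: "(\<lambda>x. f x * g x) \<in> C" if f: "f \<in> C" and g: "g \<in> A" for f g
    using f
  proof (induction rule: bounded_closure.induct)
    case (base f)
    obtain h where h: "h \<in> A" "\<forall>x\<in>X. h x = f x * g x" using mult[OF base g] by blast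
    show ?case by (rule closure_cong[OF bounded_closure.base[OF h(1)]]) (use h(2) in blast)
  next
    case (linear f1 f2 a b)
    then show ?case using bounded_closure.linear[OF linear.IH, of a b] by (simp add: ring_distribs mult.assoc)
  next
    case (limit f B h)
    obtain K where K: "\<forall>x\<in>X. cmod (g x) \<le> K" using bounded[OF g] by blast
    show ?case
    proof (rule bounded_closure.limit[of "\<lambda>n x. f n x * g x" X A "B * K"])
      show "cmod (f n x * g x) \<le> B * K" if "x \<in> X" for n x
        unfolding norm_mult using K limit.hyps(2)[OF that, of n] that
        by (intro mult_mono) (auto intro: order_trans[OF norm_ge_zero])
    qed (use limit in \<open>auto intro!: tendsto_mult tendsto_const\<close>)
  qed
  show ?thesis
    using assms(2)
  proof (induction rule: bounded_closure.induct)
    case (base g)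
    then show ?case by (rule mult_base[OF assms(1)])
  next
    case (linear g1 g2 a b)
    then show ?case using bounded_closure.linear[OF linear.IH, of a b] by (simp add: ring_distribs mult.left_commute)
  next
    case (limit g B h)
    obtain K where K: "\<forall>x\<in>X. cmod (f x) \<le> K" using closure_bounded[OF assms(1)] by blast
    show ?case
    proof (rule bounded_closure.limit[of "\<lambda>n x. f x * g n x" X A "K * B"])
      show "cmod (f x * g n x) \<le> K * B" if "x \<in> X" for n x
        unfolding norm_mult using K limit.hyps(2)[OF that, of n] that
        by (intro mult_mono) (auto intro: order_trans[OF norm_ge_zero])
    qed (use limit in \<open>auto intro!: tendsto_mult tendsto_const\<close>)
  qed
qed

lemma closure_Re: "f \<in> C \<Longrightarrow> (\<lambda>x. complex_of_real (Re (f x))) \<in> C"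
  by (rule closure_cong[OF bounded_closure.linear[OF _ closure_cnj, of f f "1/2" "1/2"]])
    (simp_all add: complex_eq_iff)

lemma closure_Im: "f \<in> C \<Longrightarrow> (\<lambda>x. complex_of_real (Im (f x))) \<in> C"
  using closure_Re[OF closure_scale[of f "-\<i>"]] by simp

text \<open>The values of \<open>f\<close> lie in a compact interval, on which \<open>g\<close> is a uniform limit of polynomials.\<close>

lemma closure_continuous:
  assumes f: "(\<lambda>x. complex_of_real (f x)) \<in> C" and g: "continuous_on UNIV (g :: real \<Rightarrow> real)"
  shows "(\<lambda>x. complex_of_real (g (f x))) \<in> C"
proof -
  obtain B where B: "\<forall>x\<in>X. \<bar>f x\<bar> \<le> B" using closure_bounded[OF f] by auto
  have poly: "(\<lambda>x. complex_of_real (p (f x))) \<in> C" if "real_polynomial_function p" for p :: "real \<Rightarrow> real"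
    using that
  proof (induction rule: real_polynomial_function.induct)
    case (linear h)
    then obtain c where "h = (\<lambda>x. x * c)" using real_bounded_linear by blast
    then show ?case using closure_scale[OF f, of c] by (simp add: mult.commute)
  next
    case (const c)
    show ?case by (rule closure_const)
  next
    case (add p q)
    then show ?case using closure_add by force
  next
    case (mult p q)
    then show ?case using closure_mult by force
  qed
  have "\<exists>p. real_polynomial_function p \<and> (\<forall>t\<in>{-B..B}. \<bar>g t - p t\<bar> < inverse (real (Suc n)))" for n
  proof -
    obtain p where "real_polynomial_function p" "\<And>t. t \<in> {-B..B} \<Longrightarrow> \<bar>g t - p t\<bar> < inverse (real (Suc n))"
      using Stone_Weierstrass_real_polynomial_function[of "{-B..B}" g "inverse (real (Suc n))"]
        continuous_on_subset[OF g] by (metis compact_Icc inverse_positive_iff_positive of_nat_0_less_iff subset_UNIV zero_less_Suc)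
    then show ?thesis by blast
  qed
  from choice[OF allI[OF this]] obtain p where p: "\<forall>n. real_polynomial_function (p n) \<and>
      (\<forall>t\<in>{-B..B}. \<bar>g t - p n t\<bar> < inverse (real (Suc n)))" ..
  obtain K where K: "\<forall>t\<in>{-B..B}. \<bar>g t\<bar> \<le> K"
  proof -
    have "bounded (g ` {-B..B})"
      by (intro compact_imp_bounded compact_continuous_image continuous_on_subset[OF g]) auto
    then show thesis using that unfolding bounded_iff by auto
  qed
  show ?thesis
  proof (rule bounded_closure.limit[of "\<lambda>n x. complex_of_real (p n (f x))" X A "K + 1"])
    show "(\<lambda>x. complex_of_real (p n (f x))) \<in> C" for n using p poly by blast
  next
    fix n x assume "x \<in> X"
    then have t: "f x \<in> {-B..B}" using B by (simp add: abs_le_iff minus_le_iff)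
    have "\<bar>g (f x) - p n (f x)\<bar> < inverse (real (Suc n))" using p t by blast
    moreover have "inverse (real (Suc n)) \<le> 1" by (simp add: field_simps)
    moreover have "\<bar>g (f x)\<bar> \<le> K" using K t by blast
    ultimately show "cmod (complex_of_real (p n (f x))) \<le> K + 1" by simp
  next
    fix x assume "x \<in> X"
    then have t: "f x \<in> {-B..B}" using B by (simp add: abs_le_iff minus_le_iff)
    have "(\<lambda>n. \<bar>p n (f x) - g (f x)\<bar>) \<longlonglongrightarrow> 0"
    proof (rule real_tendsto_sandwich[OF _ _ tendsto_const LIMSEQ_inverse_real_of_nat])
      show "\<forall>\<^sub>F n in sequentially. \<bar>p n (f x) - g (f x)\<bar> \<le> inverse (real (Suc n))"
        using p t by (intro always_eventually allI) (simp add: abs_minus_commute less_imp_le)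
    qed simp
    then have "(\<lambda>n. p n (f x)) \<longlonglongrightarrow> g (f x)"
      by (simp add: LIM_zero_iff tendsto_rabs_zero_iff)
    then show "(\<lambda>n. complex_of_real (p n (f x))) \<longlonglongrightarrow> complex_of_real (g (f x))" by (rule tendsto_of_real)
  qed
qed

definition sets_C :: "'x set set" where
  "sets_C = {S. S \<subseteq> X \<and> indicator S \<in> C}"

text \<open>The indicator of an open ray is a limit of the continuous ramps \<open>g n\<close>.\<close>

lemma superlevel_in_sets_C:
  assumes f: "(\<lambda>x. complex_of_real (f x)) \<in> C"
  shows "{x \<in> X. a < f x} \<in> sets_C"
proof -
  define g where "g n t = min 1 (max 0 (real n * (t - a)))" for n t
  have "indicator {x \<in> X. a < f x} \<in> C"
  proof (rule bounded_closure.limit[of "\<lambda>n x. complex_of_real (g n (f x))" X A 1])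
    show "(\<lambda>x. complex_of_real (g n (f x))) \<in> C" for n
      by (rule closure_continuous[OF f]) (auto simp: g_def intro!: continuous_intros)
    show "cmod (complex_of_real (g n (f x))) \<le> 1" for n x by (simp add: g_def)
    fix x assume x: "x \<in> X"
    show "(\<lambda>n. complex_of_real (g n (f x))) \<longlonglongrightarrow> indicator {x \<in> X. a < f x} x"
    proof (cases "a < f x")
      case True
      obtain N :: nat where N: "1 / (f x - a) \<le> real N" using real_arch_simple by blast
      have "g n (f x) = 1" if "n \<ge> N" for n
      proof -
        have "1 / (f x - a) \<le> real n" using N that by linarith
        then have "1 \<le> real n * (f x - a)" using True by (simp add: field_simps)
        then show ?thesis by (simp add: g_def)
      qed
      then have "\<forall>\<^sub>F n in sequentially. complex_of_real (g n (f x)) = indicator {x \<in> X. a < f x} x"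
        using True x unfolding eventually_sequentially by auto
      then show ?thesis by (rule tendsto_eventually)
    next
      case False
      then have "g n (f x) = 0" for n by (simp add: g_def mult_le_0_iff)
      then show ?thesis using False by simp
    qed
  qed
  then show ?thesis by (auto simp: sets_C_def)
qed

lemma sigma_algebra_sets_C: "sigma_algebra X sets_C"
  unfolding sigma_algebra_iff2
proof (intro conjI ballI allI impI)
  show "sets_C \<subseteq> Pow X" by (auto simp: sets_C_def)
  show "{} \<in> sets_C" using closure_const[of 0] by (simp add: sets_C_def indicator_def[abs_def])
  show "X - S \<in> sets_C" if "S \<in> sets_C" for S
  proof -
    have "(\<lambda>x. 1 - indicator S x) \<in> C" using that by (intro closure_diff closure_one) (simp add: sets_C_def)
    then have "indicator (X - S) \<in> C" by (rule closure_cong) (simp add: indicator_def)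
    then show ?thesis by (auto simp: sets_C_def)
  qed
  fix S :: "nat \<Rightarrow> 'x set" assume "range S \<subseteq> sets_C"
  then have S: "S n \<subseteq> X" "indicator (S n) \<in> C" for n by (auto simp: sets_C_def)
  have prod: "(\<lambda>x. \<Prod>i<n. 1 - indicator (S i) x) \<in> C" for n
  proof (induction n)
    case 0
    then show ?case by (simp add: closure_one)
  next
    case (Suc n)
    then show ?case using closure_mult[OF Suc closure_diff[OF closure_one S(2)[of n]]] by simp
  qed
  have prod_eq: "(\<Prod>i<n. 1 - indicator (S i) x) = (indicator (- (\<Union>i<n. S i)) x :: complex)" for n x
    by (induction n) (auto simp: indicator_def less_Suc_eq)
  have "indicator (\<Union>i. S i) \<in> C"
  proof (rule bounded_closure.limit[of "\<lambda>n x. 1 - indicator (- (\<Union>i<n. S i)) x" X A 1])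
    show "(\<lambda>x. 1 - indicator (- (\<Union>i<n. S i)) x) \<in> C" for n
      using closure_diff[OF closure_one prod[of n]] by (simp add: prod_eq)
    show "cmod (1 - indicator (- (\<Union>i<n. S i)) x) \<le> 1" for n x by (simp add: indicator_def)
    fix x
    show "(\<lambda>n. 1 - indicator (- (\<Union>i<n. S i)) x) \<longlonglongrightarrow> (indicator (\<Union>i. S i) x :: complex)"
    proof (cases "x \<in> (\<Union>i. S i)")
      case True
      then obtain i where "x \<in> S i" by blast
      then have "\<forall>n\<ge>Suc i. 1 - indicator (- (\<Union>i<n. S i)) x = (indicator (\<Union>i. S i) x :: complex)"
        by (auto simp: indicator_def less_eq_Suc_le)
      then show ?thesis by (intro tendsto_eventually) (auto simp: eventually_sequentially)
    next
      case False
      then show ?thesis by (auto simp: indicator_def)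
    qed
  qed
  then show "(\<Union>i. S i) \<in> sets_C" using S(1) by (auto simp: sets_C_def)
qed

text \<open>A functional monotone class theorem. The level sets of the real and imaginary parts of
  members of \<open>A\<close> belong to the \<open>\<sigma>\<close>-algebra \<open>sets_C\<close>, which therefore contains all measurable sets;
  bounded measurable functions are bounded limits of simple ones.\<close>

theorem bounded_measurable_in_closure:
  assumes N: "space N = X" "sets N = sigma_sets X {{x \<in> X. f x \<in> U} | f U. f \<in> A \<and> open U}"
    and p: "p \<in> borel_measurable N" "\<And>x. x \<in> X \<Longrightarrow> cmod (p x) \<le> B"
  shows "p \<in> C"
proof -
  interpret S: sigma_algebra X sets_C by (rule sigma_algebra_sets_C)
  define N' where "N' = sigma X sets_C"
  have N': "space N' = X" "sets N' = sets_C"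
    using S.space_closed by (simp_all add: N'_def S.sigma_sets_eq)
  have A_meas: "f \<in> borel_measurable N'" if "f \<in> A" for f
  proof -
    have "f \<in> C" using that by (rule bounded_closure.base)
    then have "(\<lambda>x. Re (f x)) \<in> borel_measurable N'" "(\<lambda>x. Im (f x)) \<in> borel_measurable N'"
      unfolding borel_measurable_iff_greater N'
      by (intro allI superlevel_in_sets_C closure_Re closure_Im, assumption)+
    then show ?thesis by (simp add: borel_measurable_complex_iff)
  qed
  have "sets N \<subseteq> sets_C"
    unfolding N(2)
  proof (rule S.sigma_sets_subset, safe)
    fix f U assume "f \<in> A" "open (U :: complex set)"
    then have "f -` U \<inter> space N' \<in> sets N'" by (intro measurable_sets[OF A_meas]) auto
    moreover have "f -` U \<inter> space N' = {x \<in> X. f x \<in> U}" by (auto simp: N')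
    ultimately show "{x \<in> X. f x \<in> U} \<in> sets_C" by (simp add: N')
  qed
  then have ind: "indicator S \<in> C" if "S \<in> sets N" for S using that by (auto simp: sets_C_def)
  obtain F where F: "\<And>i. simple_function N (F i)" "\<And>x. x \<in> X \<Longrightarrow> (\<lambda>i. F i x) \<longlonglongrightarrow> p x"
    "\<And>i x. x \<in> X \<Longrightarrow> dist (F i x) 0 \<le> 2 * dist (p x) 0"
    using borel_measurable_implies_sequence_metric[OF p(1), of 0] unfolding N(1) by blast
  show ?thesis
  proof (rule bounded_closure.limit[of F X A "2 * B"])
    fix i
    have "(\<lambda>x. \<Sum>y\<in>F i ` X. y * indicator (F i -` {y} \<inter> X) x) \<in> C"
      using simple_functionD(2)[OF F(1), of i] unfolding N(1) by (intro closure_sum closure_scale ind)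
    then show "F i \<in> C"
    proof (rule closure_cong)
      fix x assume "x \<in> X"
      have "(\<Sum>y\<in>F i ` X. y * indicator (F i -` {y} \<inter> X) x) = (\<Sum>y\<in>F i ` X. if y = F i x then y else 0)"
        using \<open>x \<in> X\<close> by (intro sum.cong) (auto simp: indicator_def)
      also have "\<dots> = F i x"
        using \<open>x \<in> X\<close> simple_functionD(1)[OF F(1), of i] unfolding N(1) by (subst sum.delta) auto
      finally show "(\<Sum>y\<in>F i ` X. y * indicator (F i -` {y} \<inter> X) x) = F i x" .
    qed
  next
    fix n x assume "x \<in> X"
    then show "cmod (F n x) \<le> 2 * B" using F(3)[of x n] p(2)[of x] by simp
  qed (rule F(2))
qed

end

section \<open>The dual of a countable discrete group\<close>

locale discrete_dual =
  fixes H :: "'g::{topological_ab_group_add, second_countable_topology, t2_space} set"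
    and m :: "('g \<Rightarrow> complex) measure"
  assumes subgroup: "additive_subgroup H" and discrete: "discrete H" and countable: "countable H"
    and haar: "normalized_haar_measure H m"
begin

lemma dual_iff: "\<gamma> \<in> dual H \<longleftrightarrow> \<gamma> \<in> extensional H \<and> (\<forall>x\<in>H. cmod (\<gamma> x) = 1) \<and>
    (\<forall>x\<in>H. \<forall>y\<in>H. \<gamma> (x + y) = \<gamma> x * \<gamma> y)"
  using continuous_on_discrete[OF discrete] by (auto simp: dual_def)

lemma H_closed: "0 \<in> H" "x \<in> H \<Longrightarrow> y \<in> H \<Longrightarrow> x + y \<in> H" "x \<in> H \<Longrightarrow> - x \<in> H"
    "x \<in> H \<Longrightarrow> y \<in> H \<Longrightarrow> x - y \<in> H"
  using subgroup unfolding additive_subgroup_def by (auto simp: diff_conv_add_uminus simp del: add_uminus_conv_diff)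

lemma dualD: "\<gamma> \<in> dual H \<Longrightarrow> x \<in> H \<Longrightarrow> cmod (\<gamma> x) = 1"
    "\<gamma> \<in> dual H \<Longrightarrow> x \<in> H \<Longrightarrow> y \<in> H \<Longrightarrow> \<gamma> (x + y) = \<gamma> x * \<gamma> y"
  by (auto simp: dual_iff)

lemma dual_nonzero: "\<gamma> \<in> dual H \<Longrightarrow> x \<in> H \<Longrightarrow> \<gamma> x \<noteq> 0"
  using dualD(1) by fastforce

lemma dual_at_0: "\<gamma> \<in> dual H \<Longrightarrow> \<gamma> 0 = 1"
  using dualD(2)[of \<gamma> 0 0] dual_nonzero[of \<gamma> 0] H_closed(1) by simp

lemma dual_minus:
  assumes "\<gamma> \<in> dual H" "x \<in> H"
  shows "\<gamma> (- x) = cnj (\<gamma> x)"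
proof -
  have "\<gamma> x * \<gamma> (- x) = 1"
    using dualD(2)[OF assms H_closed(3)[OF assms(2)]] dual_at_0[OF assms(1)] by simp
  moreover have "\<gamma> x * cnj (\<gamma> x) = 1"
    using dualD(1)[OF assms] by (simp flip: complex_norm_square)
  ultimately show ?thesis using dual_nonzero[OF assms] by (metis mult_left_cancel)
qed

lemma dual_ext: "\<gamma> \<in> dual H \<Longrightarrow> \<delta> \<in> dual H \<Longrightarrow> (\<And>h. h \<in> H \<Longrightarrow> \<gamma> h = \<delta> h) \<Longrightarrow> \<gamma> = \<delta>"
  by (rule extensionalityI[of _ H]) (auto simp: dual_iff)

definition dual_neg :: "('g \<Rightarrow> complex) \<Rightarrow> 'g \<Rightarrow> complex" where
  "dual_neg \<gamma> = (\<lambda>h\<in>H. inverse (\<gamma> h))"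

lemma dual_add_apply: "h \<in> H \<Longrightarrow> dual_add H \<gamma> \<delta> h = \<gamma> h * \<delta> h"
  by (simp add: dual_add_def)

lemma dual_add_closed: "\<gamma> \<in> dual H \<Longrightarrow> \<delta> \<in> dual H \<Longrightarrow> dual_add H \<gamma> \<delta> \<in> dual H"
  using H_closed(2) by (auto simp: dual_iff dual_add_def norm_mult)

lemma dual_neg_closed: "\<gamma> \<in> dual H \<Longrightarrow> dual_neg \<gamma> \<in> dual H"
  using H_closed(2) by (auto simp: dual_iff dual_neg_def norm_inverse)

lemma dual_zero_closed: "dual_zero H \<in> dual H"
  using H_closed(2) by (auto simp: dual_iff dual_zero_def)

lemma dual_add_commute: "dual_add H \<gamma> \<delta> = dual_add H \<delta> \<gamma>"
  by (auto simp: dual_add_def mult.commute)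

lemma dual_add_assoc: "dual_add H (dual_add H \<gamma> \<delta>) \<epsilon> = dual_add H \<gamma> (dual_add H \<delta> \<epsilon>)"
  by (auto simp: dual_add_def mult.assoc)

lemma dual_add_zero: "\<gamma> \<in> dual H \<Longrightarrow> dual_add H \<gamma> (dual_zero H) = \<gamma>"
  by (rule dual_ext[OF dual_add_closed[OF _ dual_zero_closed]]) (auto simp: dual_add_apply dual_zero_def)

lemma dual_add_neg: "\<gamma> \<in> dual H \<Longrightarrow> dual_add H \<gamma> (dual_neg \<gamma>) = dual_zero H"
  by (rule dual_ext[OF dual_add_closed[OF _ dual_neg_closed] dual_zero_closed])
    (auto simp: dual_add_apply dual_zero_def dual_neg_def dual_nonzero)

lemma dual_add_cancel: "\<gamma> \<in> dual H \<Longrightarrow> \<delta> \<in> dual H \<Longrightarrow> dual_add H (dual_add H \<gamma> \<delta>) (dual_neg \<delta>) = \<gamma>"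
  by (simp add: dual_add_assoc dual_add_neg dual_add_zero)

lemma dual_add_cancel': "\<gamma> \<in> dual H \<Longrightarrow> \<delta> \<in> dual H \<Longrightarrow> dual_add H (dual_add H \<gamma> (dual_neg \<delta>)) \<delta> = \<gamma>"
  by (metis dual_add_assoc dual_add_commute dual_add_neg dual_add_zero)

lemma space_m: "space m = dual H" and sets_open: "sets m = sigma_sets (dual H) {U. openin (dual_topology H) U}"
    and emeasure_m: "emeasure m (dual H) = 1"
    and emeasure_translate: "\<gamma> \<in> dual H \<Longrightarrow> B \<in> sets m \<Longrightarrow> emeasure m (dual_add H \<gamma> ` B) = emeasure m B"
  using haar by (auto simp: normalized_haar_measure_def)

definition cylinders :: "('g \<Rightarrow> complex) set set" where
  "cylinders = {{\<gamma> \<in> dual H. f \<gamma> \<in> U} | f U. f \<in> (\<lambda>h \<gamma>. \<gamma> h) ` H \<and> open (U :: complex set)}"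

lemma cylinder_open:
  assumes "h \<in> H" "open U"
  shows "openin (dual_topology H) {\<gamma> \<in> dual H. \<gamma> h \<in> U}"
  unfolding dual_topology_def
proof (rule topology_generated_by_Basis)
  have "{\<gamma> \<in> dual H. \<gamma> h \<in> U} = {\<gamma> \<in> dual H. \<gamma> ` {h} \<subseteq> U}" by auto
  moreover have "{h} \<subseteq> H \<and> compact {h} \<and> open U" using assms by auto
  ultimately show "{\<gamma> \<in> dual H. \<gamma> h \<in> U} \<in> {{\<gamma> \<in> dual H. \<gamma> ` K \<subseteq> U} |K U. K \<subseteq> H \<and> compact K \<and> open U}"
    by blast
qed

text \<open>Compact subsets of \<open>H\<close> are finite, so a basic open set restricts finitely many coordinates.
  As there are countably many coordinates and the complex plane has a countable base, an open set
  is a countable union of finite intersections of cylinders. Measurability can thus be checked on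
  single coordinates.\<close>

lemma sets_cylinders: "sets m = sigma_sets (dual H) cylinders"
proof
  have cyl: "{\<gamma> \<in> dual H. \<gamma> h \<in> U} \<in> cylinders" if "h \<in> H" "open U" for h U
    unfolding cylinders_def using that by (intro CollectI exI[of _ "\<lambda>\<gamma>. \<gamma> h"] exI[of _ U]) auto
  have sub: "cylinders \<subseteq> Pow (dual H)" by (auto simp: cylinders_def)
  interpret S: sigma_algebra "dual H" "sigma_sets (dual H) cylinders"
    by (rule sigma_algebra_sigma_sets[OF sub])
  show "sigma_sets (dual H) cylinders \<subseteq> sets m"
    unfolding sets_open
  proof (rule sigma_sets_mono)
    show "cylinders \<subseteq> sigma_sets (dual H) {U. openin (dual_topology H) U}"
      unfolding cylinders_def using cylinder_open by (blast intro: sigma_sets.Basic)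
  qed
  obtain \<B> :: "complex set set" where \<B>: "countable \<B>" "topological_basis \<B>"
    using ex_countable_basis by blast
  define N where "N P = {\<gamma> \<in> dual H. \<forall>(h, U)\<in>P. \<gamma> h \<in> U}" for P :: "('g \<times> complex set) set"
  have N_sets: "N P \<in> sigma_sets (dual H) cylinders" if "finite P" "P \<subseteq> H \<times> \<B>" for P
    using that
  proof (induction P)
    case empty
    have "N {} = dual H" by (simp add: N_def)
    then show ?case using S.top by simp
  next
    case (insert p P)
    obtain h U where p: "p = (h, U)" "h \<in> H" "U \<in> \<B>" using insert.prems by auto
    have "N (insert p P) = N P \<inter> {\<gamma> \<in> dual H. \<gamma> h \<in> U}" by (auto simp: N_def p)
    moreover have "{\<gamma> \<in> dual H. \<gamma> h \<in> U} \<in> sigma_sets (dual H) cylinders"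
      using p topological_basis_open[OF \<B>(2)] by (intro sigma_sets.Basic cyl) auto
    ultimately show ?case using insert by auto
  qed
  \<comment> \<open>The sets \<open>N P\<close> for finite subsets \<open>P\<close> of \<open>H \<times> \<B>\<close> form a countable base of the dual group.\<close>
  define nbhd where "nbhd \<gamma> W P \<longleftrightarrow> finite P \<and> P \<subseteq> H \<times> \<B> \<and> \<gamma> \<in> N P \<and> N P \<subseteq> W" for \<gamma> W P
  have nbhd: "\<forall>\<gamma>\<in>W. \<exists>P. nbhd \<gamma> W P"
    if "openin (dual_topology H) W" for W
  proof -
    have "generate_topology_on {{\<gamma> \<in> dual H. \<gamma> ` K \<subseteq> U} | K U. K \<subseteq> H \<and> compact K \<and> open U} W"
      using that unfolding dual_topology_def openin_topology_generated_by_iff .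
    then show ?thesis
    proof (induction rule: generate_topology_on.induct)
      case Empty
      then show ?case by simp
    next
      case (Int a b)
      show ?case
      proof
        fix \<gamma> assume "\<gamma> \<in> a \<inter> b"
        then have \<gamma>: "\<gamma> \<in> a" "\<gamma> \<in> b" by simp_all
        obtain P where P: "nbhd \<gamma> a P" using bspec[OF Int.IH(1) \<gamma>(1)] by (rule exE)
        obtain Q where Q: "nbhd \<gamma> b Q" using bspec[OF Int.IH(2) \<gamma>(2)] by (rule exE)
        have "N (P \<union> Q) = N P \<inter> N Q" by (auto simp: N_def)
        then have "nbhd \<gamma> (a \<inter> b) (P \<union> Q)" using P Q unfolding nbhd_def by auto
        then show "\<exists>P. nbhd \<gamma> (a \<inter> b) P" by (rule exI)
      qed
    next
      case (UN K)
      show ?case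
      proof
        fix \<gamma> assume "\<gamma> \<in> \<Union>K"
        then obtain k where k: "k \<in> K" "\<gamma> \<in> k" by (rule UnionE)
        obtain P where "nbhd \<gamma> k P" using bspec[OF UN.IH[OF k(1)] k(2)] by (rule exE)
        then have "nbhd \<gamma> (\<Union>K) P" using k(1) unfolding nbhd_def by auto
        then show "\<exists>P. nbhd \<gamma> (\<Union>K) P" by (rule exI)
      qed
    next
      case (Basis W)
      then obtain K U where W: "W = {\<gamma> \<in> dual H. \<gamma> ` K \<subseteq> U}" and K: "K \<subseteq> H" "compact K" "open U" by blast
      have "finite K" using discrete_compact_finite_iff[of K] discrete_subset[OF discrete K(1)] K(2) by blast
      show ?case
      proof
        fix \<gamma> assume \<gamma>: "\<gamma> \<in> W"
        have "\<exists>V. V \<in> \<B> \<and> \<gamma> h \<in> V \<and> V \<subseteq> U" if "h \<in> K" for h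
          using topological_basisE[OF \<B>(2) K(3), of "\<gamma> h"] \<gamma> that W by blast
        then obtain V where V: "\<And>h. h \<in> K \<Longrightarrow> V h \<in> \<B> \<and> \<gamma> h \<in> V h \<and> V h \<subseteq> U" by metis
        define P where "P = (\<lambda>h. (h, V h)) ` K"
        have "\<gamma> \<in> N P" using \<gamma> V by (auto simp: N_def W P_def)
        moreover have "N P \<subseteq> W"
        proof
          fix \<delta> assume "\<delta> \<in> N P"
          then have "\<delta> \<in> dual H" "\<And>h. h \<in> K \<Longrightarrow> \<delta> h \<in> V h" by (auto simp: N_def P_def)
          then show "\<delta> \<in> W" using V unfolding W by blast
        qed
        moreover have "P \<subseteq> H \<times> \<B>" using V K(1) by (auto simp: P_def)
        ultimately have "nbhd \<gamma> W P" using \<open>finite K\<close> by (simp add: nbhd_def P_def)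
        then show "\<exists>P. nbhd \<gamma> W P" by (rule exI)
      qed
    qed
  qed
  show "sets m \<subseteq> sigma_sets (dual H) cylinders"
    unfolding sets_open
  proof (rule sigma_sets_mono, rule subsetI)
    fix W assume "W \<in> {U. openin (dual_topology H) U}"
    then have W: "openin (dual_topology H) W" by simp
    define \<P> where "\<P> = {P. finite P \<and> P \<subseteq> H \<times> \<B>} \<inter> {P. N P \<subseteq> W}"
    have "countable {P. finite P \<and> P \<subseteq> H \<times> \<B>}"
      using countable \<B>(1) by (intro countable_Collect_finite_subset countable_SIGMA)
    then have "countable \<P>" unfolding \<P>_def by blast
    then have "(\<Union>P\<in>\<P>. N P) \<in> sigma_sets (dual H) cylinders"
      using N_sets by (intro S.countable_UN'') (auto simp: \<P>_def)
    moreover have "(\<Union>P\<in>\<P>. N P) = W"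
    proof
      show "(\<Union>P\<in>\<P>. N P) \<subseteq> W" by (auto simp: \<P>_def)
      show "W \<subseteq> (\<Union>P\<in>\<P>. N P)"
      proof
        fix \<gamma> assume "\<gamma> \<in> W"
        obtain P where "nbhd \<gamma> W P" using bspec[OF nbhd[OF W] \<open>\<gamma> \<in> W\<close>] by (rule exE)
        then show "\<gamma> \<in> (\<Union>P\<in>\<P>. N P)" by (auto simp: nbhd_def \<P>_def)
      qed
    qed
    ultimately show "W \<in> sigma_sets (dual H) cylinders" by simp
  qed
qed

lemma character_measurable: "h \<in> H \<Longrightarrow> (\<lambda>\<gamma>. \<gamma> h) \<in> borel_measurable m"
proof (rule borel_measurableI)
  fix U :: "complex set" assume h: "h \<in> H" and U: "open U"
  have "(\<lambda>\<gamma>. \<gamma> h) -` U \<inter> space m = {\<gamma> \<in> dual H. \<gamma> h \<in> U}" by (auto simp: space_m)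
  moreover have "{\<gamma> \<in> dual H. \<gamma> h \<in> U} \<in> sets m"
    unfolding sets_open using cylinder_open[OF h U] by (auto intro: sigma_sets.Basic)
  ultimately show "(\<lambda>\<gamma>. \<gamma> h) -` U \<inter> space m \<in> sets m" by simp
qed

lemma translate_measurable:
  assumes "\<delta> \<in> dual H"
  shows "(\<lambda>\<gamma>. dual_add H \<gamma> \<delta>) \<in> m \<rightarrow>\<^sub>M m"
proof (rule measurable_sigma_sets[OF sets_cylinders])
  show "cylinders \<subseteq> Pow (dual H)" by (auto simp: cylinders_def)
  show "(\<lambda>\<gamma>. dual_add H \<gamma> \<delta>) \<in> space m \<rightarrow> dual H" using assms by (auto simp: space_m dual_add_closed)
  fix Y assume "Y \<in> cylinders"
  then obtain h U where Y: "Y = {\<gamma> \<in> dual H. \<gamma> h \<in> U}" "h \<in> H" "open U" by (auto simp: cylinders_def)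
  have "(\<lambda>\<gamma>. \<gamma> h * \<delta> h) \<in> borel_measurable m"
    using character_measurable[OF Y(2)] by (intro borel_measurable_times) auto
  then have "(\<lambda>\<gamma>. \<gamma> h * \<delta> h) -` U \<inter> space m \<in> sets m" using Y(3) by (intro measurable_sets) auto
  moreover have "(\<lambda>\<gamma>. dual_add H \<gamma> \<delta>) -` Y \<inter> space m = (\<lambda>\<gamma>. \<gamma> h * \<delta> h) -` U \<inter> space m"
    using assms Y(2) by (auto simp: Y(1) space_m dual_add_closed dual_add_apply)
  ultimately show "(\<lambda>\<gamma>. dual_add H \<gamma> \<delta>) -` Y \<inter> space m \<in> sets m" by simp
qed

lemma distr_translate:
  assumes \<delta>: "\<delta> \<in> dual H"
  shows "distr m m (\<lambda>\<gamma>. dual_add H \<gamma> \<delta>) = m"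
proof (rule measure_eqI)
  fix B assume "B \<in> sets (distr m m (\<lambda>\<gamma>. dual_add H \<gamma> \<delta>))"
  then have B: "B \<in> sets m" by simp
  then have BH: "B \<subseteq> dual H" using sets.sets_into_space[OF B] by (simp add: space_m)
  have "(\<lambda>\<gamma>. dual_add H \<gamma> \<delta>) -` B \<inter> space m = dual_add H (dual_neg \<delta>) ` B"
  proof (intro equalityI subsetI)
    fix \<gamma> assume "\<gamma> \<in> (\<lambda>\<gamma>. dual_add H \<gamma> \<delta>) -` B \<inter> space m"
    then have \<gamma>: "\<gamma> \<in> dual H" "dual_add H \<gamma> \<delta> \<in> B" by (auto simp: space_m)
    have "\<gamma> = dual_add H (dual_neg \<delta>) (dual_add H \<gamma> \<delta>)"
      using dual_add_cancel[OF \<gamma>(1) \<delta>] by (simp add: dual_add_commute)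
    then show "\<gamma> \<in> dual_add H (dual_neg \<delta>) ` B" using \<gamma>(2) by blast
  next
    fix \<gamma> assume "\<gamma> \<in> dual_add H (dual_neg \<delta>) ` B"
    then obtain \<beta> where \<beta>: "\<beta> \<in> B" "\<gamma> = dual_add H \<beta> (dual_neg \<delta>)" by (auto simp: dual_add_commute)
    then have "\<beta> \<in> dual H" using BH by blast
    then show "\<gamma> \<in> (\<lambda>\<gamma>. dual_add H \<gamma> \<delta>) -` B \<inter> space m"
      using \<beta> \<delta> by (auto simp: space_m dual_add_closed dual_neg_closed dual_add_cancel')
  qed
  then show "emeasure (distr m m (\<lambda>\<gamma>. dual_add H \<gamma> \<delta>)) B = emeasure m B"
    using emeasure_translate[OF dual_neg_closed[OF \<delta>] B]
    by (simp add: emeasure_distr[OF translate_measurable[OF \<delta>] B])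
qed simp

lemma separating_dual:
  assumes K: "additive_subgroup K" "K \<subseteq> H" and h: "h \<in> H" "h \<notin> K"
  obtains \<gamma> where "\<gamma> \<in> annihilator H K" "\<gamma> h \<noteq> 1"
proof -
  obtain c where c: "\<And>a. a \<in> H \<Longrightarrow> cmod (c a) = 1" "\<And>a b. a \<in> H \<Longrightarrow> b \<in> H \<Longrightarrow> c (a + b) = c a * c b"
    "\<And>a. a \<in> K \<Longrightarrow> c a = 1" "c h \<noteq> 1"
    using separating_character[OF subgroup K h] by blast
  have "restrict c H \<in> dual H" using c H_closed(2) by (auto simp: dual_iff)
  then show thesis using c(3,4) K(2) h(1) by (intro that[of "restrict c H"]) (auto simp: annihilator_def)
qed

text \<open>Translation by a character \<open>\<delta>\<close> with \<open>\<delta> h \<noteq> 1\<close> multiplies the integral by \<open>\<delta> h\<close>.\<close>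

lemma character_integral:
  assumes h: "h \<in> H" "h \<noteq> 0"
  shows "(LINT \<gamma>|m. \<gamma> h) = 0"
proof -
  have "additive_subgroup {0 :: 'g}" by (simp add: additive_subgroup_def)
  then obtain \<delta> where \<delta>: "\<delta> \<in> dual H" "\<delta> h \<noteq> 1"
    using separating_dual[of "{0}" h] h H_closed(1) by (auto simp: annihilator_def)
  have "(LINT \<gamma>|m. \<gamma> h) = (LINT \<gamma>|distr m m (\<lambda>\<gamma>. dual_add H \<gamma> \<delta>). \<gamma> h)"
    by (simp add: distr_translate[OF \<delta>(1)])
  also have "\<dots> = (LINT \<gamma>|m. dual_add H \<gamma> \<delta> h)"
    by (rule integral_distr[OF translate_measurable[OF \<delta>(1)] character_measurable[OF h(1)]])
  also have "\<dots> = (LINT \<gamma>|m. \<gamma> h) * \<delta> h"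
    by (simp add: dual_add_apply[OF h(1)])
  finally show ?thesis using \<delta>(2) by (metis mult_cancel_left mult.right_neutral)
qed

lemma star_algebra: "function_star_algebra (dual H) ((\<lambda>h \<gamma>. \<gamma> h) ` H)"
proof
  show "\<exists>B. \<forall>\<gamma>\<in>dual H. cmod (f \<gamma>) \<le> B" if "f \<in> (\<lambda>h \<gamma>. \<gamma> h) ` H" for f
    using that dualD(1) by (auto intro!: exI[of _ 1])
  show "\<exists>h\<in>(\<lambda>h \<gamma>. \<gamma> h) ` H. \<forall>\<gamma>\<in>dual H. h \<gamma> = f \<gamma> * g \<gamma>"
    if "f \<in> (\<lambda>h \<gamma>. \<gamma> h) ` H" "g \<in> (\<lambda>h \<gamma>. \<gamma> h) ` H" for f g
    using that dualD(2) H_closed(2) by fastforce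
  show "\<exists>h\<in>(\<lambda>h \<gamma>. \<gamma> h) ` H. \<forall>\<gamma>\<in>dual H. h \<gamma> = cnj (f \<gamma>)" if "f \<in> (\<lambda>h \<gamma>. \<gamma> h) ` H" for f
    using that dual_minus H_closed(3) by fastforce
  show "\<exists>h\<in>(\<lambda>h \<gamma>. \<gamma> h) ` H. \<forall>\<gamma>\<in>dual H. h \<gamma> = 1"
    by (rule bexI[of _ "\<lambda>\<gamma>. \<gamma> 0"]) (simp_all add: dual_at_0 H_closed(1))
qed

text \<open>The argument for integrals, applied to the finite group of characters that are trivial on
  \<open>M\<close>: multiplication by \<open>\<delta>\<close> permutes the summands and multiplies the sum by \<open>\<delta> h\<close>.\<close>

lemma character_sum:
  assumes M: "additive_subgroup M" "M \<subseteq> H" and \<mu>: "bij_betw \<mu> {..<r} (annihilator H M)" and h: "h \<in> H"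
  shows "(\<Sum>k<r. \<mu> k h) = (if h \<in> M then of_nat r else 0)"
proof (cases "h \<in> M")
  case True
  then have "\<mu> k h = 1" if "k < r" for k
    using bij_betwE[OF \<mu>] that by (auto simp: annihilator_def)
  then show ?thesis using True by simp
next
  case False
  obtain \<delta> where \<delta>: "\<delta> \<in> annihilator H M" "\<delta> h \<noteq> 1"
    using separating_dual[OF M h False] by blast
  have \<delta>d: "\<delta> \<in> dual H" using \<delta>(1) by (simp add: annihilator_def)
  have ann: "bij_betw (\<lambda>\<gamma>. dual_add H \<gamma> \<delta>) (annihilator H M) (annihilator H M)"
  proof (rule bij_betwI[where g = "\<lambda>\<gamma>. dual_add H \<gamma> (dual_neg \<delta>)"])
    show "(\<lambda>\<gamma>. dual_add H \<gamma> \<delta>) \<in> annihilator H M \<rightarrow> annihilator H M"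
      using \<delta>(1) M(2) by (auto simp: annihilator_def dual_add_closed dual_add_apply subset_eq)
    show "(\<lambda>\<gamma>. dual_add H \<gamma> (dual_neg \<delta>)) \<in> annihilator H M \<rightarrow> annihilator H M"
    proof -
      have "dual_neg \<delta> a = 1" if "a \<in> M" for a
        using \<delta>(1) M(2) that by (auto simp: annihilator_def dual_neg_def subset_eq)
      then show ?thesis
        using dual_neg_closed[OF \<delta>d] M(2) by (auto simp: annihilator_def dual_add_closed dual_add_apply subset_eq)
    qed
  qed (use \<delta>d in \<open>auto simp: annihilator_def dual_add_cancel dual_add_cancel'\<close>)
  have "(\<Sum>k<r. \<mu> k h) = (\<Sum>\<gamma>\<in>annihilator H M. \<gamma> h)"
    by (rule sum.reindex_bij_betw[OF \<mu>])
  also have "\<dots> = (\<Sum>\<gamma>\<in>annihilator H M. dual_add H \<gamma> \<delta> h)"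
    by (rule sum.reindex_bij_betw[OF ann, symmetric])
  also have "\<dots> = (\<Sum>\<gamma>\<in>annihilator H M. \<gamma> h) * \<delta> h"
    by (simp add: dual_add_apply[OF h] sum_distrib_right)
  also have "(\<Sum>\<gamma>\<in>annihilator H M. \<gamma> h) = (\<Sum>k<r. \<mu> k h)"
    by (rule sum.reindex_bij_betw[OF \<mu>, symmetric])
  finally have "(\<Sum>k<r. \<mu> k h) = 0" using \<delta>(2) by (metis mult_cancel_left mult.right_neutral)
  then show ?thesis using False by simp
qed

lemma bounded_in_L2_density:
  fixes w :: "('g \<Rightarrow> complex) \<Rightarrow> real"
  assumes w: "integrable m w" "\<forall>x\<in>space m. 0 \<le> w x"
    and f: "f \<in> borel_measurable m" "\<And>x. x \<in> space m \<Longrightarrow> cmod (f x) \<le> B"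
  shows "f \<in> L2 (density m (\<lambda>x. ennreal (w x)))"
proof -
  have "integrable m (\<lambda>x. w x *\<^sub>R (cmod (f x))\<^sup>2)"
  proof (rule Bochner_Integration.integrable_bound[OF integrable_mult_left[OF w(1), of "B\<^sup>2"]])
    show "AE x in m. norm (w x *\<^sub>R (cmod (f x))\<^sup>2) \<le> norm (w x * B\<^sup>2)"
    proof (intro AE_I2)
      fix x assume x: "x \<in> space m"
      have "(cmod (f x))\<^sup>2 \<le> B\<^sup>2" using f(2)[OF x] by (intro power_mono) auto
      then show "norm (w x *\<^sub>R (cmod (f x))\<^sup>2) \<le> norm (w x * B\<^sup>2)"
        using bspec[OF w(2) x] by (simp add: abs_mult mult_left_mono)
    qed
  qed (use w f in measurable)
  then have "integrable (density m (\<lambda>x. ennreal (w x))) (\<lambda>x. (cmod (f x))\<^sup>2)"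
    using w f by (subst integrable_density) auto
  then show ?thesis using f(1) by (simp add: L2_def)
qed

lemma l2_norm_density:
  assumes w: "integrable m w" "\<forall>x\<in>space m. 0 \<le> w x" and f: "f \<in> borel_measurable m"
  shows "(l2_norm (density m (\<lambda>x. ennreal (w x))) f)\<^sup>2 = (LINT x|m. w x * (cmod (f x))\<^sup>2)"
  unfolding l2_norm_sq using w f by (subst integral_density) auto

text \<open>A monotone class argument for the property that the periodization of a function lies in the
  closed span of the characters of \<open>M\<close>, with respect to the given weight. By \<open>character_sum\<close>,
  periodization multiplies the character given by \<open>h\<close> by \<open>r\<close> if \<open>h \<in> M\<close> and kills it otherwise.
  The property passes to linear combinations, and to bounded limits by dominated convergence since
  the weight is integrable. Finally, a periodic function is \<open>1 / r\<close> times its periodization.\<close>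

lemma periodic_density:
  assumes M: "additive_subgroup M" "M \<subseteq> H" and \<mu>: "bij_betw \<mu> {..<r} (annihilator H M)"
    and til: "tiling m (\<lambda>k \<gamma>. dual_add H \<gamma> (\<mu> k)) r \<Omega>"
    and p: "p \<in> borel_measurable m" "\<And>x. x \<in> space m \<Longrightarrow> cmod (p x) \<le> B"
      "tiling.periodic m (\<lambda>k \<gamma>. dual_add H \<gamma> (\<mu> k)) r p"
    and w: "integrable m w" "\<And>x. x \<in> space m \<Longrightarrow> 0 \<le> w x" and "\<epsilon> > 0"
  shows "\<exists>F c. finite F \<and> F \<subseteq> M \<and> (LINT x|m. w x * (cmod (p x - (\<Sum>h\<in>F. c h * x h)))\<^sup>2) < \<epsilon>"
proof -
  interpret T: tiling m "\<lambda>k \<gamma>. dual_add H \<gamma> (\<mu> k)" r \<Omega> by (rule til)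
  interpret A: function_star_algebra "dual H" "(\<lambda>h \<gamma>. \<gamma> h) ` H" by (rule star_algebra)
  have "\<forall>x\<in>space m. 0 \<le> w x" using w(2) by blast
  note w' = w(1) this
  define D where "D = density m (\<lambda>x. ennreal (w x))"
  have D: "space D = dual H" "sets D = sets m" by (simp_all add: D_def space_m)
  define e where "e h \<gamma> = \<gamma> h" for h :: 'g and \<gamma> :: "'g \<Rightarrow> complex"
  have e_meas: "e h \<in> borel_measurable m" if "h \<in> H" for h
    unfolding e_def[abs_def] by (rule character_measurable[OF that])
  have \<mu>_dual: "\<mu> k \<in> dual H" if "k < r" for k
    using bij_betwE[OF \<mu>] that by (auto simp: annihilator_def)
  have L2D: "f \<in> L2 D" if "f \<in> borel_measurable m" "\<And>x. x \<in> dual H \<Longrightarrow> cmod (f x) \<le> K" for f K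
    unfolding D_def using that by (intro bounded_in_L2_density[OF w']) (auto simp: space_m)
  have e_L2: "e h \<in> L2 D" if "h \<in> M" for h
    using that M(2) dualD(1) by (intro L2D[of _ 1] e_meas) (auto simp: e_def)
  have per_bound: "cmod (T.periodize f x) \<le> real r * K"
    if "\<And>x. x \<in> dual H \<Longrightarrow> cmod (f x) \<le> K" "x \<in> dual H" for f K x
  proof -
    have "cmod (T.periodize f x) \<le> (\<Sum>k<r. K)"
      unfolding T.periodize_def using that by (intro sum_norm_le) (auto simp: dual_add_closed \<mu>_dual)
    then show ?thesis by simp
  qed
  have key: "f \<in> borel_measurable m \<and> T.periodize f \<in> closed_span D e M" if "f \<in> A.C" for f
    using that
  proof (induction rule: bounded_closure.induct)
    case (base f)
    then obtain h where "h \<in> H" "f = (\<lambda>\<gamma>. \<gamma> h)" by blast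
    then have h: "h \<in> H" "f = e h" by (simp_all add: e_def fun_eq_iff)
    have per: "T.periodize f \<gamma> = (if h \<in> M then of_nat r else 0) * e h \<gamma>" if "\<gamma> \<in> dual H" for \<gamma>
      using character_sum[OF M \<mu> h(1)]
      by (simp add: T.periodize_def h(2) e_def dual_add_apply[OF h(1)] mult.commute flip: sum_distrib_left)
    have "T.periodize f \<in> closed_span D e M"
    proof (rule closed_spanI)
      show "T.periodize f \<in> L2 D"
        using per_bound[of f 1] dualD(1) h e_meas
        by (intro L2D[of _ "real r * 1"] T.measurable_periodize) (auto simp: e_def)
      fix \<delta> :: real assume "\<delta> > 0"
      have "l2_norm D (\<lambda>x. T.periodize f x - (\<Sum>i\<in>(if h \<in> M then {h} else {}). of_nat r * e i x)) = l2_norm D (\<lambda>_. 0)"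
        unfolding l2_norm_def by (intro arg_cong[where f = sqrt] Bochner_Integration.integral_cong) (auto simp: D per)
      then show "\<exists>F c. finite F \<and> F \<subseteq> M \<and> l2_norm D (\<lambda>x. T.periodize f x - (\<Sum>i\<in>F. c i * e i x)) < \<delta>"
        using \<open>\<delta> > 0\<close>
        by (intro exI[of _ "if h \<in> M then {h} else {}"] exI[of _ "\<lambda>_. of_nat r"]) (auto simp: l2_norm_def)
    qed
    then show ?case using e_meas[OF h(1)] h(2) by simp
  next
    case (linear f g a b)
    have "T.periodize (\<lambda>x. a * f x + b * g x) = (\<lambda>x. a * T.periodize f x + b * T.periodize g x)"
      by (simp add: T.periodize_def fun_eq_iff sum.distrib sum_distrib_left)
    then show ?case
      using linear.IH closed_span_add[OF e_L2 closed_span_scale closed_span_scale] by auto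
  next
    case (limit f B g)
    have f: "f n \<in> borel_measurable m" "T.periodize (f n) \<in> closed_span D e M" for n
      using limit.IH[of n] by auto
    have fB: "cmod (f n x) \<le> B" if "x \<in> dual H" for n x by (rule limit.hyps(2)[OF that])
    have g_lim: "(\<lambda>n. f n x) \<longlonglongrightarrow> g x" if "x \<in> dual H" for x by (rule limit.hyps(3)[OF that])
    have g: "g \<in> borel_measurable m"
      by (rule borel_measurable_LIMSEQ_metric[where f = f, OF f(1)]) (simp add: space_m g_lim)
    have gB: "cmod (g x) \<le> B" if "x \<in> dual H" for x
      using fB[OF that] by (intro LIMSEQ_le_const2[OF tendsto_norm[OF g_lim[OF that]]]) auto
    have per_g: "T.periodize g \<in> L2 D"
      using per_bound[of g B, OF gB] g by (intro L2D[of _ "real r * B"] T.measurable_periodize) auto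
    have per_lim: "(\<lambda>n. T.periodize (f n) x) \<longlonglongrightarrow> T.periodize g x" if "x \<in> dual H" for x
      unfolding T.periodize_def using that by (intro tendsto_sum g_lim) (auto simp: dual_add_closed \<mu>_dual)
    have meas: "(\<lambda>x. T.periodize g x - T.periodize (f n) x) \<in> borel_measurable m" for n
      using T.measurable_periodize[OF g] T.measurable_periodize[OF f(1)[of n]] by measurable
    have lim: "(\<lambda>n. LINT x|m. w x * (cmod (T.periodize g x - T.periodize (f n) x))\<^sup>2) \<longlonglongrightarrow> (LINT x|m. 0)"
    proof (rule integral_dominated_convergence[where w = "\<lambda>x. w x * (2 * (real r * B))\<^sup>2"])
      show "AE x in m. (\<lambda>n. w x * (cmod (T.periodize g x - T.periodize (f n) x))\<^sup>2) \<longlonglongrightarrow> 0"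
      proof (intro AE_I2)
        fix x assume "x \<in> space m"
        then have "(\<lambda>n. w x * (cmod (T.periodize g x - T.periodize (f n) x))\<^sup>2) \<longlonglongrightarrow>
            w x * (cmod (T.periodize g x - T.periodize g x))\<^sup>2"
          by (intro tendsto_intros per_lim) (simp add: space_m)
        then show "(\<lambda>n. w x * (cmod (T.periodize g x - T.periodize (f n) x))\<^sup>2) \<longlonglongrightarrow> 0" by simp
      qed
      show "AE x in m. norm (w x * (cmod (T.periodize g x - T.periodize (f n) x))\<^sup>2) \<le> w x * (2 * (real r * B))\<^sup>2" for n
      proof (intro AE_I2)
        fix x assume x: "x \<in> space m"
        then have "cmod (T.periodize g x - T.periodize (f n) x) \<le> 2 * (real r * B)"
          using norm_triangle_ineq4[of "T.periodize g x" "T.periodize (f n) x"]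
            per_bound[of g B x, OF gB] per_bound[of "f n" B x, OF fB] by (simp add: space_m)
        then have "(cmod (T.periodize g x - T.periodize (f n) x))\<^sup>2 \<le> (2 * (real r * B))\<^sup>2"
          by (intro power_mono) auto
        then show "norm (w x * (cmod (T.periodize g x - T.periodize (f n) x))\<^sup>2) \<le> w x * (2 * (real r * B))\<^sup>2"
          using w(2)[OF x] by (simp add: abs_mult mult_left_mono)
      qed
      show "(\<lambda>x. w x * (cmod (T.periodize g x - T.periodize (f n) x))\<^sup>2) \<in> borel_measurable m" for n
        using meas[of n] w(1) by measurable
    qed (use w(1) in auto)
    have "T.periodize g \<in> closed_span D e M"
    proof (rule closed_span_closed[OF e_L2 per_g])
      fix \<delta> :: real assume "\<delta> > 0"
      then have "\<forall>\<^sub>F n in sequentially. (LINT x|m. w x * (cmod (T.periodize g x - T.periodize (f n) x))\<^sup>2) < \<delta>\<^sup>2"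
        using lim by (intro order_tendstoD(2)[of _ 0]) auto
      then obtain n where "(LINT x|m. w x * (cmod (T.periodize g x - T.periodize (f n) x))\<^sup>2) < \<delta>\<^sup>2"
        by (auto simp: eventually_sequentially)
      then have "(l2_norm D (\<lambda>x. T.periodize g x - T.periodize (f n) x))\<^sup>2 < \<delta>\<^sup>2"
        unfolding D_def l2_norm_density[OF w' meas] .
      then have "l2_norm D (\<lambda>x. T.periodize g x - T.periodize (f n) x) < \<delta>"
        using \<open>\<delta> > 0\<close> by (auto intro: power2_less_imp_less)
      then show "\<exists>h\<in>closed_span D e M. l2_norm D (\<lambda>x. T.periodize g x - h x) < \<delta>" using f(2) by blast
    qed
    then show ?case using g by simp
  qed
  have "p \<in> A.C"
    by (rule A.bounded_measurable_in_closure[OF space_m sets_cylinders[unfolded cylinders_def] p(1), where B = B])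
      (simp add: p(2) space_m)
  then have span: "(\<lambda>x. (1 / of_nat r) * T.periodize p x) \<in> closed_span D e M"
    using key by (intro closed_span_scale) blast
  have per_p: "(1 / of_nat r) * T.periodize p x = p x" if "x \<in> space m" for x
    using T.r_pos T.periodicD[OF p(3) _ that] by (simp add: T.periodize_def)
  have "0 < sqrt \<epsilon>" using \<open>\<epsilon> > 0\<close> by simp
  then obtain F c where F: "finite F" "F \<subseteq> M"
    "l2_norm D (\<lambda>x. (1 / of_nat r) * T.periodize p x - (\<Sum>h\<in>F. c h * e h x)) < sqrt \<epsilon>"
    using span unfolding closed_span_def by blast
  have meas: "(\<lambda>x. p x - (\<Sum>h\<in>F. c h * e h x)) \<in> borel_measurable m"
    using p(1) e_meas F(2) M(2) by (intro borel_measurable_diff borel_measurable_sum borel_measurable_times) auto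
  have "l2_norm D (\<lambda>x. (1 / of_nat r) * T.periodize p x - (\<Sum>h\<in>F. c h * e h x)) =
      l2_norm D (\<lambda>x. p x - (\<Sum>h\<in>F. c h * e h x))"
    unfolding l2_norm_def using per_p
    by (intro arg_cong[where f = sqrt] Bochner_Integration.integral_cong) (simp_all add: D space_m)
  then have "(l2_norm D (\<lambda>x. p x - (\<Sum>h\<in>F. c h * e h x)))\<^sup>2 < (sqrt \<epsilon>)\<^sup>2"
    using F(3) by (intro power_strict_mono) auto
  then have "(LINT x|m. w x * (cmod (p x - (\<Sum>h\<in>F. c h * e h x)))\<^sup>2) < \<epsilon>"
    unfolding D_def l2_norm_density[OF w' meas] using \<open>\<epsilon> > 0\<close> by simp
  then show ?thesis using F(1,2) unfolding e_def by blast
qed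

text \<open>A character lies in the translate of \<open>\<Omega>\<close> by \<open>\<mu> n\<close> if and only if translation by the inverse
  of \<open>\<mu> n\<close>, which is another \<open>\<mu> k\<close>, brings it into \<open>\<Omega>\<close>.\<close>

lemma section_tiling:
  assumes M: "M \<subseteq> H" and \<mu>: "bij_betw \<mu> {..<r} (annihilator H M)" and \<mu>0: "\<mu> 0 = dual_zero H"
    and \<Omega>: "\<Omega> \<in> sets m" "disjoint_family_on (\<lambda>n. dual_add H (\<mu> n) ` \<Omega>) {..<r}"
      "(\<Union>n<r. dual_add H (\<mu> n) ` \<Omega>) = dual H"
  shows "tiling m (\<lambda>k \<gamma>. dual_add H \<gamma> (\<mu> k)) r \<Omega>"
proof -
  interpret prob_space m by (rule prob_spaceI) (simp add: space_m emeasure_m)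
  have \<mu>_ann: "\<mu> k \<in> annihilator H M" if "k < r" for k using bij_betwE[OF \<mu>] that by auto
  have \<mu>_dual: "\<mu> k \<in> dual H" if "k < r" for k using \<mu>_ann[OF that] by (simp add: annihilator_def)
  have ann_add: "dual_add H \<gamma> \<delta> \<in> annihilator H M" if "\<gamma> \<in> annihilator H M" "\<delta> \<in> annihilator H M" for \<gamma> \<delta>
    using that M by (auto simp: annihilator_def dual_add_closed dual_add_apply subset_eq)
  have ann_neg: "dual_neg \<gamma> \<in> annihilator H M" if "\<gamma> \<in> annihilator H M" for \<gamma>
  proof -
    have "dual_neg \<gamma> \<in> dual H" using that by (intro dual_neg_closed) (simp add: annihilator_def)
    moreover have "dual_neg \<gamma> a = 1" if "a \<in> M" for a
      using \<open>\<gamma> \<in> annihilator H M\<close> M that by (auto simp: annihilator_def dual_neg_def subset_eq)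
    ultimately show ?thesis by (simp add: annihilator_def)
  qed
  have \<mu>_surj: "\<exists>k<r. \<mu> k = \<gamma>" if "\<gamma> \<in> annihilator H M" for \<gamma>
    using that \<mu> by (metis bij_betw_imp_surj_on imageE lessThan_iff)
  have \<mu>_inj: "k = l" if "k < r" "l < r" "\<mu> k = \<mu> l" for k l
    using that \<mu> by (auto simp: bij_betw_def dest: inj_onD)
  have "dual_zero H \<in> annihilator H M"
    using M dual_zero_closed by (auto simp: annihilator_def dual_zero_def subset_eq)
  then have r: "0 < r" using \<mu>_surj by fastforce
  have \<Omega>_dual: "\<Omega> \<subseteq> dual H" using sets.sets_into_space[OF \<Omega>(1)] by (simp add: space_m)
  show ?thesis
  proof
    show "0 < r" by (rule r)
    show "(\<lambda>\<gamma>. dual_add H \<gamma> (\<mu> k)) \<in> m \<rightarrow>\<^sub>M m" if "k < r" for k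
      by (rule translate_measurable[OF \<mu>_dual[OF that]])
    show "distr m m (\<lambda>\<gamma>. dual_add H \<gamma> (\<mu> k)) = m" if "k < r" for k
      by (rule distr_translate[OF \<mu>_dual[OF that]])
    show "dual_add H \<gamma> (\<mu> 0) = \<gamma>" if "\<gamma> \<in> space m" for \<gamma>
      using that by (simp add: \<mu>0 dual_add_zero space_m)
    show "dual_add H (dual_add H \<gamma> (\<mu> l)) (\<mu> k) = dual_add H (dual_add H \<gamma> (\<mu> k)) (\<mu> l)" for k l \<gamma>
      by (metis dual_add_assoc dual_add_commute)
    show "\<Omega> \<in> sets m" by (rule \<Omega>(1))
  next
    fix k assume k: "k < r"
    have "\<forall>l\<in>{..<r}. \<exists>n<r. \<mu> n = dual_add H (\<mu> k) (\<mu> l)"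
      using \<mu>_surj ann_add \<mu>_ann k by simp
    then obtain \<sigma> where \<sigma>: "\<And>l. l < r \<Longrightarrow> \<sigma> l < r \<and> \<mu> (\<sigma> l) = dual_add H (\<mu> k) (\<mu> l)"
      by (metis lessThan_iff)
    have "inj_on \<sigma> {..<r}"
    proof (rule inj_onI)
      fix l n assume ln: "l \<in> {..<r}" "n \<in> {..<r}" "\<sigma> l = \<sigma> n"
      then have "dual_add H (\<mu> l) (\<mu> k) = dual_add H (\<mu> n) (\<mu> k)"
        using \<sigma>[of l] \<sigma>[of n] by (simp add: dual_add_commute)
      then have "\<mu> l = \<mu> n"
        using ln dual_add_cancel[OF \<mu>_dual \<mu>_dual[OF k]] by (metis lessThan_iff)
      then show "l = n" using ln \<mu>_inj by simp
    qed
    moreover have "\<sigma> ` {..<r} \<subseteq> {..<r}" using \<sigma> by auto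
    ultimately have "bij_betw \<sigma> {..<r} {..<r}" by (simp add: bij_betw_def endo_inj_surj)
    moreover have "dual_add H (dual_add H \<gamma> (\<mu> k)) (\<mu> l) = dual_add H \<gamma> (\<mu> (\<sigma> l))" if "l < r" for l \<gamma>
      using \<sigma>[OF that] by (simp add: dual_add_assoc)
    ultimately show "\<exists>\<sigma>. bij_betw \<sigma> {..<r} {..<r} \<and>
        (\<forall>l<r. \<forall>\<gamma>\<in>space m. dual_add H (dual_add H \<gamma> (\<mu> k)) (\<mu> l) = dual_add H \<gamma> (\<mu> (\<sigma> l)))"
      by blast
  next
    fix \<gamma> assume "\<gamma> \<in> space m"
    then have \<gamma>: "\<gamma> \<in> dual H" by (simp add: space_m)
    have mem: "dual_add H \<gamma> (\<mu> k) \<in> \<Omega> \<longleftrightarrow> \<gamma> \<in> dual_add H (dual_neg (\<mu> k)) ` \<Omega>" if k: "k < r" for k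
    proof
      assume "dual_add H \<gamma> (\<mu> k) \<in> \<Omega>"
      moreover have "\<gamma> = dual_add H (dual_neg (\<mu> k)) (dual_add H \<gamma> (\<mu> k))"
        using dual_add_cancel[OF \<gamma> \<mu>_dual[OF k]] by (simp add: dual_add_commute)
      ultimately show "\<gamma> \<in> dual_add H (dual_neg (\<mu> k)) ` \<Omega>" by blast
    next
      assume "\<gamma> \<in> dual_add H (dual_neg (\<mu> k)) ` \<Omega>"
      then obtain \<omega> where \<omega>: "\<omega> \<in> \<Omega>" "\<gamma> = dual_add H \<omega> (dual_neg (\<mu> k))" by (auto simp: dual_add_commute)
      then show "dual_add H \<gamma> (\<mu> k) \<in> \<Omega>"
        using dual_add_cancel'[OF _ \<mu>_dual[OF k], of \<omega>] \<Omega>_dual by auto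
    qed
    have neg_neg: "dual_neg (dual_neg \<delta>) = \<delta>" if "\<delta> \<in> dual H" for \<delta>
      by (rule dual_ext[OF dual_neg_closed[OF dual_neg_closed[OF that]] that]) (simp add: dual_neg_def)
    obtain n where n: "n < r" "\<gamma> \<in> dual_add H (\<mu> n) ` \<Omega>" using \<gamma> unfolding \<Omega>(3)[symmetric] by blast
    obtain k where k: "k < r" "\<mu> k = dual_neg (\<mu> n)" using \<mu>_surj ann_neg \<mu>_ann n(1) by blast
    have k_mem: "dual_add H \<gamma> (\<mu> k) \<in> \<Omega>"
      using mem[OF k(1)] n(2) by (simp add: k(2) neg_neg[OF \<mu>_dual[OF n(1)]])
    show "\<exists>!k. k < r \<and> dual_add H \<gamma> (\<mu> k) \<in> \<Omega>"
    proof (intro ex1I[of _ k] conjI k(1) k_mem)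
      fix l assume l: "l < r \<and> dual_add H \<gamma> (\<mu> l) \<in> \<Omega>"
      obtain n' where n': "n' < r" "\<mu> n' = dual_neg (\<mu> l)" using \<mu>_surj ann_neg \<mu>_ann l by blast
      have "\<gamma> \<in> dual_add H (\<mu> n') ` \<Omega>" unfolding n'(2) using mem l by blast
      then have "n' = n" using \<Omega>(2) n n'(1) unfolding disjoint_family_on_def by blast
      then have "\<mu> l = \<mu> k" using n'(2) k(2) neg_neg[OF \<mu>_dual, of l] l by simp
      then show "l = k" using \<mu>_inj l k(1) by blast
    qed
  qed
qed

end

section \<open>The fiberization theorem\<close>

text \<open>Evaluation at an element of \<open>M\<close> is invariant under the annihilator, and such evaluations are
  orthonormal and dense. The tiling of the dual group by translates of \<open>\<Omega>\<close> thus falls under the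
  fiberization, whose matrices are those of the statement.\<close>

theorem proposition2:
  fixes H M :: "'g::{topological_ab_group_add, second_countable_topology, t2_space} set"
    and m :: "('g \<Rightarrow> complex) measure"
    and \<mu> :: "nat \<Rightarrow> 'g \<Rightarrow> complex"
    and \<Omega> :: "('g \<Rightarrow> complex) set"
    and r s :: nat
    and G :: "nat \<Rightarrow> ('g \<Rightarrow> complex) \<Rightarrow> complex"
  assumes "locally_compact_space (euclidean :: 'g topology)"
    and "uniform_lattice H" and "countable H"
    and "uniform_lattice M" and "countable M"
    and "M \<subseteq> H"
    and "normalized_haar_measure H m"
    and "bij_betw \<mu> {..<r} (annihilator H M)" and "\<mu> 0 = dual_zero H"
    and "\<Omega> \<in> sets m"
    and "disjoint_family_on (\<lambda>n. dual_add H (\<mu> n) ` \<Omega>) {..<r}"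
    and "(\<Union>n<r. dual_add H (\<mu> n) ` \<Omega>) = dual H"
    and "\<forall>j\<in>{1..s}. G j \<in> L2 m"
  shows
    "(complete_system m (modulated_system G) (M \<times> {1..s}) \<longleftrightarrow>
        (AE \<xi> in restrict_space m \<Omega>. matrix_rank (fiber_matrix H \<mu> s r G \<xi>) = r)) \<and>
     (bessel_sequence m (modulated_system G) (M \<times> {1..s}) \<longleftrightarrow>
        beta_const m \<Omega> (fiber_matrix H \<mu> s r G) < \<infinity>) \<and>
     (bessel_sequence m (modulated_system G) (M \<times> {1..s}) \<longrightarrow>
        ereal (optimal_upper_bound m (modulated_system G) (M \<times> {1..s})) =
          beta_const m \<Omega> (fiber_matrix H \<mu> s r G) / ereal (real r)) \<and>
     (frame m (modulated_system G) (M \<times> {1..s}) \<longleftrightarrow>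
        0 < alpha_const m \<Omega> (fiber_matrix H \<mu> s r G) \<and>
        alpha_const m \<Omega> (fiber_matrix H \<mu> s r G) \<le> beta_const m \<Omega> (fiber_matrix H \<mu> s r G) \<and>
        beta_const m \<Omega> (fiber_matrix H \<mu> s r G) < \<infinity>) \<and>
     (frame m (modulated_system G) (M \<times> {1..s}) \<longrightarrow>
        ereal (optimal_lower_bound m (modulated_system G) (M \<times> {1..s})) =
          alpha_const m \<Omega> (fiber_matrix H \<mu> s r G) / ereal (real r) \<and>
        ereal (optimal_upper_bound m (modulated_system G) (M \<times> {1..s})) =
          beta_const m \<Omega> (fiber_matrix H \<mu> s r G) / ereal (real r)) \<and>
     (riesz_basis m (modulated_system G) (M \<times> {1..s}) \<longleftrightarrow>
        frame m (modulated_system G) (M \<times> {1..s}) \<and> s = r)"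
proof -
  interpret D: discrete_dual H m
    using assms(2,3,7) by unfold_locales (auto simp: uniform_lattice_def)
  have M: "additive_subgroup M" using assms(4) by (simp add: uniform_lattice_def)
  have til: "tiling m (\<lambda>k \<gamma>. dual_add H \<gamma> (\<mu> k)) r \<Omega>"
    by (rule D.section_tiling[OF assms(6,8-12)])
  interpret T: tiling m "\<lambda>k \<gamma>. dual_add H \<gamma> (\<mu> k)" r \<Omega> by (rule til)
  interpret fiberization m "\<lambda>k \<gamma>. dual_add H \<gamma> (\<mu> k)" r \<Omega> "\<lambda>h \<gamma>. \<gamma> h" M s G
  proof
    fix h assume "h \<in> M"
    then have h: "h \<in> H" using assms(6) by blast
    show "(\<lambda>\<gamma>. \<gamma> h) \<in> borel_measurable m" by (rule D.character_measurable[OF h])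
    show "cmod (\<gamma> h) = 1" if "\<gamma> \<in> space m" for \<gamma> using that D.dualD(1) h by (simp add: D.space_m)
    show "T.periodic (\<lambda>\<gamma>. \<gamma> h)"
      unfolding T.periodic_def
    proof (intro allI impI ballI)
      fix k \<gamma> assume "k < r" "\<gamma> \<in> space m"
      then have "\<mu> k h = 1" using bij_betwE[OF assms(8)] \<open>h \<in> M\<close> by (auto simp: annihilator_def)
      then show "dual_add H \<gamma> (\<mu> k) h = \<gamma> h" by (simp add: D.dual_add_apply[OF h])
    qed
    fix h' assume "h' \<in> M" "h \<noteq> h'"
    then have h': "h' \<in> H" using assms(6) by blast
    have "l2_inner m (\<lambda>\<gamma>. \<gamma> h) (\<lambda>\<gamma>. \<gamma> h') = (LINT \<gamma>|m. \<gamma> (h - h'))"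
      unfolding l2_inner_def
    proof (intro Bochner_Integration.integral_cong refl)
      fix \<gamma> assume "\<gamma> \<in> space m"
      then have "\<gamma> \<in> dual H" by (simp add: D.space_m)
      then show "\<gamma> h * cnj (\<gamma> h') = \<gamma> (h - h')"
        using D.dualD(2)[of \<gamma> h "- h'"] D.dual_minus[of \<gamma> h'] D.H_closed(3)[OF h'] h h' by simp
    qed
    also have "\<dots> = 0" using D.H_closed(4)[OF h h'] \<open>h \<noteq> h'\<close> by (intro D.character_integral) auto
    finally show "l2_inner m (\<lambda>\<gamma>. \<gamma> h) (\<lambda>\<gamma>. \<gamma> h') = 0" .
  next
    fix p :: "('g \<Rightarrow> complex) \<Rightarrow> complex" and B :: real and w :: "('g \<Rightarrow> complex) \<Rightarrow> real" and \<epsilon> :: real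
    assume "p \<in> borel_measurable m" "\<And>x. x \<in> space m \<Longrightarrow> cmod (p x) \<le> B" "T.periodic p"
      "integrable m w" "\<And>x. x \<in> space m \<Longrightarrow> 0 \<le> w x" "\<epsilon> > 0"
    then show "\<exists>F c. finite F \<and> F \<subseteq> M \<and> (LINT x|m. w x * (cmod (p x - (\<Sum>i\<in>F. c i * x i)))\<^sup>2) < \<epsilon>"
      by (rule D.periodic_density[OF M assms(6,8) til])
  next
    show "G j \<in> L2 m" if "j \<in> {1..s}" for j using assms(13) that by blast
  qed
  have sys: "modulated_system G = sys" by (simp add: modulated_system_def sys_def)
  have mat: "fiber_matrix H \<mu> s r G = fib_mat"
    by (simp add: fun_eq_iff fiber_matrix_def fib_mat_def fib_def)
  have frame_bessel: "frame m sys (M \<times> {1..s}) \<Longrightarrow> bessel_sequence m sys (M \<times> {1..s})"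
    unfolding frame_def bessel_sequence_def by blast
  show ?thesis
    unfolding sys mat
    using complete_iff_rank bessel_iff_beta optimal_upper_bound_eq frame_iff_alpha_beta optimal_lower_bound_eq
      frame_bessel riesz_imp_frame frame_imp_riesz by blast
qed

end
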